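(* Let $(G,\theta)$ be a measured group such that $\theta$ has a density with respect to left Haar measure belonging to $L^p_{\mathrm c}(G)$ for some $1<p\le+\infty$. Then $(G,\theta)$ admits a universal compact Radon--Nikodym model. That is, there exist a compact $G$-space $\mathbb{G}$ and a continuous $\theta$-harmonic cocycle $\mathfrak{g}:G\times\mathbb{G}\to\mathbb{R}_{>0}$ such that for every stationary $(G,\theta)$-space $(X,\mu)$ there are a compact $G$-invariant subset $\widehat X\subseteq\mathbb{G}$ and a $\theta$-stationary Borel probability measure $\widehat\mu$ on $\widehat X$ such that $(X,\mu)$ is measurably isomorphic to $(\widehat X,\widehat\mu)$ and $\mathfrak{g}|_{G\times\widehat X}$ is a (continuous) version of the Radon--Nikodym cocycle of $(\widehat X,\widehat\mu)$.
   Context: A measured group $(G,\theta)$ is a locally compact second countable (lcsc) group $G$ with an admissible Borel probability measure $\theta$, i.e. $\theta$ is absolutely continuous with respect to Haar measure and is not supported on a closed proper subsemigroup of $G$ (equivalently $G=\overline{\bigcup_{n\ge1}\mathrm{supp}(\theta^{\ast n})}$). $L^p_{\mathrm c}(G)$ is the space of $L^p$ functions with compact support. A measurable $u:G\to\mathbb{R}$ is $\theta$-harmonic if $\int_G u(gh)\,d\theta(h)=u(g)$ for all $g$. A stationary $(G,\theta)$-space is a standard Borel space $X$ with a Borel $G$-action and a Borel probability measure $\mu$ with $\int_G g\mu\,d\theta(g)=\mu$, where $g\mu(A)=\mu(g^{-1}.A)$; then $g\mu\sim\mu$ for all $g$. A version of its Radon--Nikodym cocycle is a measurable $\varrho:G\times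 X\to\mathbb{R}_{>0}$ with $\varrho_g=\frac{dg^{-1}\mu}{d\mu}$ $\mu$-a.e. for every $g\in G$. A compact $G$-space is a compact metric space with a continuous action $G\times\mathbb{G}\to\mathbb{G}$. A cocycle on it is a map $\eta:G\times\mathbb{G}\to\mathbb{R}_{>0}$ with $\eta_{gh}(x)=\eta_g(h.x)\eta_h(x)$ for all $g,h\in G$ and all $x$; it is $\theta$-harmonic if for every $x$ the function $g\mapsto\eta_{g^{-1}}(x)$ is $\theta$-harmonic. Measurable isomorphism of $(X,\mu)$ with $(\widehat X,\widehat\mu)$ means: there are a $\mu$-conull set $X_o\subseteq X$ and an injective measurable $G$-equivariant map $\iota:X_o\to\widehat X$ (i.e. $\iota(g.x)=g.\iota(x)$ whenever $x,g.x\in X_o$) with $\iota_\ast\mu=\widehat\mu$. *)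

theory Defs
  imports "HOL-Probability.Probability"
begin

section \<open>Measured groups\<close>

text \<open>
  Groups are types of class \<^class>\<open>topological_group_add\<close>, the topological groups of the
  library. They are written additively but are not assumed commutative: \<open>g + h\<close> is the product
  $gh$, \<open>- g\<close> the inverse $g^{-1}$ and \<open>0\<close> the identity. With \<^class>\<open>second_countable_topology\<close>,
  \<^class>\<open>t2_space\<close> and \<open>locally_compact_space euclidean\<close> this gives the (Hausdorff) lcsc groups.
\<close>

text \<open>On an lcsc group, Borel measures that are finite on compact sets are regular.\<close>

definition left_haar_measure :: "'g::topological_group_add measure \<Rightarrow> bool" where
  "left_haar_measure m \<longleftrightarrow>
     sets m = sets borel \<and> emeasure m UNIV \<noteq> 0 \<and>
     (\<forall>C. compact C \<longrightarrow> emeasure m C < \<infinity>) \<and>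
     (\<forall>g. distr m m (\<lambda>x. g + x) = m)"

text \<open>Left and right Haar measures have the same null sets, so the choice of side is immaterial here.\<close>

definition admissible :: "'g::topological_group_add measure \<Rightarrow> bool" where
  "admissible \<theta> \<longleftrightarrow>
     (\<exists>m. left_haar_measure m \<and> absolutely_continuous m \<theta>) \<and>
     \<not> (\<exists>S. closed S \<and> S \<noteq> UNIV \<and> (\<forall>x\<in>S. \<forall>y\<in>S. x + y \<in> S) \<and> emeasure \<theta> S = 1)"

definition measured_group ::
  "'g::{topological_group_add, second_countable_topology, t2_space} measure \<Rightarrow> bool" where
  "measured_group \<theta> \<longleftrightarrow>
     locally_compact_space (euclidean :: 'g topology) \<and>
     sets \<theta> = sets borel \<and> prob_space \<theta> \<and> admissible \<theta>"

text \<open>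
  \<open>Lp_compact m p f\<close>: the class of \<open>f\<close> lies in $L^p_{\mathrm c}$, where \<open>p = \<infinity>\<close> is allowed. The support
  condition is up to null sets, as \<open>f\<close> is only a representative of its class.
\<close>

definition Lp_compact ::
  "'g::topological_space measure \<Rightarrow> ennreal \<Rightarrow> ('g \<Rightarrow> real) \<Rightarrow> bool" where
  "Lp_compact m p f \<longleftrightarrow>
     f \<in> borel_measurable m \<and>
     (if p = \<infinity> then \<exists>B. AE x in m. \<bar>f x\<bar> \<le> B
      else integrable m (\<lambda>x. \<bar>f x\<bar> powr enn2real p)) \<and>
     (\<exists>C. compact C \<and> (AE x in m. x \<notin> C \<longrightarrow> f x = 0))"

definition harmonic :: "'g::topological_group_add measure \<Rightarrow> ('g \<Rightarrow> real) \<Rightarrow> bool" where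
  "harmonic \<theta> u \<longleftrightarrow>
     u \<in> borel_measurable borel \<and> (\<forall>g. has_bochner_integral \<theta> (\<lambda>h. u (g + h)) (u g))"


section \<open>Stationary spaces\<close>

definition action_on :: "('g::group_add \<Rightarrow> 'x \<Rightarrow> 'x) \<Rightarrow> 'x set \<Rightarrow> bool" where
  "action_on act S \<longleftrightarrow>
     (\<forall>g. \<forall>x\<in>S. act g x \<in> S) \<and> (\<forall>x\<in>S. act 0 x = x) \<and>
     (\<forall>g h. \<forall>x\<in>S. act (g + h) x = act g (act h x))"

text \<open>The underlying measurable space of \<open>M\<close> is standard Borel; \<open>T\<close> is a Polish topology.\<close>

definition standard_borel :: "'x measure \<Rightarrow> bool" where
  "standard_borel M \<longleftrightarrow>
     (\<exists>T. completely_metrizable_space T \<and> second_countable T \<and> topspace T = space M \<and>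
          sets M = sigma_sets (topspace T) {U. openin T U})"

definition borel_action ::
  "'x measure \<Rightarrow> ('g::topological_group_add \<Rightarrow> 'x \<Rightarrow> 'x) \<Rightarrow> bool" where
  "borel_action M act \<longleftrightarrow>
     action_on act (space M) \<and> (\<lambda>(g, x). act g x) \<in> borel \<Otimes>\<^sub>M M \<rightarrow>\<^sub>M M"

definition translate ::
  "'x measure \<Rightarrow> ('g \<Rightarrow> 'x \<Rightarrow> 'x) \<Rightarrow> 'g \<Rightarrow> 'x measure" where
  "translate \<mu> act g = distr \<mu> \<mu> (act g)"

definition stationary_measure ::
  "'g measure \<Rightarrow> 'x measure \<Rightarrow> ('g \<Rightarrow> 'x \<Rightarrow> 'x) \<Rightarrow> bool" where
  "stationary_measure \<theta> \<mu> act \<longleftrightarrow>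
     prob_space \<mu> \<and>
     (\<forall>A\<in>sets \<mu>. (\<integral>\<^sup>+ g. emeasure (translate \<mu> act g) A \<partial>\<theta>) = emeasure \<mu> A)"

definition stationary_space ::
  "'g::topological_group_add measure \<Rightarrow> 'x measure \<Rightarrow> ('g \<Rightarrow> 'x \<Rightarrow> 'x) \<Rightarrow> bool" where
  "stationary_space \<theta> \<mu> act \<longleftrightarrow>
     standard_borel \<mu> \<and> borel_action \<mu> act \<and> stationary_measure \<theta> \<mu> act"

definition RN_cocycle_version ::
  "'x measure \<Rightarrow> ('g::topological_group_add \<Rightarrow> 'x \<Rightarrow> 'x) \<Rightarrow> ('g \<Rightarrow> 'x \<Rightarrow> real) \<Rightarrow> bool" where
  "RN_cocycle_version \<mu> act \<rho> \<longleftrightarrow>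
     (\<lambda>(g, x). \<rho> g x) \<in> borel_measurable (borel \<Otimes>\<^sub>M \<mu>) \<and>
     (\<forall>g. \<forall>x\<in>space \<mu>. \<rho> g x > 0) \<and>
     (\<forall>g. AE x in \<mu>. ennreal (\<rho> g x) = RN_deriv \<mu> (translate \<mu> act (- g)) x)"

definition measurably_isomorphic ::
  "'x measure \<Rightarrow> ('g \<Rightarrow> 'x \<Rightarrow> 'x) \<Rightarrow> 'y measure \<Rightarrow> ('g \<Rightarrow> 'y \<Rightarrow> 'y) \<Rightarrow> bool" where
  "measurably_isomorphic \<mu> act \<nu> act' \<longleftrightarrow>
     (\<exists>X0 \<iota>. X0 \<in> sets \<mu> \<and> space \<mu> - X0 \<in> null_sets \<mu> \<and>
        \<iota> \<in> restrict_space \<mu> X0 \<rightarrow>\<^sub>M \<nu> \<and> inj_on \<iota> X0 \<and>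
        (\<forall>g. \<forall>x\<in>X0. act g x \<in> X0 \<longrightarrow> \<iota> (act g x) = act' g (\<iota> x)) \<and>
        distr (restrict_space \<mu> X0) \<nu> \<iota> = \<nu>)"


section \<open>Compact models\<close>

definition compact_G_space ::
  "'k::metric_space set \<Rightarrow> ('g::topological_group_add \<Rightarrow> 'k \<Rightarrow> 'k) \<Rightarrow> bool" where
  "compact_G_space K act \<longleftrightarrow>
     compact K \<and> action_on act K \<and> continuous_on (UNIV \<times> K) (\<lambda>(g, x). act g x)"

definition cocycle_on ::
  "'k set \<Rightarrow> ('g::group_add \<Rightarrow> 'k \<Rightarrow> 'k) \<Rightarrow> ('g \<Rightarrow> 'k \<Rightarrow> real) \<Rightarrow> bool" where
  "cocycle_on K act \<eta> \<longleftrightarrow>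
     (\<forall>g. \<forall>x\<in>K. \<eta> g x > 0) \<and>
     (\<forall>g h. \<forall>x\<in>K. \<eta> (g + h) x = \<eta> g (act h x) * \<eta> h x)"

definition harmonic_on ::
  "'g::topological_group_add measure \<Rightarrow> 'k set \<Rightarrow> ('g \<Rightarrow> 'k \<Rightarrow> real) \<Rightarrow> bool" where
  "harmonic_on \<theta> K \<eta> \<longleftrightarrow> (\<forall>x\<in>K. harmonic \<theta> (\<lambda>g. \<eta> (- g) x))"

text \<open>
  \<open>universal_compact_RN_model TYPE('x) \<theta> K act \<eta>\<close>: the compact \<open>G\<close>-space \<open>K\<close> with the cocycle \<open>\<eta>\<close>
  is universal for the stationary spaces whose points are elements of the type \<open>'x\<close>. The type
  argument is needed because quantification over all types is not available inside a formula.

  The case \<open>'x = real\<close> already covers all stationary spaces up to renaming of points: a standard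
  Borel space has at most continuum many points, and \<^const>\<open>standard_borel\<close> refers to an arbitrary
  Polish topology on an arbitrary carrier, unrelated to the usual topology of the type. To say that
  one model, chosen independently of \<open>'x\<close>, is universal for every \<open>'x\<close>, one therefore states that
  a model for \<open>real\<close> exists and that each model for \<open>real\<close> is also one for \<open>'x\<close>.
\<close>

definition universal_compact_RN_model ::
  "'x itself \<Rightarrow> 'g::topological_group_add measure \<Rightarrow>
   'k::metric_space set \<Rightarrow> ('g \<Rightarrow> 'k \<Rightarrow> 'k) \<Rightarrow> ('g \<Rightarrow> 'k \<Rightarrow> real) \<Rightarrow> bool" where
  "universal_compact_RN_model _ \<theta> K act \<eta> \<longleftrightarrow>
     compact_G_space K act \<and>
     cocycle_on K act \<eta> \<and> harmonic_on \<theta> K \<eta> \<and>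
     continuous_on (UNIV \<times> K) (\<lambda>(g, x). \<eta> g x) \<and>
     (\<forall>(\<mu> :: 'x measure) actX. stationary_space \<theta> \<mu> actX \<longrightarrow>
        (\<exists>Xh \<mu>h.
           Xh \<subseteq> K \<and> compact Xh \<and> (\<forall>g. \<forall>x\<in>Xh. act g x \<in> Xh) \<and>
           sets \<mu>h = sets (restrict_space borel Xh) \<and> stationary_measure \<theta> \<mu>h act \<and>
           measurably_isomorphic \<mu> actX \<mu>h act \<and>
           RN_cocycle_version \<mu>h act \<eta>))"

text \<open>
  Every compact metric space is homeomorphic to a compact subset of \<open>nat \<Rightarrow> real\<close> with the product
  topology (the metric of the library on this type), so a model may be sought there.
\<close>

end

theory Submission
  imports Defs
begin

text \<open>
  For a stationary space, the Radon--Nikodym cocycle assigns to almost every point the positive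
  \<open>\<theta>\<close>-harmonic function $g \mapsto \frac{d g\mu}{d\mu}(x)$, normalised to be 1 at the identity. These functions
  form a compact set on which evaluation is continuous: admissibility gives a Harnack inequality
  for integrals over compact sets, splitting the density of \<open>\<theta>\<close> into a bounded part and a part of
  small mass turns it into a pointwise one, and continuity of translation in $L^1$ then gives
  equicontinuity. On this set the cocycle is evaluation at $g^{-1}$. To separate points, one adds
  countably many averages of the visiting functions $h \mapsto 1_U(h^{-1}x)$ over open sets of the group; they
  are uniformly continuous with a modulus that does not depend on the space, so they also range over
  a compact set.
\<close>


section \<open>Translation in $L^1$ of a left Haar measure\<close>

text \<open>Three obstacles shape the proof. First, harmonic functions are a priori only measurable
  and \<open>\<theta>\<close> may have an unbounded density, so no pointwise bound is at hand: the
  estimates are made for \<open>ennreal\<close>-valued functions, where integrals always exist, and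
  finiteness is a result. Second, the group need not be unimodular; inversion is controlled on
  compact sets only, by Tonelli, which suffices because \<open>\<theta>\<close> lives on a compact
  set. Third, the group is uncountable, so identities that hold for each group element off a null
  set must be gathered into one null set. Joint measurability turns them into statements about
  almost every group element; smoothing by \<open>\<theta>\<close> and continuity of harmonic
  functions remove the exceptional ones. The Harnack constants and the moduli of continuity depend
  on the group and \<open>\<theta>\<close> alone, and this is the source of universality.
  Quasi-invariance is derived from stationarity: the mass that translates give to a null set is a
  harmonic function vanishing at the identity, hence zero.\<close>

locale haar_measure =
  fixes m :: "'g::{topological_group_add, second_countable_topology, t2_space} measure"
  assumes locally_compact: "locally_compact_space (euclidean :: 'g topology)"
    and haar: "left_haar_measure m"
begin

lemma sets_m [measurable_cong, simp]: "sets m = sets borel"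
  using haar by (simp add: left_haar_measure_def)

lemma space_m [simp]: "space m = UNIV"
  using sets_eq_imp_space_eq[OF sets_m] by simp

lemma measurable_m [simp]: "measurable m N = measurable borel N"
  by (intro measurable_cong_sets) auto

lemma emeasure_compact_finite: "compact C \<Longrightarrow> emeasure m C < \<infinity>"
  using haar by (simp add: left_haar_measure_def)

lemma not_null_UNIV: "emeasure m UNIV \<noteq> 0"
  using haar by (simp add: left_haar_measure_def)

lemma measurable_plus_left [measurable]: "(\<lambda>h. g + h) \<in> borel_measurable (borel :: 'g measure)"
  by (intro borel_measurable_continuous_onI continuous_intros)

lemma measurable_uminus_group [measurable (raw)]:
  "a \<in> borel_measurable M \<Longrightarrow> (\<lambda>x. - a x :: 'g) \<in> borel_measurable M"
  by (rule borel_measurable_continuous_on[of uminus]) (auto intro!: continuous_intros)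

lemma measurable_minus_group [measurable (raw)]:
  assumes "a \<in> borel_measurable M" "b \<in> borel_measurable M"
  shows "(\<lambda>x. a x - b x :: 'g) \<in> borel_measurable M"
  unfolding diff_conv_add_uminus using assms by measurable

lemma distr_translate: "distr m m (\<lambda>h. g + h) = m"
  using haar by (simp add: left_haar_measure_def)

lemma nn_integral_translate:
  assumes "u \<in> borel_measurable (borel :: 'g measure)"
  shows "(\<integral>\<^sup>+h. u (g + h) \<partial>m) = (\<integral>\<^sup>+h. u h \<partial>m)"
proof -
  have "(\<integral>\<^sup>+h. u h \<partial>m) = (\<integral>\<^sup>+h. u h \<partial>distr m m (\<lambda>h. g + h))"
    by (simp only: distr_translate)
  also have "\<dots> = (\<integral>\<^sup>+h. u (g + h) \<partial>m)"
    using assms by (subst nn_integral_distr) auto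
  finally show ?thesis ..
qed

lemma AE_translate:
  assumes "AE h in m. P h"
  shows "AE h in m. P (g + h)"
proof -
  have "AE h in distr m m (\<lambda>h. g + h). P h"
    using assms by (simp only: distr_translate)
  then show ?thesis
    by (rule AE_distrD[rotated]) auto
qed

lemma compact_neighbourhood:
  fixes x :: 'g
  assumes "open W" "x \<in> W"
  obtains U K where "open U" "compact K" "x \<in> U" "U \<subseteq> K" "K \<subseteq> W"
proof -
  have Hausdorff: "Hausdorff_space (euclidean :: 'g topology)"
    unfolding Hausdorff_space_def by (simp add: disjnt_def) (metis hausdorff)
  have "neighbourhood_base_of (compactin euclidean) (euclidean :: 'g topology)"
    using locally_compact locally_compact_space_neighbourhood_base[of "euclidean :: 'g topology"]
      Hausdorff by simp
  then show ?thesis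
    using assms that unfolding neighbourhood_base_of by (simp) metis
qed

text \<open>Local compactness covers \<open>W\<close> by open sets lying in compact subsets of
  \<open>W\<close>; Lindelof makes the cover countable, finite unions make it increasing. With
  continuity from below this supplies the inner regularity of \<open>m\<close> on open sets.\<close>

lemma open_eq_Union_compact:
  fixes W :: "'g set"
  assumes "open W"
  obtains K :: "nat \<Rightarrow> 'g set" and U :: "nat \<Rightarrow> 'g set"
  where "incseq K" "incseq U" "\<And>n. compact (K n)" "\<And>n. open (U n)" "\<And>n. U n \<subseteq> K n"
    "(\<Union>n. K n) = W" "(\<Union>n. U n) = W"
proof -
  define \<U> where "\<U> = {U. open U \<and> (\<exists>K. compact K \<and> U \<subseteq> K \<and> K \<subseteq> W)}"
  have "\<Union>\<U> = W"
  proof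
    show "W \<subseteq> \<Union>\<U>"
    proof
      fix x assume "x \<in> W"
      obtain U K where "open U" "compact K" "x \<in> U" "U \<subseteq> K" "K \<subseteq> W"
        using compact_neighbourhood[OF assms \<open>x \<in> W\<close>] .
      then show "x \<in> \<Union>\<U>"
        unfolding \<U>_def by blast
    qed
  qed (auto simp: \<U>_def)
  moreover have "\<And>U. U \<in> \<U> \<Longrightarrow> open U"
    by (simp add: \<U>_def)
  ultimately obtain \<V> where \<V>: "\<V> \<subseteq> \<U>" "countable \<V>" "\<Union>\<V> = W"
    using Lindelof[of \<U>] by metis
  define B where "B n = (if \<V> = {} then {} else from_nat_into \<V> n)" for n
  have "range B = (if \<V> = {} then {{}} else \<V>)"
    using range_from_nat_into[OF _ \<V>(2)] by (auto simp: B_def fun_eq_iff)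
  then have BU: "(\<Union>n. B n) = W"
    using \<V>(3) by auto
  have "B n \<in> \<U>" for n
    using \<V>(1) from_nat_into[of \<V> n] by (cases "\<V> = {}") (auto simp: B_def \<U>_def)
  then obtain K where K: "open (B n)" "compact (K n)" "B n \<subseteq> K n" "K n \<subseteq> W" for n
    unfolding \<U>_def mem_Collect_eq by metis
  have UN_atMost: "(\<Union>n. \<Union>i\<le>n. A i) = (\<Union>n. A n)" for A :: "nat \<Rightarrow> 'g set"
    by auto
  show ?thesis
  proof (rule that[of "\<lambda>n. \<Union>i\<le>n. K i" "\<lambda>n. \<Union>i\<le>n. B i"])
    show "incseq (\<lambda>n. \<Union>i\<le>n. K i)" "incseq (\<lambda>n. \<Union>i\<le>n. B i)"
      by (force simp: incseq_def)+
    show "compact (\<Union>i\<le>n. K i)" "open (\<Union>i\<le>n. B i)" for n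
      using K by (auto intro!: compact_UN)
    show "(\<Union>i\<le>n. B i) \<subseteq> (\<Union>i\<le>n. K i)" for n
      by (intro UN_mono K) auto
    show "(\<Union>n. \<Union>i\<le>n. B i) = W"
      unfolding BU[symmetric] by (rule UN_atMost)
    show "(\<Union>n. \<Union>i\<le>n. K i) = W"
      unfolding UN_atMost using BU K(3,4) by (intro equalityI) (auto, blast)
  qed
qed

lemma sigma_compact:
  obtains K :: "nat \<Rightarrow> 'g set" where "\<And>n. compact (K n)" "(\<Union>n. K n) = UNIV"
  using open_eq_Union_compact[of UNIV] by (metis open_UNIV)

lemma compact_imp_borel: "compact (K :: 'g set) \<Longrightarrow> K \<in> sets borel"
  by (simp add: borel_closed compact_imp_closed)

sublocale sigma_finite_measure m
proof -
  obtain K :: "nat \<Rightarrow> 'g set" where K: "\<And>n. compact (K n)" "(\<Union>n. K n) = UNIV"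
    using sigma_compact by metis
  show "sigma_finite_measure m"
    by standard (rule exI[of _ "range K"],
        use K emeasure_compact_finite compact_imp_borel in \<open>auto simp: less_top[symmetric]\<close>)
qed

text \<open>The L^1 distance from \<open>a\<close> to a left translate; every modulus of continuity
  below has this form.\<close>

definition shift_diff :: "('g \<Rightarrow> real) \<Rightarrow> 'g \<Rightarrow> ennreal" where
  "shift_diff a g = (\<integral>\<^sup>+h. ennreal \<bar>a (g + h) - a h\<bar> \<partial>m)"

definition shift_continuous :: "('g \<Rightarrow> real) \<Rightarrow> bool" where
  "shift_continuous a \<longleftrightarrow> a \<in> borel_measurable borel \<and> (shift_diff a \<longlongrightarrow> 0) (nhds 0)"

lemma shift_diff_add_le:
  assumes [measurable]: "a \<in> borel_measurable borel" "b \<in> borel_measurable borel"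
  shows "shift_diff (\<lambda>x. a x + b x) g \<le> shift_diff a g + shift_diff b g"
proof -
  have "shift_diff (\<lambda>x. a x + b x) g
      \<le> (\<integral>\<^sup>+h. ennreal \<bar>a (g + h) - a h\<bar> + ennreal \<bar>b (g + h) - b h\<bar> \<partial>m)"
    unfolding shift_diff_def
    by (intro nn_integral_mono) (simp add: ennreal_plus[symmetric] del: ennreal_plus)
  also have "\<dots> = shift_diff a g + shift_diff b g"
    unfolding shift_diff_def by (intro nn_integral_add) measurable
  finally show ?thesis .
qed

lemma shift_continuous_add:
  assumes "shift_continuous a" "shift_continuous b"
  shows "shift_continuous (\<lambda>x. a x + b x)"
  unfolding shift_continuous_def
proof
  have [measurable]: "a \<in> borel_measurable borel" "b \<in> borel_measurable borel"
    using assms by (auto simp: shift_continuous_def)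
  show "(\<lambda>x. a x + b x) \<in> borel_measurable borel" by measurable
  have "((\<lambda>g. shift_diff a g + shift_diff b g) \<longlongrightarrow> 0 + 0) (nhds 0)"
    using assms unfolding shift_continuous_def by (intro tendsto_add) auto
  then have "((\<lambda>g. shift_diff a g + shift_diff b g) \<longlongrightarrow> 0) (nhds 0)"
    by simp
  then show "(shift_diff (\<lambda>x. a x + b x) \<longlongrightarrow> 0) (nhds 0)"
    by (rule tendsto_sandwich[OF always_eventually always_eventually tendsto_const, rotated 2])
       (simp_all only: zero_le shift_diff_add_le \<open>a \<in> _\<close> \<open>b \<in> _\<close> simp_thms)
qed

lemma shift_continuous_mult:
  assumes "shift_continuous a"
  shows "shift_continuous (\<lambda>x. c * a x)"
  unfolding shift_continuous_def
proof
  have [measurable]: "a \<in> borel_measurable borel"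
    using assms by (auto simp: shift_continuous_def)
  show "(\<lambda>x. c * a x) \<in> borel_measurable borel" by measurable
  have *: "shift_diff (\<lambda>x. c * a x) = (\<lambda>g. ennreal \<bar>c\<bar> * shift_diff a g)"
    unfolding shift_diff_def
    by (subst nn_integral_cmult[symmetric])
       (auto simp: ennreal_mult[symmetric] abs_mult[symmetric] algebra_simps)
  have "((\<lambda>g. ennreal \<bar>c\<bar> * shift_diff a g) \<longlongrightarrow> ennreal \<bar>c\<bar> * 0) (nhds 0)"
    using assms unfolding shift_continuous_def by (intro ennreal_tendsto_cmult) auto
  then show "(shift_diff (\<lambda>x. c * a x) \<longlongrightarrow> 0) (nhds 0)"
    unfolding * by simp
qed

text \<open>By left invariance the translates of \<open>a\<close> and \<open>s\<close> are as close
  as \<open>a\<close> and \<open>s\<close> themselves, so the three-term estimate is uniform in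
  \<open>g\<close>.\<close>

lemma shift_continuous_limit:
  assumes [measurable]: "a \<in> borel_measurable borel"
    and approx: "\<And>e::real. e > 0 \<Longrightarrow> \<exists>s. shift_continuous s \<and> (\<integral>\<^sup>+x. ennreal \<bar>a x - s x\<bar> \<partial>m) \<le> ennreal e"
  shows "shift_continuous a"
  unfolding shift_continuous_def
proof
  show "(shift_diff a \<longlongrightarrow> 0) (nhds 0)"
  proof (rule tendsto_zero_ennreal)
    fix r :: real assume "r > 0"
    then obtain s where s: "shift_continuous s" "(\<integral>\<^sup>+x. ennreal \<bar>a x - s x\<bar> \<partial>m) \<le> ennreal (r/4)"
      using approx[of "r/4"] by auto
    then have [measurable]: "s \<in> borel_measurable borel"
      by (auto simp: shift_continuous_def)
    have "eventually (\<lambda>g. shift_diff s g < ennreal (r/4)) (nhds 0)"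
      using s(1) \<open>r > 0\<close> unfolding shift_continuous_def by (auto intro: order_tendstoD)
    then show "eventually (\<lambda>g. shift_diff a g < ennreal r) (nhds 0)"
    proof eventually_elim
      case (elim g)
      have "shift_diff a g \<le> (\<integral>\<^sup>+h. (ennreal \<bar>a (g+h) - s (g+h)\<bar> + ennreal \<bar>s (g + h) - s h\<bar>) + ennreal \<bar>a h - s h\<bar> \<partial>m)"
        unfolding shift_diff_def
        by (intro nn_integral_mono) (simp add: ennreal_plus[symmetric] del: ennreal_plus)
      also have "\<dots> = (\<integral>\<^sup>+h. ennreal \<bar>a (g+h) - s (g+h)\<bar> \<partial>m) + shift_diff s g + (\<integral>\<^sup>+h. ennreal \<bar>a h - s h\<bar> \<partial>m)"
        unfolding shift_diff_def by (simp add: nn_integral_add)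
      also have "(\<integral>\<^sup>+h. ennreal \<bar>a (g+h) - s (g+h)\<bar> \<partial>m) = (\<integral>\<^sup>+h. ennreal \<bar>a h - s h\<bar> \<partial>m)"
        by (rule nn_integral_translate) measurable
      also have "(\<integral>\<^sup>+h. ennreal \<bar>a h - s h\<bar> \<partial>m) + shift_diff s g + (\<integral>\<^sup>+h. ennreal \<bar>a h - s h\<bar> \<partial>m)
          \<le> ennreal (r/4) + ennreal (r/4) + ennreal (r/4)"
        using s(2) elim by (intro add_mono) auto
      also have "\<dots> < ennreal r"
        using \<open>r > 0\<close> by (simp add: ennreal_plus[symmetric] ennreal_lessI del: ennreal_plus)
      finally show ?case .
    qed
  qed
qed fact

text \<open>The tube lemma for the preimage of \<open>W\<close> under addition.\<close>

lemma translate_compact_subset_open: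
  fixes K W :: "'g set"
  assumes "compact K" "open W" "K \<subseteq> W"
  shows "eventually (\<lambda>g. \<forall>k\<in>K. g + k \<in> W) (nhds 0)"
proof -
  have "continuous_on UNIV (\<lambda>p::'g\<times>'g. fst p + snd p)"
    by (intro continuous_intros)
  then have op: "open ((\<lambda>p::'g\<times>'g. fst p + snd p) -` W)"
    using assms(2) by (simp add: open_vimage)
  have "{0} \<times> K \<subseteq> (\<lambda>p. fst p + snd p) -` W"
    using assms(3) by auto
  then obtain X0 where "0 \<in> X0" "open X0" "X0 \<times> K \<subseteq> (\<lambda>p. fst p + snd p) -` W"
    using Elementary_Topology.tube_lemma[OF assms(1) op] by blast
  then show ?thesis
    unfolding eventually_nhds by (intro exI[of _ X0]) auto
qed

lemma translate_image_borel: "A \<in> sets borel \<Longrightarrow> (\<lambda>h. g + h) -` A \<in> sets (borel :: 'g measure)"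
  using measurable_sets[OF measurable_plus_left[of g]] by simp

lemma emeasure_translate:
  "A \<in> sets borel \<Longrightarrow> emeasure m ((\<lambda>h. g + h) -` A) = emeasure m A"
  using emeasure_distr[of "\<lambda>h. g + h" m m A] by (simp add: distr_translate)

lemma eventually_nhds_uminus:
  fixes P :: "'g \<Rightarrow> bool"
  assumes "eventually P (nhds 0)"
  shows "eventually (\<lambda>g. P (- g)) (nhds 0)"
proof -
  have "((\<lambda>g::'g. - g) \<longlongrightarrow> - 0) (nhds 0)"
    by (intro tendsto_minus) (simp add: filterlim_ident)
  then show ?thesis
    using assms unfolding filterlim_iff by auto
qed

lemma incseq_exhaust:
  assumes "range B \<subseteq> sets borel" "incseq B" "emeasure m (\<Union>n. B n) < \<infinity>" "(0::real) < e"
  obtains n where "emeasure m ((\<Union>n. B n) - B n) \<le> ennreal e"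
proof -
  let ?W = "\<Union>n. B n"
  have lim: "(\<lambda>n. emeasure m (B n)) \<longlonglongrightarrow> emeasure m ?W"
    using Lim_emeasure_incseq[of B m] assms by simp
  have "emeasure m ?W < emeasure m ?W + ennreal e"
    using assms(3,4) by (cases "emeasure m ?W")
      (auto simp: ennreal_plus[symmetric] ennreal_less_iff simp del: ennreal_plus)
  moreover have "(\<lambda>n. emeasure m (B n) + ennreal e) \<longlonglongrightarrow> emeasure m ?W + ennreal e"
    by (intro tendsto_add lim tendsto_const)
  ultimately have "eventually (\<lambda>n. emeasure m ?W < emeasure m (B n) + ennreal e) sequentially"
    by (intro order_tendstoD(1))
  then obtain n where n: "emeasure m ?W < emeasure m (B n) + ennreal e"
    by (auto simp: eventually_sequentially)
  have "emeasure m (B n) \<le> emeasure m ?W"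
    using assms(1) by (intro emeasure_mono) auto
  then have "emeasure m (?W - B n) = emeasure m ?W - emeasure m (B n)"
    using assms(1,3) by (intro emeasure_Diff) auto
  also have "\<dots> \<le> ennreal e"
    using n assms(3) by (auto simp: ennreal_minus_le_iff add.commute less_imp_le)
  finally show ?thesis by (rule that)
qed

text \<open>Let the compact \<open>K n\<close> fill \<open>W\<close> up to a small error. A small
  translation keeps \<open>K n\<close> inside \<open>W\<close> and preserves its measure, so the
  translate of \<open>W\<close> misses only a small part of \<open>W\<close>.\<close>

lemma shift_continuous_open:
  fixes W :: "'g set"
  assumes W: "open W" and fin: "emeasure m W < \<infinity>"
  shows "shift_continuous (indicator W)"
  unfolding shift_continuous_def
proof
  have Wm [measurable]: "W \<in> sets borel" using W by simp
  show "(indicator W :: 'g \<Rightarrow> real) \<in> borel_measurable borel" by measurable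
  show "(shift_diff (indicator W) \<longlongrightarrow> 0) (nhds 0)"
  proof (rule tendsto_zero_ennreal)
    fix r :: real assume r: "r > 0"
    obtain K U :: "nat \<Rightarrow> 'g set" where K: "incseq K" "\<And>n. compact (K n)" "(\<Union>n. K n) = W"
      using open_eq_Union_compact[OF W] by metis
    have Km [measurable]: "K n \<in> sets borel" for n
      using K(2) compact_imp_borel by auto
    have "range K \<subseteq> sets borel"
      using Km by auto
    then obtain n where n: "emeasure m (W - K n) \<le> ennreal (r/3)"
      using incseq_exhaust[of K "r/3"] K(1) fin r unfolding K(3) by auto
    have KW: "K n \<subseteq> W" using K by auto
    have bound: "emeasure m (W - (\<lambda>h. g + h) -` W) \<le> ennreal (r/3)"
      if g: "\<forall>k\<in>K n. - g + k \<in> W" for g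
    proof -
      have sub: "(\<lambda>h. g + h) -` K n \<subseteq> W"
      proof
        fix h assume "h \<in> (\<lambda>h. g + h) -` K n"
        then have "- g + (g + h) \<in> W" using g by blast
        then show "h \<in> W" by (simp add: add.assoc[symmetric])
      qed
      have "emeasure m (W - (\<lambda>h. g + h) -` W) \<le> emeasure m (W - (\<lambda>h. g + h) -` K n)"
        using KW by (intro emeasure_mono) (auto intro!: sets.Diff translate_image_borel)
      also have "\<dots> = emeasure m W - emeasure m (K n)"
        using sub emeasure_compact_finite[OF K(2)[of n]]
        by (subst emeasure_Diff) (auto simp: emeasure_translate intro: translate_image_borel)
      also have "\<dots> = emeasure m (W - K n)"
        using KW emeasure_compact_finite[OF K(2)[of n]] by (subst emeasure_Diff) auto
      finally show ?thesis using n by simp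
    qed
    have ev: "eventually (\<lambda>g. \<forall>k\<in>K n. g + k \<in> W) (nhds 0)"
      by (rule translate_compact_subset_open) (use K W KW in auto)
    show "eventually (\<lambda>g. shift_diff (indicator W) g < ennreal r) (nhds 0)"
      using ev eventually_nhds_uminus[OF ev]
    proof eventually_elim
      case (elim g)
      \<comment> \<open>Translation turns the other half of the symmetric difference into the first
        half for \<open>- g\<close>; hence the bound is needed at both \<open>g\<close> and
        \<open>- g\<close>.\<close>
      have swap: "emeasure m ((\<lambda>h. g + h) -` W - W) = emeasure m (W - (\<lambda>h. - g + h) -` W)"
      proof -
        have "(\<lambda>h. g + h) -` (W - (\<lambda>h. - g + h) -` W) = (\<lambda>h. g + h) -` W - W"
          by (auto simp: add.assoc[symmetric])
        then show ?thesis
          using emeasure_translate[of "W - (\<lambda>h. - g + h) -` W" g] translate_image_borel[OF Wm]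
          by (metis Wm sets.Diff)
      qed
      have "shift_diff (indicator W) g
          = (\<integral>\<^sup>+h. indicator ((\<lambda>h. g + h) -` W - W) h + indicator (W - (\<lambda>h. g + h) -` W) h \<partial>m)"
        unfolding shift_diff_def by (intro nn_integral_cong) (auto simp: indicator_def)
      also have "\<dots> = emeasure m ((\<lambda>h. g + h) -` W - W) + emeasure m (W - (\<lambda>h. g + h) -` W)"
        using translate_image_borel[OF Wm, of g]
        by (subst nn_integral_add) auto
      also have "\<dots> \<le> ennreal (r/3) + ennreal (r/3)"
        unfolding swap using bound[of g] bound[of "- g"] elim by (intro add_mono) auto
      also have "\<dots> < ennreal r"
        using r by (simp add: ennreal_plus[symmetric] ennreal_lessI del: ennreal_plus)
      finally show ?case .
    qed
  qed
qed

lemma shift_continuous_incseq: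
  assumes B: "range B \<subseteq> sets borel" "incseq B" "emeasure m (\<Union>n. B n) < \<infinity>"
    and sc: "\<And>n. shift_continuous (indicator (B n))"
  shows "shift_continuous (indicator (\<Union>n. B n))"
proof (rule shift_continuous_limit)
  show "(indicator (\<Union>n. B n) :: 'g \<Rightarrow> real) \<in> borel_measurable borel"
    using B(1) by (intro borel_measurable_indicator) auto
  fix e :: real assume "e > 0"
  then obtain n where n: "emeasure m ((\<Union>n. B n) - B n) \<le> ennreal e"
    using incseq_exhaust[OF B] by auto
  have "(\<integral>\<^sup>+x. ennreal \<bar>indicat_real (\<Union>n. B n) x - indicat_real (B n) x\<bar> \<partial>m)
      = (\<integral>\<^sup>+x. indicator ((\<Union>n. B n) - B n) x \<partial>m)"
    by (intro nn_integral_cong) (auto simp: indicator_def)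
  also have "\<dots> = emeasure m ((\<Union>n. B n) - B n)"
    using B(1) by (intro nn_integral_indicator) auto
  finally show "\<exists>s. shift_continuous s \<and>
      (\<integral>\<^sup>+x. ennreal \<bar>indicat_real (\<Union>n. B n) x - s x\<bar> \<partial>m) \<le> ennreal e"
    using sc n by (intro exI[of _ "indicator (B n)"]) simp
qed

text \<open>A Dynkin argument from open sets. It is run inside each \<open>U n\<close>, since the
  complement of a set of finite measure may have infinite measure; the increasing union over
  \<open>n\<close> then recovers \<open>A\<close>.\<close>

lemma shift_continuous_indicator:
  assumes A: "A \<in> sets borel" and fin: "emeasure m A < \<infinity>"
  shows "shift_continuous (indicator A)"
proof -
  obtain K U :: "nat \<Rightarrow> 'g set" where U: "incseq U" "\<And>n. open (U n)" "(\<Union>n. U n) = UNIV"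
    and K: "\<And>n. compact (K n)" "\<And>n. U n \<subseteq> K n"
    using open_eq_Union_compact[of UNIV] by (metis open_UNIV)
  have Ufin: "emeasure m (X \<inter> U n) < \<infinity>" for n X
  proof -
    have "emeasure m (X \<inter> U n) \<le> emeasure m (K n)"
      using K compact_imp_borel by (intro emeasure_mono) auto
    then show ?thesis
      using emeasure_compact_finite[OF K(1)[of n]] by (auto intro: le_less_trans)
  qed
  have step: "shift_continuous (indicator (X \<inter> U n))" if "X \<in> sets borel" for X n
  proof -
    have "X \<in> sigma_sets UNIV {S :: 'g set. open S}"
      using that by (simp add: borel_def sets_measure_of)
    then show ?thesis
    proof (induction rule: sigma_sets_induct_disjoint[rotated 2, consumes 1, case_names basic empty compl union stable sub])
      case (basic X)
      then show ?case
        using U Ufin by (intro shift_continuous_open) auto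
    next
      case empty
      then show ?case
        using shift_continuous_mult[OF shift_continuous_open[of "{}"], of 0] by simp
    next
      case (compl X)
      have "shift_continuous (\<lambda>x. indicator (U n) x + (-1) * indicator (X \<inter> U n) x)"
        using U Ufin[of UNIV n]
        by (intro shift_continuous_add shift_continuous_mult compl.IH shift_continuous_open) auto
      also have "(\<lambda>x. indicat_real (U n) x + (-1) * indicator (X \<inter> U n) x) = indicator ((UNIV - X) \<inter> U n)"
        by (auto simp: indicator_def fun_eq_iff)
      finally show ?case .
    next
      case (union X)
      have Xb: "X i \<in> sets borel" for i
        using union(2) by (auto simp: borel_def sets_measure_of)
      have fin_union: "shift_continuous (indicator (\<Union>i<k. X i \<inter> U n))" for k
      proof (induction k)
        case 0
        then show ?case
          using shift_continuous_mult[OF shift_continuous_open[of "{}"], of 0] by simp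
      next
        case (Suc k)
        have "shift_continuous (\<lambda>x. indicator (\<Union>i<k. X i \<inter> U n) x + indicator (X k \<inter> U n) x)"
          by (intro shift_continuous_add Suc union)
        also have "(\<lambda>x. indicat_real (\<Union>i<k. X i \<inter> U n) x + indicator (X k \<inter> U n) x)
            = indicator (\<Union>i<Suc k. X i \<inter> U n)"
        proof
          fix x
          have "x \<notin> X i" if "x \<in> X k" "i < k" for i
            using union(1) that unfolding disjoint_family_on_def
            by (metis IntI UNIV_I empty_iff less_irrefl)
          then show "indicat_real (\<Union>i<k. X i \<inter> U n) x + indicator (X k \<inter> U n) x
              = indicator (\<Union>i<Suc k. X i \<inter> U n) x"
            by (auto simp: indicator_def less_Suc_eq)
        qed
        finally show ?case .
      qed
      have eq: "(\<Union>k. \<Union>i<k. X i \<inter> U n) = (\<Union>i. X i) \<inter> U n"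
        by auto
      have "shift_continuous (indicator (\<Union>k. \<Union>i<k. X i \<inter> U n))"
      proof (rule shift_continuous_incseq)
        show "incseq (\<lambda>k. \<Union>i<k. X i \<inter> U n)"
          by (force simp: incseq_def)
        show "emeasure m (\<Union>k. \<Union>i<k. X i \<inter> U n) < \<infinity>"
          unfolding eq by (rule Ufin)
        show "range (\<lambda>k. \<Union>i<k. X i \<inter> U n) \<subseteq> sets borel"
          using Xb U(2) by auto
      qed (rule fin_union)
      then show ?case unfolding eq .
    qed (auto simp: Int_stable_def)
  qed
  have eq: "(\<Union>n. A \<inter> U n) = A"
    using U(3) by auto
  have "shift_continuous (indicator (\<Union>n. A \<inter> U n))"
  proof (rule shift_continuous_incseq)
    show "incseq (\<lambda>n. A \<inter> U n)"
      using U(1) by (force simp: incseq_def)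
    show "range (\<lambda>n. A \<inter> U n) \<subseteq> sets borel"
      using A U(2) by auto
  qed (use fin eq step A in auto)
  then show ?thesis unfolding eq .
qed

theorem integrable_imp_shift_continuous:
  assumes "integrable m a"
  shows "shift_continuous a"
  using assms
proof (induction rule: integrable_induct)
  case (base A c)
  then have "shift_continuous (\<lambda>x. c * indicator A x)"
    by (intro shift_continuous_mult shift_continuous_indicator) auto
  then show ?case by (simp add: mult.commute)
next
  case (add a b)
  then show ?case by (intro shift_continuous_add)
next
  case (lim a s)
  show ?case
  proof (rule shift_continuous_limit)
    show "a \<in> borel_measurable borel"
      using lim.hyps(4) by (auto dest: borel_measurable_integrable)
    fix e :: real assume "e > 0"
    have [measurable]: "a \<in> borel_measurable borel" "\<And>i. s i \<in> borel_measurable borel"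
      using lim.hyps(1,4) by (auto dest: borel_measurable_integrable)
    have "(\<lambda>i. \<integral>\<^sup>+x. ennreal (norm (a x - s i x)) \<partial>m) \<longlonglongrightarrow> 0"
    proof (rule nn_integral_dominated_convergence_norm[where w = "\<lambda>x. 2 * norm (a x)"])
      show "(\<integral>\<^sup>+x. ennreal (2 * norm (a x)) \<partial>m) < \<infinity>"
        using integrable_mult_right[OF lim.hyps(4), of 2]
        unfolding integrable_iff_bounded by (simp add: abs_mult)
    qed (use lim.hyps(2,3) in auto)
    then have "eventually (\<lambda>i. (\<integral>\<^sup>+x. ennreal (norm (a x - s i x)) \<partial>m) < ennreal e) sequentially"
      using \<open>e > 0\<close> by (intro order_tendstoD(2)) auto
    then obtain i where "(\<integral>\<^sup>+x. ennreal (norm (a x - s i x)) \<partial>m) < ennreal e"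
      by (auto simp: eventually_sequentially)
    then show "\<exists>s. shift_continuous s \<and> (\<integral>\<^sup>+x. ennreal \<bar>a x - s x\<bar> \<partial>m) \<le> ennreal e"
      using lim.IH by (intro exI[of _ "s i"]) (auto simp: less_imp_le)
  qed
qed

end

text \<open>Serves one recurring device: a quantity is multiplied by the mass \<open>b\<close> of a
  set, written as an integral over that set, estimated there, and divided by \<open>b\<close>
  again.\<close>

lemma ennreal_le_inverse_mult:
  fixes b I J :: ennreal
  assumes "b \<noteq> 0" "b \<noteq> \<top>" "b * I \<le> J"
  shows "I \<le> inverse b * J"
proof -
  have "inverse b * b = 1"
    using assms(1,2) ennreal_divide_self[of b] by (simp add: divide_ennreal_def mult.commute less_top)
  then have "I = inverse b * (b * I)"
    by (simp add: mult.assoc[symmetric])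
  also have "\<dots> \<le> inverse b * J"
    by (intro mult_left_mono assms) auto
  finally show ?thesis .
qed

lemma ennreal_inverse_neq_top: "b \<noteq> 0 \<Longrightarrow> inverse b \<noteq> (\<top> :: ennreal)"
  by (simp add: ennreal_inverse_eq_top_iff)

section \<open>Inversion and right translation on a possibly non-unimodular group\<close>

context haar_measure
begin

sublocale mm: pair_sigma_finite m m ..

lemma pos_compact:
  obtains B :: "'g set" where "compact B" "emeasure m B \<noteq> 0"
proof -
  obtain K :: "nat \<Rightarrow> 'g set" where K: "\<And>n. compact (K n)" "(\<Union>n. K n) = UNIV"
    using sigma_compact by metis
  have "\<exists>n. emeasure m (K n) \<noteq> 0"
  proof (rule ccontr)
    assume "\<not> ?thesis"
    then have "(\<Union>n. K n) \<in> null_sets m"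
      using K(1) compact_imp_borel by (intro null_sets_UN) auto
    then show False
      using K(2) not_null_UNIV by auto
  qed
  then show ?thesis using K that by blast
qed

lemma compact_plus: "compact A \<Longrightarrow> compact B \<Longrightarrow> compact {a + b |a b. a \<in> A \<and> b \<in> (B :: 'g set)}"
proof -
  assume "compact A" "compact B"
  then have "compact ((\<lambda>p. fst p + snd p) ` (A \<times> B))"
    by (intro compact_continuous_image compact_Times continuous_intros)
  also have "(\<lambda>p. fst p + snd p) ` (A \<times> B) = {a + b |a b. a \<in> A \<and> b \<in> B}"
    by force
  finally show ?thesis .
qed

lemma compact_uminus: "compact A \<Longrightarrow> compact (uminus ` (A :: 'g set))"
  by (intro compact_continuous_image continuous_intros)

text \<open>
  This replaces the modular function: on a compact set, the right Haar measure is dominated by a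
  multiple of the left one.
\<close>

lemma nn_integral_uminus_le:
  assumes "compact C"
  obtains D where "D \<noteq> \<top>" "\<And>a. a \<in> borel_measurable (borel :: 'g measure) \<Longrightarrow> (\<And>x. x \<notin> C \<Longrightarrow> a x = 0) \<Longrightarrow>
    (\<integral>\<^sup>+h. a (- h) \<partial>m) \<le> D * (\<integral>\<^sup>+h. a h \<partial>m)"
proof -
  obtain B :: "'g set" where B: "compact B" "emeasure m B \<noteq> 0"
    using pos_compact .
  have [measurable]: "B \<in> sets borel"
    using B compact_imp_borel by auto
  define E where "E = {b + c |b c. b \<in> B \<and> c \<in> uminus ` C}"
  have E: "compact E"
    unfolding E_def by (intro compact_plus compact_uminus assms B)
  then have [measurable]: "E \<in> sets borel"
    using compact_imp_borel by auto
  show ?thesis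
  proof (rule that[of "inverse (emeasure m B) * emeasure m E"])
    show "inverse (emeasure m B) * emeasure m E \<noteq> \<top>"
      using B(2) emeasure_compact_finite[OF E]
      by (auto simp: ennreal_mult_eq_top_iff ennreal_inverse_eq_top_iff)
    fix a :: "'g \<Rightarrow> ennreal" assume [measurable]: "a \<in> borel_measurable borel"
      and a0: "\<And>x. x \<notin> C \<Longrightarrow> a x = 0"
    have "emeasure m B * (\<integral>\<^sup>+h. a (- h) \<partial>m) = (\<integral>\<^sup>+x. indicator B x * (\<integral>\<^sup>+h. a (- h) \<partial>m) \<partial>m)"
      by (subst nn_integral_multc) auto
    also have "\<dots> = (\<integral>\<^sup>+x. \<integral>\<^sup>+h. indicator B x * a (- h + x) \<partial>m \<partial>m)"
    proof (intro nn_integral_cong)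
      fix x
      have "(\<integral>\<^sup>+h. a (- h) \<partial>m) = (\<integral>\<^sup>+h. a (- (- x + h)) \<partial>m)"
        by (rule nn_integral_translate[symmetric]) measurable
      then show "indicator B x * (\<integral>\<^sup>+h. a (- h) \<partial>m) = (\<integral>\<^sup>+h. indicator B x * a (- h + x) \<partial>m)"
        by (subst nn_integral_cmult) (auto simp: minus_add)
    qed
    also have "\<dots> = (\<integral>\<^sup>+h. \<integral>\<^sup>+x. indicator B x * a (- h + x) \<partial>m \<partial>m)"
      by (rule mm.Fubini') measurable
    also have "\<dots> = (\<integral>\<^sup>+h. \<integral>\<^sup>+x. indicator B (h + x) * a x \<partial>m \<partial>m)"
    proof (rule nn_integral_cong)
      fix h
      have "(\<integral>\<^sup>+x. indicator B x * a (- h + x) \<partial>m) = (\<integral>\<^sup>+x. indicator B (h + x) * a (- h + (h + x)) \<partial>m)"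
        by (rule nn_integral_translate[symmetric]) measurable
      then show "(\<integral>\<^sup>+x. indicator B x * a (- h + x) \<partial>m) = (\<integral>\<^sup>+x. indicator B (h + x) * a x \<partial>m)"
        by (simp add: add.assoc[symmetric])
    qed
    also have "\<dots> = (\<integral>\<^sup>+x. \<integral>\<^sup>+h. indicator B (h + x) * a x \<partial>m \<partial>m)"
      by (rule mm.Fubini') measurable
    also have "\<dots> \<le> (\<integral>\<^sup>+x. emeasure m E * a x \<partial>m)"
    proof (intro nn_integral_mono)
      fix x
      show "(\<integral>\<^sup>+h. indicator B (h + x) * a x \<partial>m) \<le> emeasure m E * a x"
      proof (cases "x \<in> C")
        case True
        have "h \<in> E" if "h + x \<in> B" for h
          unfolding E_def using that True by (intro CollectI exI[of _ "h + x"] exI[of _ "- x"]) (auto simp: add.assoc)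
        then have "(\<integral>\<^sup>+h. indicator B (h + x) * a x \<partial>m) \<le> (\<integral>\<^sup>+h. indicator E h * a x \<partial>m)"
          by (intro nn_integral_mono) (auto simp: indicator_def)
        also have "\<dots> = emeasure m E * a x"
          by (subst nn_integral_multc) auto
        finally show ?thesis .
      qed (simp add: a0)
    qed
    also have "\<dots> = emeasure m E * (\<integral>\<^sup>+h. a h \<partial>m)"
      by (rule nn_integral_cmult) measurable
    finally show "(\<integral>\<^sup>+h. a (- h) \<partial>m) \<le> inverse (emeasure m B) * emeasure m E * (\<integral>\<^sup>+h. a h \<partial>m)"
      using ennreal_le_inverse_mult[of "emeasure m B"] B emeasure_compact_finite[OF B(1)]
      by (auto simp: mult.assoc)
  qed
qed

text \<open>The domination on compact sets shows that the part of a null set in each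
  \<open>K n\<close> has a null inverse, and countably many \<open>K n\<close> cover the
  group.\<close>

lemma AE_uminus:
  assumes "AE h in m. P h"
  shows "AE h in m. P (- h :: 'g)"
proof -
  obtain N where N: "N \<in> null_sets m" "\<And>h. h \<notin> N \<Longrightarrow> P h"
    using assms by (auto elim!: AE_E3)
  obtain K :: "nat \<Rightarrow> 'g set" where K: "\<And>n. compact (K n)" "(\<Union>n. K n) = UNIV"
    using sigma_compact by metis
  have [measurable]: "N \<in> sets borel" "K n \<in> sets borel" for n
    using N K compact_imp_borel by auto
  have "AE h in m. - h \<notin> N \<inter> K n" for n
  proof -
    obtain D where D: "\<And>a. a \<in> borel_measurable (borel :: 'g measure) \<Longrightarrow> (\<And>x. x \<notin> K n \<Longrightarrow> a x = 0) \<Longrightarrow>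
      (\<integral>\<^sup>+h. a (- h) \<partial>m) \<le> D * (\<integral>\<^sup>+h. a h \<partial>m)"
      using nn_integral_uminus_le[OF K(1)] by metis
    have "(\<integral>\<^sup>+h. indicator (N \<inter> K n) (- h) \<partial>m) \<le> D * (\<integral>\<^sup>+h. indicator (N \<inter> K n) h \<partial>m)"
      by (rule D) auto
    also have "(\<integral>\<^sup>+h. indicator (N \<inter> K n) h \<partial>m) = emeasure m (N \<inter> K n)"
      by (rule nn_integral_indicator) auto
    also have "\<dots> = 0"
      by (rule emeasure_eq_0[OF null_setsD2[OF N(1)] null_setsD1[OF N(1)]]) blast
    finally have "(\<integral>\<^sup>+h. indicator (N \<inter> K n) (- h) \<partial>m) = 0"
      by simp
    then have "AE h in m. (indicator (N \<inter> K n) (- h) :: ennreal) = 0"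
      by (subst (asm) nn_integral_0_iff_AE) auto
    then show ?thesis
      by eventually_elim (auto simp: indicator_def split: if_splits)
  qed
  then have "AE h in m. \<forall>n. - h \<notin> N \<inter> K n"
    unfolding AE_all_countable by blast
  then show ?thesis
    by eventually_elim (use K(2) N(2) in blast)
qed

text \<open>Right translation is left translation conjugated by inversion.\<close>

lemma AE_translate_right:
  assumes "AE h in m. P h"
  shows "AE h in m. P (h + g)"
proof -
  have "AE h in m. P (- (- g + h))"
    by (rule AE_translate[OF AE_uminus[OF assms]])
  then have "AE h in m. P (- (- g + - h))"
    by (rule AE_uminus)
  then show ?thesis
    by (simp add: minus_add)
qed

end


section \<open>The Harnack inequality\<close>

locale compact_kernel = haar_measure m
  for m :: "'g::{topological_group_add, second_countable_topology, t2_space} measure" +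
  fixes \<theta> :: "'g measure" and f :: "'g \<Rightarrow> real" and C :: "'g set"
  assumes f_measurable [measurable]: "f \<in> borel_measurable borel"
    and f_nonneg: "0 \<le> f x"
    and compact_C: "compact C"
    and f_zero: "x \<notin> C \<Longrightarrow> f x = 0"
    and \<theta>_eq: "\<theta> = density m (\<lambda>x. ennreal (f x))"
    and prob_\<theta>: "prob_space \<theta>"
    and semigroup_eq_UNIV: "closed S \<Longrightarrow> (\<And>x y. x \<in> S \<Longrightarrow> y \<in> S \<Longrightarrow> x + y \<in> S) \<Longrightarrow>
      emeasure \<theta> S = 1 \<Longrightarrow> S = UNIV"
begin

lemma sets_\<theta> [measurable_cong, simp]: "sets \<theta> = sets borel"
  by (simp add: \<theta>_eq)

lemma space_\<theta> [simp]: "space \<theta> = UNIV"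
  by (simp add: \<theta>_eq)

sublocale P: prob_space \<theta>
  by (rule prob_\<theta>)

lemma nn_integral_\<theta>:
  "u \<in> borel_measurable borel \<Longrightarrow> (\<integral>\<^sup>+h. u h \<partial>\<theta>) = (\<integral>\<^sup>+h. ennreal (f h) * u h \<partial>m)"
  unfolding \<theta>_eq by (subst nn_integral_density) auto

lemma AE_\<theta>: "AE h in m. P h \<Longrightarrow> AE h in \<theta>. P h"
  unfolding \<theta>_eq by (subst AE_density) auto

lemma nn_integral_f: "(\<integral>\<^sup>+h. ennreal (f h) \<partial>m) = 1"
  using P.emeasure_space_1 by (simp add: \<theta>_eq emeasure_density)

lemma integrable_f: "integrable m f"
  by (rule integrableI_nonneg) (auto simp: f_nonneg nn_integral_f)

definition superharm :: "('g \<Rightarrow> ennreal) \<Rightarrow> bool" where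
  "superharm u \<longleftrightarrow> u \<in> borel_measurable borel \<and> (\<forall>g. (\<integral>\<^sup>+h. u (g + h) \<partial>\<theta>) \<le> u g)"

lemma superharm_measurable: "superharm u \<Longrightarrow> u \<in> borel_measurable borel"
  by (simp add: superharm_def)

lemma superharm_translate: "superharm u \<Longrightarrow> superharm (\<lambda>h. u (g + h))"
  unfolding superharm_def by (auto simp: add.assoc[symmetric])

text \<open>A local Harnack bound relative to the identity, uniform over all superharmonic
  functions. The good points form an open set which the support of \<open>\<theta>\<close> maps into
  itself; admissibility can act on such a set.\<close>

definition good :: "'g \<Rightarrow> bool" where
  "good y \<longleftrightarrow> (\<exists>W c. open W \<and> y \<in> W \<and> c \<noteq> \<top> \<and>
    (\<forall>u. superharm u \<longrightarrow> (\<integral>\<^sup>+h. indicator W h * u h \<partial>m) \<le> c * u 0))"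

lemma integral_f: "(\<integral>x. f x \<partial>m) = 1"
  using nn_integral_f f_nonneg by (simp add: integral_eq_nn_integral)

text \<open>Let \<open>f\<close> be at least \<open>\<delta>\<close> on \<open>E\<close>.
  Superharmonicity applied twice bounds \<open>\<delta> * \<delta>\<close> times the integral of
  \<open>q b * u b\<close> by \<open>u 0\<close>, where \<open>q\<close> is the convolution of the
  indicator of \<open>E\<close> with itself. A single application would give only the set
  \<open>E\<close>, which may have empty interior, whereas a nonzero convolution is bounded below on
  an open set.\<close>

lemma good_exists: "\<exists>y. good y"
proof -
  have "\<exists>E \<delta>. E \<in> sets m \<and> \<delta> > 0 \<and> emeasure m E > 0 \<and> (\<forall>x\<in>E. \<delta> \<le> f x)"
    by (intro not_AE_zero_int_E) (simp_all add: f_nonneg integral_f)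
  then obtain E and \<delta> :: real where [measurable]: "E \<in> sets borel" and \<delta>: "\<delta> > 0"
    and E0: "emeasure m E \<noteq> 0" and E_le: "\<And>x. x \<in> E \<Longrightarrow> \<delta> \<le> f x"
    by auto
  have EC: "E \<subseteq> C"
    using \<delta> f_zero E_le by force
  have Efin: "emeasure m E < \<top>"
    using emeasure_mono[OF EC, of m] emeasure_compact_finite[OF compact_C] compact_imp_borel[OF compact_C]
    by (auto intro: le_less_trans)
  define E' where "E' = {x. - x \<in> E}"
  have [measurable]: "E' \<in> sets borel"
    unfolding E'_def by measurable
  have E'fin: "emeasure m E' < \<top>"
  proof -
    obtain D where D: "D \<noteq> \<top>" "\<And>a. a \<in> borel_measurable (borel :: 'g measure) \<Longrightarrow> (\<And>x. x \<notin> C \<Longrightarrow> a x = 0) \<Longrightarrow>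
        (\<integral>\<^sup>+h. a (- h) \<partial>m) \<le> D * (\<integral>\<^sup>+h. a h \<partial>m)"
      using nn_integral_uminus_le[OF compact_C] by metis
    have "emeasure m E' = (\<integral>\<^sup>+h. indicator E' h \<partial>m)"
      by simp
    also have "\<dots> = (\<integral>\<^sup>+h. indicator E (- h) \<partial>m)"
      by (intro nn_integral_cong) (auto simp: E'_def indicator_def)
    also have "\<dots> \<le> D * (\<integral>\<^sup>+h. indicator E h \<partial>m)"
      using EC by (intro D) (auto simp: indicator_def)
    also have "\<dots> < \<top>"
      using D(1) Efin by (simp add: ennreal_mult_less_top less_top)
    finally show ?thesis .
  qed
  define q where "q b = (\<integral>\<^sup>+a. indicator E a * indicator E (- a + b) \<partial>m)" for b
  have [measurable]: "q \<in> borel_measurable borel"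
    unfolding q_def by measurable
  \<comment> \<open>With the inverse set \<open>E'\<close>, a change of \<open>b\<close> becomes a
    left translation of one indicator, to which \<open>shift_diff\<close> applies.\<close>
  have q_eq: "q b = (\<integral>\<^sup>+a. indicator E a * indicator E' (- b + a) \<partial>m)" for b
    unfolding q_def by (intro nn_integral_cong) (auto simp: indicator_def E'_def minus_add)
  have qfin: "q b < \<top>" for b
  proof -
    have "q b \<le> (\<integral>\<^sup>+a. indicator E a \<partial>m)"
      unfolding q_def by (intro nn_integral_mono) (auto simp: indicator_def)
    then show ?thesis using Efin by simp
  qed
  obtain b0 where b0: "q b0 \<noteq> 0"
  proof -
    have "(\<integral>\<^sup>+b. q b \<partial>m) = (\<integral>\<^sup>+a. \<integral>\<^sup>+b. indicator E a * indicator E (- a + b) \<partial>m \<partial>m)"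
      unfolding q_def by (rule mm.Fubini') measurable
    also have "\<dots> = (\<integral>\<^sup>+a. indicator E a * emeasure m E \<partial>m)"
    proof (intro nn_integral_cong)
      fix a
      have "(\<integral>\<^sup>+b. indicator E (- a + b) \<partial>m) = (\<integral>\<^sup>+b. indicator E b \<partial>m)"
        by (rule nn_integral_translate) measurable
      then show "(\<integral>\<^sup>+b. indicator E a * indicator E (- a + b) \<partial>m) = indicator E a * emeasure m E"
        by (subst nn_integral_cmult) auto
    qed
    also have "\<dots> = emeasure m E * emeasure m E"
      by (subst nn_integral_multc) auto
    finally have "(\<integral>\<^sup>+b. q b \<partial>m) \<noteq> 0"
      using E0 by simp
    then have "\<exists>b. q b \<noteq> 0"
      by (metis nn_integral_0_iff_AE nn_integral_const mult_zero_left nn_integral_cong)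
    then show ?thesis using that by auto
  qed
  \<comment> \<open>The factor 2 lets half of the value at \<open>b0\<close> survive on a
    neighbourhood.\<close>
  obtain s where s: "q b0 = ennreal (2 * s)" "s > 0"
  proof -
    from qfin[of b0] b0 obtain r where "q b0 = ennreal r" "r > 0"
      by (cases "q b0") (auto simp: less_le)
    then show ?thesis using that[of "r/2"] by simp
  qed
  have "integrable m (indicat_real E')"
    using E'fin by (intro integrable_real_indicator) auto
  then have "(shift_diff (indicator E') \<longlongrightarrow> 0) (nhds 0)"
    using integrable_imp_shift_continuous unfolding shift_continuous_def by blast
  then have "eventually (\<lambda>g. shift_diff (indicator E') g < ennreal s) (nhds 0)"
    using s(2) by (intro order_tendstoD(2)) auto
  moreover have "((\<lambda>b. - b + b0) \<longlongrightarrow> - b0 + b0) (nhds b0)"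
    by (intro tendsto_add tendsto_minus tendsto_const) (simp add: filterlim_ident)
  ultimately have "eventually (\<lambda>b. shift_diff (indicator E') (- b + b0) < ennreal s) (nhds b0)"
    by (intro eventually_compose_filterlim[where f = "\<lambda>b. - b + b0"]) simp_all
  then obtain W where W: "open W" "b0 \<in> W" "\<And>b. b \<in> W \<Longrightarrow> shift_diff (indicator E') (- b + b0) < ennreal s"
    unfolding eventually_nhds by blast
  have [measurable]: "W \<in> sets borel"
    using W by simp
  have qW: "ennreal s \<le> q b" if "b \<in> W" for b
  proof -
    have "q b0 \<le> (\<integral>\<^sup>+a. indicator E a * indicator E' (- b + a)
        + ennreal \<bar>indicat_real E' (- b + a) - indicator E' (- b0 + a)\<bar> \<partial>m)"
      unfolding q_eq by (intro nn_integral_mono) (auto simp: indicator_def)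
    also have "\<dots> = q b + (\<integral>\<^sup>+a. ennreal \<bar>indicat_real E' (- b + a) - indicator E' (- b0 + a)\<bar> \<partial>m)"
      unfolding q_eq by (rule nn_integral_add) measurable
    also have "(\<integral>\<^sup>+a. ennreal \<bar>indicat_real E' (- b + a) - indicator E' (- b0 + a)\<bar> \<partial>m)
        = (\<integral>\<^sup>+a. ennreal \<bar>indicat_real E' (- b + (b0 + a)) - indicator E' (- b0 + (b0 + a))\<bar> \<partial>m)"
      by (rule nn_integral_translate[symmetric]) measurable
    also have "\<dots> = shift_diff (indicator E') (- b + b0)"
      by (simp add: shift_diff_def add.assoc[symmetric])
    also have "q b + \<dots> \<le> q b + ennreal s"
      using W(3)[OF that] by (intro add_mono) auto
    finally have "ennreal s + ennreal s \<le> q b + ennreal s"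
      using s by (simp add: ennreal_plus[symmetric] del: ennreal_plus)
    then show ?thesis
      using s(2) by (cases "q b") (auto simp: ennreal_plus[symmetric] simp del: ennreal_plus)
  qed
  define c where "c = ennreal \<delta> * ennreal \<delta> * ennreal s"
  have c: "c \<noteq> 0" "c \<noteq> \<top>"
    using \<delta> s(2) by (auto simp: c_def ennreal_mult_eq_top_iff)
  have fE: "ennreal \<delta> * indicator E h \<le> ennreal (f h)" for h
    by (auto simp: indicator_def intro: ennreal_leI E_le)
  have "(\<integral>\<^sup>+h. indicator W h * u h \<partial>m) \<le> inverse c * u 0" if u: "superharm u" for u
  proof (rule ennreal_le_inverse_mult[OF c])
    have [measurable]: "u \<in> borel_measurable borel" and u_le: "\<And>g. (\<integral>\<^sup>+h. u (g + h) \<partial>\<theta>) \<le> u g"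
      using u by (auto simp: superharm_def)
    have lower: "ennreal \<delta> * (\<integral>\<^sup>+h. indicator E h * u (g + h) \<partial>m) \<le> u g" for g
    proof -
      have "ennreal \<delta> * (\<integral>\<^sup>+h. indicator E h * u (g + h) \<partial>m) = (\<integral>\<^sup>+h. (ennreal \<delta> * indicator E h) * u (g + h) \<partial>m)"
        by (subst nn_integral_cmult[symmetric]) (auto simp: mult.assoc)
      also have "\<dots> \<le> (\<integral>\<^sup>+h. ennreal (f h) * u (g + h) \<partial>m)"
        by (intro nn_integral_mono mult_right_mono fE) auto
      also have "\<dots> = (\<integral>\<^sup>+h. u (g + h) \<partial>\<theta>)"
        by (rule nn_integral_\<theta>[symmetric]) measurable
      finally show ?thesis using u_le order_trans by blast
    qed
    have "c * (\<integral>\<^sup>+h. indicator W h * u h \<partial>m) = ennreal \<delta> * ennreal \<delta> * (\<integral>\<^sup>+h. ennreal s * (indicator W h * u h) \<partial>m)"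
      unfolding c_def by (subst nn_integral_cmult) (auto simp: mult.assoc)
    also have "\<dots> \<le> ennreal \<delta> * ennreal \<delta> * (\<integral>\<^sup>+b. q b * u b \<partial>m)"
    proof (intro mult_left_mono nn_integral_mono)
      fix b show "ennreal s * (indicator W b * u b) \<le> q b * u b"
        using qW[of b] by (auto simp: indicator_def intro: mult_right_mono)
    qed auto
    also have "(\<integral>\<^sup>+b. q b * u b \<partial>m) = (\<integral>\<^sup>+b. \<integral>\<^sup>+a. indicator E a * (indicator E (- a + b) * u b) \<partial>m \<partial>m)"
      unfolding q_def by (subst nn_integral_multc[symmetric]) (auto simp: mult.assoc)
    also have "\<dots> = (\<integral>\<^sup>+a. \<integral>\<^sup>+b. indicator E a * (indicator E (- a + b) * u b) \<partial>m \<partial>m)"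
      by (rule mm.Fubini') measurable
    also have "\<dots> = (\<integral>\<^sup>+a. indicator E a * (\<integral>\<^sup>+b. indicator E b * u (a + b) \<partial>m) \<partial>m)"
    proof (intro nn_integral_cong)
      fix a
      have "(\<integral>\<^sup>+b. indicator E (- a + b) * u b \<partial>m) = (\<integral>\<^sup>+b. indicator E (- a + (a + b)) * u (a + b) \<partial>m)"
        by (rule nn_integral_translate[symmetric]) measurable
      then show "(\<integral>\<^sup>+b. indicator E a * (indicator E (- a + b) * u b) \<partial>m) = indicator E a * (\<integral>\<^sup>+b. indicator E b * u (a + b) \<partial>m)"
        by (subst nn_integral_cmult) (auto simp: add.assoc[symmetric])
    qed
    \<comment> \<open>One factor \<open>\<delta>\<close> is spent inside the integral, with base
      point \<open>a\<close>, the other outside, with base point the identity.\<close>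
    also have "ennreal \<delta> * ennreal \<delta> * \<dots> = ennreal \<delta> * (\<integral>\<^sup>+a. ennreal \<delta> * (indicator E a * (\<integral>\<^sup>+b. indicator E b * u (a + b) \<partial>m)) \<partial>m)"
      by (subst nn_integral_cmult) (auto simp: mult.assoc)
    also have "\<dots> = ennreal \<delta> * (\<integral>\<^sup>+a. indicator E a * (ennreal \<delta> * (\<integral>\<^sup>+b. indicator E b * u (a + b) \<partial>m)) \<partial>m)"
      by (simp only: mult.left_commute)
    also have "\<dots> \<le> ennreal \<delta> * (\<integral>\<^sup>+a. indicator E a * u (0 + a) \<partial>m)"
      by (intro mult_left_mono nn_integral_mono) (use lower in auto)
    also have "\<dots> \<le> u 0"
      by (rule lower)
    finally show "c * (\<integral>\<^sup>+h. indicator W h * u h \<partial>m) \<le> u 0" .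
  qed
  then have "good b0"
    unfolding good_def using W c ennreal_inverse_neq_top by blast
  then show ?thesis ..
qed

end

lemma ennreal_sum_neq_top:
  fixes c :: "'i \<Rightarrow> ennreal"
  assumes "finite A" "\<And>i. i \<in> A \<Longrightarrow> c i \<noteq> \<top>"
  shows "(\<Sum>i\<in>A. c i) \<noteq> \<top>"
  using assms by (induction A) auto

lemma ennreal_le_minus_plus: "a \<le> a - b + (b :: ennreal)"
  using ennreal_minus_le_iff[of a b "a - b"] by (simp add: add.commute)

context compact_kernel
begin

text \<open>For \<open>h\<close> near \<open>s\<close> the set \<open>V'\<close> lies in the
  translate of \<open>V\<close> by \<open>h\<close>, so the bound at \<open>y\<close>, rebased at
  \<open>h\<close>, gives at most \<open>c * u h\<close> for the integral over \<open>V'\<close>.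
  Integrating over \<open>h\<close> in \<open>W\<close> against \<open>\<theta>\<close> replaces
  \<open>u h\<close> by \<open>u 0\<close>. The hypothesis on \<open>s\<close> says that it lies in
  the support of \<open>\<theta>\<close>.\<close>

lemma good_plus:
  assumes y: "good y" and s: "\<And>W. open W \<Longrightarrow> s \<in> W \<Longrightarrow> emeasure \<theta> W \<noteq> 0"
  shows "good (s + y)"
proof -
  obtain V c where V: "open V" "y \<in> V" "c \<noteq> \<top>"
    "\<And>u. superharm u \<Longrightarrow> (\<integral>\<^sup>+h. indicator V h * u h \<partial>m) \<le> c * u 0"
    using y unfolding good_def by blast
  have "continuous_on UNIV (\<lambda>p::'g\<times>'g. - fst p + snd p)"
    by (intro continuous_intros)
  then have "open ((\<lambda>p::'g\<times>'g. - fst p + snd p) -` V)"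
    using V(1) by (simp add: open_vimage)
  moreover have "(s, s + y) \<in> (\<lambda>p. - fst p + snd p) -` V"
    using V(2) by (simp add: add.assoc[symmetric])
  ultimately obtain W V' where W: "open W" "open V'" "(s, s + y) \<in> W \<times> V'"
    "W \<times> V' \<subseteq> (\<lambda>p. - fst p + snd p) -` V"
    by (rule open_prod_elim)
  have [measurable]: "W \<in> sets borel" "V' \<in> sets borel" "V \<in> sets borel"
    using W V by auto
  have \<theta>W: "emeasure \<theta> W \<noteq> 0" "emeasure \<theta> W \<noteq> \<top>"
    using s W by auto
  have "(\<integral>\<^sup>+h. indicator V' h * u h \<partial>m) \<le> inverse (emeasure \<theta> W) * c * u 0" if u: "superharm u" for u
    unfolding mult.assoc
  proof (rule ennreal_le_inverse_mult[OF \<theta>W])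
    have [measurable]: "u \<in> borel_measurable borel"
      using u by (rule superharm_measurable)
    have "emeasure \<theta> W * (\<integral>\<^sup>+h. indicator V' h * u h \<partial>m) = (\<integral>\<^sup>+h. indicator W h * (\<integral>\<^sup>+v. indicator V' v * u v \<partial>m) \<partial>\<theta>)"
      by (subst nn_integral_multc) auto
    also have "\<dots> \<le> (\<integral>\<^sup>+h. c * u (0 + h) \<partial>\<theta>)"
    proof (rule nn_integral_mono)
      fix h
      show "indicator W h * (\<integral>\<^sup>+v. indicator V' v * u v \<partial>m) \<le> c * u (0 + h)"
      proof (cases "h \<in> W")
        case True
        have "(\<integral>\<^sup>+v. indicator V' v * u v \<partial>m) \<le> (\<integral>\<^sup>+v. indicator V (- h + v) * u v \<partial>m)"
        proof (rule nn_integral_mono)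
          fix v show "indicator V' v * u v \<le> indicator V (- h + v) * u v"
            using W(4) True by (auto simp: indicator_def)
        qed
        also have "\<dots> = (\<integral>\<^sup>+v. indicator V (- h + (h + v)) * u (h + v) \<partial>m)"
          by (rule nn_integral_translate[symmetric]) measurable
        also have "\<dots> = (\<integral>\<^sup>+v. indicator V v * u (h + v) \<partial>m)"
          by (simp add: add.assoc[symmetric])
        also have "\<dots> \<le> c * u (h + 0)"
          by (rule V(4)[OF superharm_translate[OF u]])
        finally show ?thesis
          using True by simp
      qed simp
    qed
    also have "\<dots> = c * (\<integral>\<^sup>+h. u (0 + h) \<partial>\<theta>)"
      by (rule nn_integral_cmult) measurable
    also have "\<dots> \<le> c * u 0"
    proof (rule mult_left_mono)
      show "(\<integral>\<^sup>+h. u (0 + h) \<partial>\<theta>) \<le> u 0"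
        using u unfolding superharm_def by blast
    qed simp
    finally show "emeasure \<theta> W * (\<integral>\<^sup>+h. indicator V' h * u h \<partial>m) \<le> c * u 0" .
  qed
  moreover have "inverse (emeasure \<theta> W) * c \<noteq> \<top>"
    using V(3) ennreal_inverse_neq_top[OF \<theta>W(1)] by (simp add: ennreal_mult_eq_top_iff)
  ultimately show ?thesis
    unfolding good_def using W by (intro exI[of _ V'] exI[of _ "inverse (emeasure \<theta> W) * c"]) auto
qed

text \<open>The elements carrying good points to good points form a semigroup \<open>S\<close>. It
  is closed because the set of good points is open, and has full measure because it contains the
  support of \<open>\<theta>\<close>; so admissibility makes it the whole group, and one good point
  reaches all others.\<close>

lemma good_UNIV: "good y"
proof -
  define S where "S = {s. \<forall>y. good y \<longrightarrow> good (s + y)}"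
  have "closed S"
  proof -
    have "s \<in> S" if s: "s \<in> closure S" for s
      unfolding S_def
    proof (intro CollectI allI impI)
      fix y assume "good y"
      then obtain W where W: "open W" "y \<in> W" "\<And>z. z \<in> W \<Longrightarrow> good z"
        unfolding good_def by blast
      \<comment> \<open>For \<open>t\<close> in \<open>S\<close> close to \<open>s\<close>, the
        element \<open>s + y\<close> is \<open>t\<close> plus a point near \<open>y\<close>, which
        is still good.\<close>
      have "continuous_on UNIV (\<lambda>t::'g. - t + (s + y))"
        by (intro continuous_intros)
      then have op: "open ((\<lambda>t. - t + (s + y)) -` W)"
        using W(1) by (simp add: open_vimage)
      have "s \<in> (\<lambda>t. - t + (s + y)) -` W"
        using W(2) by (simp add: add.assoc[symmetric])
      then have "(\<lambda>t. - t + (s + y)) -` W \<inter> S \<noteq> {}"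
        using open_Int_closure_eq_empty[OF op, of S] s by blast
      then obtain t where t: "t \<in> S" "- t + (s + y) \<in> W"
        by blast
      then have "good (t + (- t + (s + y)))"
        using W(3) unfolding S_def by blast
      then show "good (s + y)"
        by (simp add: add.assoc[symmetric])
    qed
    then have "closure S = S"
      using closure_subset by blast
    then show ?thesis
      using closure_eq by blast
  qed
  moreover have "x + y \<in> S" if "x \<in> S" "y \<in> S" for x y
    using that unfolding S_def by (simp add: add.assoc)
  moreover have "emeasure \<theta> S = 1"
  proof -
    \<comment> \<open>By Lindelof the complement of the support is a countable union of null open
      sets.\<close>
    define \<N> where "\<N> = {W::'g set. open W \<and> emeasure \<theta> W = 0}"
    obtain \<V> where \<V>: "\<V> \<subseteq> \<N>" "countable \<V>" "\<Union>\<V> = \<Union>\<N>"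
      using Lindelof[of \<N>] unfolding \<N>_def by blast
    have "(\<Union>W\<in>\<V>. W) \<in> null_sets \<theta>"
      using \<V>(1) by (intro null_sets_UN' \<V>(2)) (auto simp: \<N>_def null_sets_def)
    then have "AE s in \<theta>. s \<notin> \<Union>\<N>"
      using \<V>(3) AE_not_in by fastforce
    then have "AE s in \<theta>. s \<in> S"
    proof eventually_elim
      case (elim s)
      then have "emeasure \<theta> W \<noteq> 0" if "open W" "s \<in> W" for W
        using that by (auto simp: \<N>_def)
      then show ?case
        unfolding S_def using good_plus by blast
    qed
    then show ?thesis
      using \<open>closed S\<close> by (intro P.emeasure_eq_1_AE) auto
  qed
  ultimately have "S = UNIV"
    by (rule semigroup_eq_UNIV)
  obtain z where "good z"
    using good_exists ..
  then have "good ((y - z) + z)"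
    using \<open>S = UNIV\<close> unfolding S_def by blast
  then show ?thesis by simp
qed

text \<open>A finite subcover by the neighbourhoods of good points; left translation then moves the
  base point from the identity to \<open>g\<close>.\<close>

lemma harnack_L1:
  assumes "compact Q"
  obtains M where "M \<noteq> \<top>" "\<And>u g. superharm u \<Longrightarrow> (\<integral>\<^sup>+h. indicator Q h * u (g + h) \<partial>m) \<le> M * u g"
proof -
  have "\<exists>W c. open W \<and> y \<in> W \<and> c \<noteq> \<top> \<and> (\<forall>u. superharm u \<longrightarrow> (\<integral>\<^sup>+h. indicator W h * u h \<partial>m) \<le> c * u 0)" for y
    using good_UNIV[of y] unfolding good_def .
  then obtain W c where W: "\<And>y. open (W y)" "\<And>y. y \<in> W y" "\<And>y. c y \<noteq> \<top>"
    "\<And>y u. superharm u \<Longrightarrow> (\<integral>\<^sup>+h. indicator (W y) h * u h \<partial>m) \<le> c y * u 0"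
    by metis
  have [measurable]: "W y \<in> sets borel" for y
    using W by simp
  obtain F where F: "F \<subseteq> Q" "finite F" "Q \<subseteq> (\<Union>y\<in>F. W y)"
    using compactE_image[OF assms, of Q W] W by blast
  have *: "(\<integral>\<^sup>+h. indicator Q h * u h \<partial>m) \<le> (\<Sum>y\<in>F. c y) * u 0" if u: "superharm u" for u
  proof -
    have [measurable]: "u \<in> borel_measurable borel"
      using u by (rule superharm_measurable)
    have "(\<integral>\<^sup>+h. indicator Q h * u h \<partial>m) \<le> (\<integral>\<^sup>+h. (\<Sum>y\<in>F. indicator (W y) h * u h) \<partial>m)"
    proof (rule nn_integral_mono)
      fix h
      show "indicator Q h * u h \<le> (\<Sum>y\<in>F. indicator (W y) h * u h)"
      proof (cases "h \<in> Q")
        case True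
        then obtain y where "y \<in> F" "h \<in> W y" using F by auto
        then show ?thesis
          using True F(2) member_le_sum[of y F "\<lambda>y. indicator (W y) h * u h"] by simp
      qed simp
    qed
    also have "\<dots> = (\<Sum>y\<in>F. \<integral>\<^sup>+h. indicator (W y) h * u h \<partial>m)"
      by (rule nn_integral_sum) measurable
    also have "\<dots> \<le> (\<Sum>y\<in>F. c y * u 0)"
      by (intro sum_mono W u)
    finally show ?thesis by (simp add: sum_distrib_right)
  qed
  show ?thesis
  proof (rule that)
    show "(\<Sum>y\<in>F. c y) \<noteq> \<top>"
      by (intro ennreal_sum_neq_top F W)
    show "(\<integral>\<^sup>+h. indicator Q h * u (g + h) \<partial>m) \<le> (\<Sum>y\<in>F. c y) * u g" if "superharm u" for u g
      using *[OF superharm_translate[OF that, of g]] by simp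
  qed
qed

text \<open>Left unnormalised. Averages satisfy a pointwise Harnack inequality before it is known
  for \<open>u\<close> itself.\<close>

definition average :: "'g set \<Rightarrow> ('g \<Rightarrow> ennreal) \<Rightarrow> 'g \<Rightarrow> ennreal" where
  "average V u x = (\<integral>\<^sup>+h. indicator V h * u (x + h) \<partial>m)"

lemma average_measurable [measurable]:
  assumes [measurable]: "V \<in> sets borel" "u \<in> borel_measurable borel"
  shows "average V u \<in> borel_measurable borel"
  unfolding average_def[abs_def] by measurable

text \<open>For every \<open>v\<close> in \<open>V\<close>, the translate of \<open>V\<close> by
  \<open>x + q\<close> lies in the translate of the compact set \<open>Q'\<close> by
  \<open>x + v\<close>, so the average at \<open>x + q\<close> is at most
  \<open>M * u (x + v)\<close>. Integrating over \<open>v\<close> in \<open>V\<close> produces the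
  average at \<open>x\<close>.\<close>

lemma harnack_average:
  assumes V: "compact V" "emeasure m V \<noteq> 0" and Q: "compact Q"
  obtains B where "B \<noteq> \<top>" "\<And>u x q. superharm u \<Longrightarrow> q \<in> Q \<Longrightarrow> average V u (x + q) \<le> B * average V u x"
proof -
  have Vm [measurable]: "V \<in> sets borel"
    by (rule compact_imp_borel[OF V(1)])
  define Q' where "Q' = {a + h |a h. a \<in> {v + q |v q. v \<in> uminus ` V \<and> q \<in> Q} \<and> h \<in> V}"
  have "compact Q'"
    unfolding Q'_def by (intro compact_plus compact_uminus V Q)
  then obtain M where M: "M \<noteq> \<top>" "\<And>u g. superharm u \<Longrightarrow> (\<integral>\<^sup>+h. indicator Q' h * u (g + h) \<partial>m) \<le> M * u g"
    using harnack_L1 by metis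
  show ?thesis
  proof (rule that)
    show "inverse (emeasure m V) * M \<noteq> \<top>"
      using M(1) ennreal_inverse_neq_top[OF V(2)] by (simp add: ennreal_mult_eq_top_iff)
    fix u x q assume u: "superharm u" and q: "q \<in> Q"
    have [measurable]: "u \<in> borel_measurable borel"
      using u by (rule superharm_measurable)
    have le: "average V u (x + q) \<le> M * u (x + v)" if v: "v \<in> V" for v
    proof -
      have "average V u (x + q) = (\<integral>\<^sup>+h. indicator V (- q + v + (- v + q + h)) * u (x + v + (- v + q + h)) \<partial>m)"
        by (simp add: average_def add.assoc)
      also have "\<dots> = (\<integral>\<^sup>+k. indicator V (- q + v + k) * u (x + v + k) \<partial>m)"
        by (rule nn_integral_translate) measurable
      also have "\<dots> \<le> (\<integral>\<^sup>+k. indicator Q' k * u (x + v + k) \<partial>m)"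
      proof (rule nn_integral_mono)
        fix k
        have "k \<in> Q'" if "- q + v + k \<in> V"
        proof -
          have "k = (- v + q) + (- q + v + k)"
            by (simp add: add.assoc)
          then show ?thesis
            unfolding Q'_def using that v q by blast
        qed
        then show "indicator V (- q + v + k) * u (x + v + k) \<le> indicator Q' k * u (x + v + k)"
          by (auto simp: indicator_def)
      qed
      also have "\<dots> \<le> M * u (x + v)"
        by (rule M(2)[OF u])
      finally show ?thesis .
    qed
    have "average V u (x + q) \<le> inverse (emeasure m V) * (M * average V u x)"
    proof (rule ennreal_le_inverse_mult[OF V(2)])
      show "emeasure m V \<noteq> \<top>"
        using emeasure_compact_finite[OF V(1)] by simp
      have "emeasure m V * average V u (x + q) = (\<integral>\<^sup>+v. indicator V v * average V u (x + q) \<partial>m)"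
        by (subst nn_integral_multc) auto
      also have "\<dots> \<le> (\<integral>\<^sup>+v. M * (indicator V v * u (x + v)) \<partial>m)"
        by (rule nn_integral_mono) (auto simp: indicator_def intro: le)
      also have "\<dots> = M * average V u x"
        unfolding average_def by (rule nn_integral_cmult) measurable
      finally show "emeasure m V * average V u (x + q) \<le> M * average V u x" .
    qed
    then show "average V u (x + q) \<le> inverse (emeasure m V) * M * average V u x"
      by (simp add: mult.assoc)
  qed
qed

section \<open>Pointwise Harnack inequality for harmonic functions\<close>

definition harm :: "('g \<Rightarrow> ennreal) \<Rightarrow> bool" where
  "harm u \<longleftrightarrow> u \<in> borel_measurable borel \<and> (\<forall>g. (\<integral>\<^sup>+h. u (g + h) \<partial>\<theta>) = u g)"

lemma harm_measurable: "harm u \<Longrightarrow> u \<in> borel_measurable borel"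
  by (simp add: harm_def)

lemma harm_imp_superharm: "harm u \<Longrightarrow> superharm u"
  by (simp add: harm_def superharm_def)

lemma harm_eq:
  assumes "harm u"
  shows "u g = (\<integral>\<^sup>+h. ennreal (f h) * u (g + h) \<partial>m)"
proof -
  have [measurable]: "u \<in> borel_measurable borel"
    using assms by (rule harm_measurable)
  have "(\<integral>\<^sup>+h. u (g + h) \<partial>\<theta>) = (\<integral>\<^sup>+h. ennreal (f h) * u (g + h) \<partial>m)"
    by (rule nn_integral_\<theta>) measurable
  then show ?thesis
    using assms unfolding harm_def by simp
qed

text \<open>The value at \<open>y\<close> is an integral over the translate of \<open>C\<close> by
  \<open>y\<close>. This is also the translate of the compact set \<open>Q\<close> by
  \<open>x\<close>, where the Harnack inequality for integrals forces \<open>u\<close> to vanish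
  almost everywhere.\<close>

lemma harm_zero:
  assumes u: "harm u" and "u x = 0"
  shows "u y = 0"
proof -
  have [measurable]: "u \<in> borel_measurable borel"
    using u by (rule harm_measurable)
  define Q where "Q = {a + c |a c. a \<in> {- x + y} \<and> c \<in> C}"
  have Q: "compact Q"
    unfolding Q_def by (intro compact_plus compact_C) auto
  then have [measurable]: "Q \<in> sets borel"
    by (rule compact_imp_borel)
  obtain M where "(\<integral>\<^sup>+h. indicator Q h * u (x + h) \<partial>m) \<le> M * u x"
    using harnack_L1[OF Q] harm_imp_superharm[OF u] by metis
  then have "(\<integral>\<^sup>+h. indicator Q h * u (x + h) \<partial>m) = 0"
    using assms(2) by simp
  then have "AE h in m. indicator Q h * u (x + h) = 0"
    by (subst (asm) nn_integral_0_iff_AE) auto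
  then have "AE h in m. indicator Q (- x + y + h) * u (x + (- x + y + h)) = 0"
    by (rule AE_translate)
  then have "AE h in m. ennreal (f h) * u (y + h) = 0"
  proof eventually_elim
    case (elim h)
    show ?case
    proof (cases "h \<in> C")
      case True
      then have "- x + y + h \<in> Q"
        unfolding Q_def by blast
      then show ?thesis
        using elim by (simp add: add.assoc[symmetric])
    qed (simp add: f_zero)
  qed
  then show ?thesis
    unfolding harm_eq[OF u, of y] by (subst nn_integral_0_iff_AE) auto
qed

text \<open>
  The part of the kernel above a high level acts on averages of \<open>u\<close> as a contraction, so the
  excess of \<open>u\<close> over a multiple of its average vanishes almost everywhere.
\<close>

theorem harnack:
  assumes Q: "compact Q"
  obtains M where "M \<noteq> \<top>" "\<And>u x. harm u \<Longrightarrow> u 0 < \<top> \<Longrightarrow> x \<in> Q \<Longrightarrow> u x \<le> M * u 0"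
proof -
  obtain K1 W0 :: "'g set" where W0: "open W0" "compact K1" "0 \<in> W0" "W0 \<subseteq> K1"
    using compact_neighbourhood[of UNIV 0] by (metis UNIV_I open_UNIV)
  obtain K0 :: "'g set" where K0: "compact K0" "emeasure m K0 \<noteq> 0"
    using pos_compact .
  \<comment> \<open>\<open>C\<close> puts the support of the kernel inside \<open>V\<close>,
    \<open>K1\<close> makes \<open>V\<close> a neighbourhood of the identity, and \<open>K0\<close>
    gives it positive measure.\<close>
  define V where "V = C \<union> K1 \<union> K0"
  have V: "compact V"
    unfolding V_def by (intro compact_Un compact_C W0 K0)
  then have [measurable]: "V \<in> sets borel"
    by (rule compact_imp_borel)
  have V0: "emeasure m V \<noteq> 0"
  proof -
    have "K0 \<subseteq> V"
      by (auto simp: V_def)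
    then have "emeasure m K0 \<le> emeasure m V"
      by (rule emeasure_mono) simp
    then show ?thesis using K0(2) by auto
  qed
  have VC: "compact {v + c |v c. v \<in> V \<and> c \<in> C}"
    by (intro compact_plus V compact_C)
  \<comment> \<open>The kernel spreads an average over \<open>V\<close> to the product of
    \<open>V\<close> and \<open>C\<close>; finitely many translates of \<open>W0\<close>, hence of
    \<open>V\<close>, cover that product.\<close>
  obtain F where F: "finite F" "{v + c |v c. v \<in> V \<and> c \<in> C} \<subseteq> (\<Union>w\<in>F. (\<lambda>h. - w + h) -` W0)"
  proof (rule compactE_image[OF VC, of UNIV "\<lambda>w. (\<lambda>h. - w + h) -` W0"])
    show "open ((\<lambda>h. - w + h) -` W0)" for w
      by (intro open_vimage W0 continuous_intros)
    show "{v + c |v c. v \<in> V \<and> c \<in> C} \<subseteq> (\<Union>w. (\<lambda>h. - w + h) -` W0)"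
    proof
      fix x show "x \<in> (\<Union>w. (\<lambda>h. - w + h) -` W0)"
        using W0(3) by (intro UN_I[of x]) auto
    qed
  qed (use that in blast)
  have "compact (C \<union> F)"
    using F(1) by (intro compact_Un compact_C finite_imp_compact)
  then obtain B where B: "B \<noteq> \<top>"
    "\<And>u x q. superharm u \<Longrightarrow> q \<in> C \<union> F \<Longrightarrow> average V u (x + q) \<le> B * average V u x"
    using harnack_average[OF V V0] by metis
  obtain D where D: "D \<noteq> \<top>" "\<And>a. a \<in> borel_measurable (borel :: 'g measure) \<Longrightarrow> (\<And>x. x \<notin> C \<Longrightarrow> a x = 0) \<Longrightarrow>
    (\<integral>\<^sup>+h. a (- h) \<partial>m) \<le> D * (\<integral>\<^sup>+h. a h \<partial>m)"
    using nn_integral_uminus_le[OF compact_C] by metis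
  obtain M where M: "M \<noteq> \<top>" "\<And>u g. superharm u \<Longrightarrow> (\<integral>\<^sup>+h. indicator V h * u (g + h) \<partial>m) \<le> M * u g"
    using harnack_L1[OF V] by metis
  \<comment> \<open>The part of the kernel above the level \<open>t\<close>; its mass tends to zero
    as the level grows.\<close>
  define F2 where "F2 t h = (if f h > t then ennreal (f h) else 0)" for t :: real and h
  have [measurable]: "F2 t \<in> borel_measurable borel" for t
    unfolding F2_def[abs_def] by measurable
  have F2_le: "F2 t h \<le> ennreal (f h)" for t h
    by (simp add: F2_def)
  have F2_C: "h \<notin> C \<Longrightarrow> F2 t h = 0" for t h
    using f_zero by (simp add: F2_def)
  define half :: ennreal where "half = ennreal (1/2)"
  have half_pos: "0 < half"
    unfolding half_def by (rule iffD2[OF ennreal_less_zero_iff]) simp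
  \<comment> \<open>\<open>B\<close> is the factor in the one-step estimate \<open>s_step\<close>,
    the other summand the factor in the iterated estimate \<open>s_pow\<close>; their sum lets one
    level serve both.\<close>
  define E where "E = B + D * of_nat (card F) * B"
  have E: "E \<noteq> \<top>"
    using B(1) D(1) by (simp add: E_def ennreal_mult_eq_top_iff of_nat_less_top)
  have "(\<lambda>n. \<integral>\<^sup>+h. F2 (real n) h \<partial>m) \<longlonglongrightarrow> (\<integral>\<^sup>+h. 0 \<partial>m)"
  proof (rule nn_integral_dominated_convergence[where w = "\<lambda>h. ennreal (f h)"])
    show "(\<integral>\<^sup>+h. ennreal (f h) \<partial>m) < \<infinity>"
      by (simp add: nn_integral_f)
    show "AE h in m. (\<lambda>n. F2 (real n) h) \<longlonglongrightarrow> 0"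
    proof (rule AE_I2)
      fix h
      have "eventually (\<lambda>n. f h \<le> real n) sequentially"
        by (rule eventually_sequentiallyI[of "nat \<lceil>f h\<rceil>"]) linarith
      then have "eventually (\<lambda>n. F2 (real n) h = 0) sequentially"
        by eventually_elim (simp add: F2_def)
      then show "(\<lambda>n. F2 (real n) h) \<longlonglongrightarrow> 0"
        by (rule tendsto_eventually)
    qed
  qed (use F2_le in auto)
  then have "(\<lambda>n. E * (\<integral>\<^sup>+h. F2 (real n) h \<partial>m)) \<longlonglongrightarrow> E * 0"
    using E by (intro ennreal_tendsto_cmult) (auto simp: less_top)
  then have "eventually (\<lambda>n. E * (\<integral>\<^sup>+h. F2 (real n) h \<partial>m) < half) sequentially"
    using half_pos by (intro order_tendstoD(2)) auto
  then obtain n0 :: nat where n0: "E * (\<integral>\<^sup>+h. F2 (real n0) h \<partial>m) < half"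
    by (auto simp: eventually_sequentially)
  define t0 where "t0 = real n0"
  define I where "I = (\<integral>\<^sup>+h. F2 t0 h \<partial>m)"
  have "B * I \<le> E * I" "D * of_nat (card F) * B * I \<le> E * I"
    unfolding E_def by (intro mult_right_mono; simp)+
  then have BI: "B * I \<le> half" and DI: "D * of_nat (card F) * B * I \<le> half"
    using n0 unfolding I_def t0_def by (auto intro: order_trans less_imp_le)
  \<comment> \<open>Twice the truncation level: the bounded part of the kernel contributes
    \<open>t0\<close> times the average, and the multiple \<open>t * ub\<close> seen through the
    unbounded part contributes at most as much again, by \<open>BI\<close>.\<close>
  define t where "t = ennreal (2 * t0)"
  have t_half: "t * half = ennreal t0"
    unfolding t_def t0_def half_def by (subst ennreal_mult[symmetric]) simp_all
  have main: "u x \<le> t * B * average V u x" if u: "harm u" and fin: "u 0 < \<top>" for u x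
  proof -
    have sup: "superharm u" using u by (rule harm_imp_superharm)
    have [measurable]: "u \<in> borel_measurable borel"
      using u by (rule harm_measurable)
    define ub where "ub = average V u"
    have [measurable]: "ub \<in> borel_measurable borel"
      unfolding ub_def by measurable
    have ubB: "ub (y + q) \<le> B * ub y" if "q \<in> C \<union> F" for y q
      unfolding ub_def using B(2)[OF sup that] .
    \<comment> \<open>Needed to subtract \<open>t * ub y\<close> in \<open>s_step\<close> and to let
      the bound of \<open>s_pow\<close> tend to zero.\<close>
    have ub_fin: "ub y < \<top>" for y
    proof -
      have "ub 0 \<le> M * u 0"
        using M(2)[OF sup, of 0] by (simp add: ub_def average_def)
      also have "\<dots> < \<top>"
        using M(1) fin by (simp add: ennreal_mult_less_top less_top)
      finally have ub0: "ub 0 < \<top>" .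
      have "compact {y}" by simp
      then obtain B' where B': "B' \<noteq> \<top>" "\<And>u x q. superharm u \<Longrightarrow> q \<in> {y} \<Longrightarrow> average V u (x + q) \<le> B' * average V u x"
        using harnack_average[OF V V0] by metis
      have "ub (0 + y) \<le> B' * ub 0"
        unfolding ub_def using B'(2)[OF sup] by blast
      also have "\<dots> < \<top>"
        using B'(1) ub0 by (simp add: ennreal_mult_less_top less_top)
      finally show ?thesis by simp
    qed
    \<comment> \<open>Subtraction in \<open>ennreal\<close> truncates at zero, so this is the excess
      of \<open>u\<close> over a multiple of its average.\<close>
    define s where "s y = u y - t * ub y" for y
    have [measurable]: "s \<in> borel_measurable borel"
      unfolding s_def[abs_def] by measurable
    have s_step: "s y \<le> (\<integral>\<^sup>+h. F2 t0 h * s (y + h) \<partial>m)" for y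
    proof -
      have f_le: "ennreal (f h) \<le> ennreal t0 * indicator V h + F2 t0 h" for h
        using f_zero[of h] by (cases "h \<in> C") (auto simp: F2_def V_def intro: ennreal_leI)
      have u_le: "u z \<le> s z + t * ub z" for z
        unfolding s_def by (rule ennreal_le_minus_plus)
      have "u y \<le> (\<integral>\<^sup>+h. (ennreal t0 * indicator V h + F2 t0 h) * u (y + h) \<partial>m)"
        unfolding harm_eq[OF u, of y] by (intro nn_integral_mono mult_right_mono f_le) auto
      also have "\<dots> = (\<integral>\<^sup>+h. ennreal t0 * (indicator V h * u (y + h)) + F2 t0 h * u (y + h) \<partial>m)"
        by (simp add: distrib_right mult.assoc)
      also have "\<dots> = ennreal t0 * ub y + (\<integral>\<^sup>+h. F2 t0 h * u (y + h) \<partial>m)"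
        unfolding ub_def average_def by (subst nn_integral_add) (auto simp: nn_integral_cmult)
      also have "(\<integral>\<^sup>+h. F2 t0 h * u (y + h) \<partial>m) \<le> (\<integral>\<^sup>+h. F2 t0 h * s (y + h) + t * (B * ub y) * F2 t0 h \<partial>m)"
      proof (rule nn_integral_mono)
        fix h
        have "F2 t0 h * u (y + h) \<le> F2 t0 h * s (y + h) + F2 t0 h * (t * ub (y + h))"
          using mult_left_mono[OF u_le[of "y + h"], of "F2 t0 h"] by (simp add: distrib_left)
        also have "F2 t0 h * (t * ub (y + h)) \<le> F2 t0 h * (t * (B * ub y))"
          using ubB[of h y] F2_C[of h t0] by (cases "h \<in> C") (auto intro!: mult_left_mono)
        finally show "F2 t0 h * u (y + h) \<le> F2 t0 h * s (y + h) + t * (B * ub y) * F2 t0 h"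
          by (simp add: mult.commute add_left_mono)
      qed
      also have "\<dots> = (\<integral>\<^sup>+h. F2 t0 h * s (y + h) \<partial>m) + t * (B * ub y) * I"
        unfolding I_def by (subst nn_integral_add) (auto simp: nn_integral_cmult)
      also have "t * (B * ub y) * I = t * ((B * I) * ub y)"
        by (simp only: mult_ac)
      also have "\<dots> \<le> t * (half * ub y)"
        by (intro mult_left_mono mult_right_mono BI) auto
      also have "\<dots> = ennreal t0 * ub y"
        by (simp only: mult.assoc[symmetric] t_half)
      finally have "u y \<le> ennreal t0 * ub y + ((\<integral>\<^sup>+h. F2 t0 h * s (y + h) \<partial>m) + ennreal t0 * ub y)"
        by (simp add: add_left_mono)
      also have "\<dots> = t * ub y + (\<integral>\<^sup>+h. F2 t0 h * s (y + h) \<partial>m)"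
      proof -
        have "t = ennreal t0 + ennreal t0"
          unfolding t_def t0_def by (simp add: ennreal_plus[symmetric] del: ennreal_plus)
        then have "t * ub y = ennreal t0 * ub y + ennreal t0 * ub y"
          by (simp only: distrib_right)
        then show ?thesis by (simp only: add_ac)
      qed
      finally have "u y \<le> t * ub y + (\<integral>\<^sup>+h. F2 t0 h * s (y + h) \<partial>m)" .
      moreover have "t * ub y \<noteq> \<top>"
        using ub_fin[of y] unfolding t_def by (auto simp: ennreal_mult_eq_top_iff)
      ultimately show ?thesis
        unfolding s_def[of y] by (simp add: ennreal_minus_le_iff)
    qed
    \<comment> \<open>By Tonelli the kernel is integrated over \<open>V\<close> first, which costs
      \<open>D * I\<close> because of the inversion. The outer variable is then confined to the
      product of \<open>V\<close> and \<open>C\<close>, covered by the translates of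
      \<open>V\<close> by \<open>F\<close>.\<close>
    have s_avg: "average V s y \<le> D * I * (\<Sum>w\<in>F. average V s (y + w))" for y
    proof -
      have "average V s y \<le> (\<integral>\<^sup>+h. indicator V h * (\<integral>\<^sup>+k. F2 t0 k * s (y + h + k) \<partial>m) \<partial>m)"
        unfolding average_def by (intro nn_integral_mono mult_left_mono s_step) auto
      also have "\<dots> = (\<integral>\<^sup>+h. \<integral>\<^sup>+k. indicator V h * (F2 t0 (- h + k) * s (y + k)) \<partial>m \<partial>m)"
      proof (rule nn_integral_cong)
        fix h
        have "(\<integral>\<^sup>+k. F2 t0 (- h + k) * s (y + k) \<partial>m) = (\<integral>\<^sup>+k. F2 t0 (- h + (h + k)) * s (y + (h + k)) \<partial>m)"
          by (rule nn_integral_translate[symmetric]) measurable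
        also have "\<dots> = (\<integral>\<^sup>+k. F2 t0 k * s (y + h + k) \<partial>m)"
          by (simp add: add.assoc[symmetric])
        finally show "indicator V h * (\<integral>\<^sup>+k. F2 t0 k * s (y + h + k) \<partial>m) = (\<integral>\<^sup>+k. indicator V h * (F2 t0 (- h + k) * s (y + k)) \<partial>m)"
          by (subst nn_integral_cmult) auto
      qed
      also have "\<dots> = (\<integral>\<^sup>+k. \<integral>\<^sup>+h. indicator V h * (F2 t0 (- h + k) * s (y + k)) \<partial>m \<partial>m)"
        by (rule mm.Fubini') measurable
      also have "\<dots> \<le> (\<integral>\<^sup>+k. D * I * (\<Sum>w\<in>F. indicator V (- w + k) * s (y + k)) \<partial>m)"
      proof (rule nn_integral_mono)
        fix k
        have eq: "(\<integral>\<^sup>+h. indicator V h * (F2 t0 (- h + k) * s (y + k)) \<partial>m)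
            = (\<integral>\<^sup>+h. indicator V h * F2 t0 (- h + k) \<partial>m) * s (y + k)"
          by (subst nn_integral_multc[symmetric]) (auto simp: mult.assoc)
        show "(\<integral>\<^sup>+h. indicator V h * (F2 t0 (- h + k) * s (y + k)) \<partial>m)
            \<le> D * I * (\<Sum>w\<in>F. indicator V (- w + k) * s (y + k))"
        proof (cases "k \<in> {v + c |v c. v \<in> V \<and> c \<in> C}")
          case True
          then obtain w where w: "w \<in> F" "- w + k \<in> V"
            using F(2) W0(4) by (auto simp: V_def)
          have "(\<integral>\<^sup>+h. indicator V h * F2 t0 (- h + k) \<partial>m)
              = (\<integral>\<^sup>+h. indicator V (k + h) * F2 t0 (- (k + h) + k) \<partial>m)"
            by (rule nn_integral_translate[symmetric]) measurable
          also have "\<dots> \<le> (\<integral>\<^sup>+h. F2 t0 (- h) \<partial>m)"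
            by (rule nn_integral_mono) (auto simp: indicator_def minus_add add.assoc)
          also have "\<dots> \<le> D * I"
            unfolding I_def by (rule D(2)) (auto simp: F2_C)
          finally have "(\<integral>\<^sup>+h. indicator V h * F2 t0 (- h + k) \<partial>m) * s (y + k) \<le> D * I * s (y + k)"
            by (rule mult_right_mono) simp
          also have "\<dots> \<le> D * I * (\<Sum>w\<in>F. indicator V (- w + k) * s (y + k))"
            using w F(1) member_le_sum[of w F "\<lambda>w. indicator V (- w + k) * s (y + k)"]
            by (intro mult_left_mono) auto
          finally show ?thesis unfolding eq .
        next
          case False
          have "indicator V h * F2 t0 (- h + k) = 0" for h
          proof -
            have "- h + k \<notin> C" if "h \<in> V"
            proof
              assume "- h + k \<in> C"
              moreover have "k = h + (- h + k)" by (simp add: add.assoc[symmetric])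
              ultimately show False using False that by blast
            qed
            then show ?thesis using F2_C by (auto simp: indicator_def)
          qed
          then have "(\<integral>\<^sup>+h. indicator V h * F2 t0 (- h + k) \<partial>m) = (\<integral>\<^sup>+h. 0 \<partial>m)"
            by (simp only:)
          then show ?thesis unfolding eq by simp
        qed
      qed
      also have "\<dots> = D * I * (\<integral>\<^sup>+k. (\<Sum>w\<in>F. indicator V (- w + k) * s (y + k)) \<partial>m)"
        by (rule nn_integral_cmult) measurable
      also have "(\<integral>\<^sup>+k. (\<Sum>w\<in>F. indicator V (- w + k) * s (y + k)) \<partial>m) = (\<Sum>w\<in>F. \<integral>\<^sup>+k. indicator V (- w + k) * s (y + k) \<partial>m)"
        by (rule nn_integral_sum) measurable
      also have "\<dots> = (\<Sum>w\<in>F. average V s (y + w))"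
      proof (rule sum.cong[OF refl])
        fix w
        have "(\<integral>\<^sup>+k. indicator V (- w + k) * s (y + k) \<partial>m) = (\<integral>\<^sup>+k. indicator V (- w + (w + k)) * s (y + (w + k)) \<partial>m)"
          by (rule nn_integral_translate[symmetric]) measurable
        then show "(\<integral>\<^sup>+k. indicator V (- w + k) * s (y + k) \<partial>m) = average V s (y + w)"
          by (simp add: average_def add.assoc[symmetric])
      qed
      finally show ?thesis .
    qed
    \<comment> \<open>In each round \<open>card F\<close> counts the terms and \<open>B\<close> pays
      for moving the average from \<open>y + w\<close> back to \<open>y\<close>; together with
      \<open>D * I\<close> this is at most \<open>half\<close>.\<close>
    have s_pow: "average V s y \<le> half ^ n * ub y" for n y
    proof (induction n arbitrary: y)
      case 0
      have "s z \<le> u z" for z by (simp add: s_def)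
      then show ?case
        unfolding ub_def average_def by (auto intro!: nn_integral_mono mult_left_mono)
    next
      case (Suc n)
      have "average V s y \<le> D * I * (\<Sum>w\<in>F. average V s (y + w))"
        by (rule s_avg)
      also have "\<dots> \<le> D * I * (\<Sum>w\<in>F. half ^ n * (B * ub y))"
        using ubB by (intro mult_left_mono sum_mono order_trans[OF Suc.IH] mult_left_mono) auto
      also have "\<dots> = (D * of_nat (card F) * B * I) * (half ^ n * ub y)"
        by (simp add: mult_ac)
      also have "\<dots> \<le> half * (half ^ n * ub y)"
        by (intro mult_right_mono DI) auto
      finally show ?case by (simp add: mult.assoc)
    qed
    have s_zero: "average V s y = 0"  for y
    proof -
      have "(\<lambda>n. ennreal ((1/2) ^ n)) \<longlonglongrightarrow> ennreal 0"
        by (intro tendsto_ennrealI LIMSEQ_power_zero) simp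
      then have "(\<lambda>n. half ^ n) \<longlonglongrightarrow> 0"
        unfolding half_def by (subst ennreal_power) simp_all
      then have "(\<lambda>n. ub y * half ^ n) \<longlonglongrightarrow> ub y * 0"
        using ub_fin[of y] by (intro ennreal_tendsto_cmult)
      then have "average V s y \<le> 0"
        using s_pow[of y] by (intro LIMSEQ_le_const[of _ 0]) (auto simp: mult.commute)
      then show ?thesis by simp
    qed
    \<comment> \<open>The excess vanishes only almost everywhere, but the mean value property at
      \<open>x\<close> turns a bound almost everywhere on the translate of \<open>C\<close> into one
      at \<open>x\<close>.\<close>
    have "AE h in m. indicator V h * s (x + h) = 0"
      using s_zero[of x] unfolding average_def by (subst (asm) nn_integral_0_iff_AE) auto
    then have "AE h in m. ennreal (f h) * u (x + h) \<le> ennreal (f h) * (t * (B * ub x))"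
    proof eventually_elim
      case (elim h)
      show ?case
      proof (cases "h \<in> C")
        case True
        then have "s (x + h) = 0"
          using elim by (simp add: V_def)
        then have "u (x + h) \<le> t * ub (x + h)"
          unfolding s_def by (simp add: ennreal_minus_eq_0)
        also have "\<dots> \<le> t * (B * ub x)"
          using True by (intro mult_left_mono ubB) auto
        finally show ?thesis by (rule mult_left_mono) simp
      qed (simp add: f_zero)
    qed
    then have "u x \<le> (\<integral>\<^sup>+h. ennreal (f h) * (t * (B * ub x)) \<partial>m)"
      unfolding harm_eq[OF u, of x] by (rule nn_integral_mono_AE)
    also have "\<dots> = t * B * ub x"
      by (subst nn_integral_multc) (auto simp: nn_integral_f mult.assoc)
    finally show ?thesis by (simp add: ub_def)
  qed
  obtain B' where B': "B' \<noteq> \<top>" "\<And>u x q. superharm u \<Longrightarrow> q \<in> Q \<Longrightarrow> average V u (x + q) \<le> B' * average V u x"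
    using harnack_average[OF V V0 Q] by metis
  show ?thesis
  proof (rule that)
    show "t * B * (B' * M) \<noteq> \<top>"
      using B(1) B'(1) M(1) by (simp add: t_def ennreal_mult_eq_top_iff)
    fix u x assume u: "harm u" "u 0 < \<top>" and x: "x \<in> Q"
    have sup: "superharm u" using u(1) by (rule harm_imp_superharm)
    have "u x \<le> t * B * average V u (0 + x)"
      using main[OF u, of x] by simp
    also have "\<dots> \<le> t * B * (B' * average V u 0)"
      by (intro mult_left_mono B'(2) sup x) auto
    also have "average V u 0 \<le> M * u 0"
      using M(2)[OF sup, of 0] by (simp add: average_def)
    finally show "u x \<le> t * B * (B' * M) * u 0"
      by (simp add: mult.assoc mult_left_mono)
  qed
qed

end


section \<open>Compactness of normalised harmonic functions\<close>

text \<open>Function spaces carry the product topology throughout, so that compactness comes from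
  Tychonoff.\<close>

definition equicont :: "('a::topological_space \<Rightarrow> real) set \<Rightarrow> bool" where
  "equicont S \<longleftrightarrow> (\<forall>x. \<forall>e>0. \<exists>V. open V \<and> x \<in> V \<and> (\<forall>u\<in>S. \<forall>y\<in>V. \<bar>u y - u x\<bar> \<le> e))"

lemma equicontD:
  "equicont S \<Longrightarrow> e > 0 \<Longrightarrow> \<exists>V. open V \<and> x \<in> V \<and> (\<forall>u\<in>S. \<forall>y\<in>V. \<bar>u y - u x\<bar> \<le> e)"
  by (simp add: equicont_def)

text \<open>One coordinate controls the function at \<open>x\<close>; equicontinuity controls the
  passage from \<open>x\<close> to nearby points.\<close>

lemma equicont_evaluation:
  fixes S :: "('a::topological_space \<Rightarrow> real) set"
  assumes "equicont S"
  shows "continuous_on (S \<times> UNIV) (\<lambda>p. fst p (snd p))"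
  unfolding continuous_on_def
proof (intro ballI tendstoI)
  fix p :: "('a \<Rightarrow> real) \<times> 'a" and e :: real
  assume "p \<in> S \<times> UNIV" "e > 0"
  obtain u x where p: "p = (u, x)" "u \<in> S"
    using \<open>p \<in> S \<times> UNIV\<close> by auto
  have "e/3 > 0"
    using \<open>e > 0\<close> by simp
  then obtain V where V: "open V" "x \<in> V" "\<And>u y. u \<in> S \<Longrightarrow> y \<in> V \<Longrightarrow> \<bar>u y - u x\<bar> \<le> e/3"
    using equicontD[OF assms, of "e/3" x] by blast
  have "open ((\<lambda>v. v x) -` ball (u x) (e/3))"
    by (rule open_vimage) (auto intro: continuous_on_product_coordinates)
  then have "open ((\<lambda>v. v x) -` ball (u x) (e/3) \<times> V)"
    using V(1) by (rule open_Times)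
  moreover have "p \<in> (\<lambda>v. v x) -` ball (u x) (e/3) \<times> V"
    using p V(2) \<open>e > 0\<close> by simp
  moreover have "dist (fst q (snd q)) (fst p (snd p)) < e"
    if "q \<in> (\<lambda>v. v x) -` ball (u x) (e/3) \<times> V" "q \<in> S \<times> UNIV" for q
  proof -
    have "\<bar>fst q (snd q) - fst q x\<bar> \<le> e/3" "\<bar>fst q x - u x\<bar> < e/3"
      using that V(3)[of "fst q" "snd q"] by (auto simp: dist_real_def abs_minus_commute)
    then show ?thesis
      using \<open>e > 0\<close> unfolding p(1) dist_real_def fst_conv snd_conv by linarith
  qed
  ultimately show "eventually (\<lambda>q. dist (fst q (snd q)) (fst p (snd p)) < e) (at p within S \<times> UNIV)"
    unfolding eventually_at_topological by blast
qed

lemma equicont_imp_continuous: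
  assumes "equicont S" "u \<in> S"
  shows "continuous_on UNIV u"
proof -
  have "continuous_on UNIV ((\<lambda>p. fst p (snd p)) \<circ> (\<lambda>x. (u, x)))"
    by (intro continuous_on_compose continuous_on_subset[OF equicont_evaluation[OF assms(1)]]
        continuous_intros) (use assms(2) in auto)
  then show ?thesis by (simp add: o_def)
qed

lemma compact_PiE_UNIV:
  fixes K :: "'i \<Rightarrow> 'b::topological_space set"
  assumes "\<And>i. compact (K i)"
  shows "compact (PiE UNIV K)"
proof -
  have "compactin (product_topology (\<lambda>i. euclidean) UNIV) (PiE UNIV K)"
    using assms by (subst compactin_PiE) auto
  then show ?thesis
    by (simp add: euclidean_product_topology)
qed

lemma closed_coordinate: "closed A \<Longrightarrow> closed {u :: 'i \<Rightarrow> 'b::topological_space. u x \<in> A}"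
  using closed_vimage[of A "\<lambda>u. u x"] by (simp add: vimage_def)

lemma closed_coordinates:
  assumes "closed {(a, b). P a b}"
  shows "closed {u :: 'i \<Rightarrow> real. P (u x) (u y)}"
proof -
  have "closed ((\<lambda>u :: 'i \<Rightarrow> real. (u x, u y)) -` {(a, b). P a b})"
    by (intro closed_vimage assms continuous_on_Pair continuous_on_product_coordinates)
  then show ?thesis by (simp add: vimage_def)
qed

lemma closed_diff_le: "closed {(a, b). \<bar>a - b\<bar> \<le> (r::real)}"
proof -
  have "{(a, b). \<bar>a - b\<bar> \<le> r} = (\<lambda>p. \<bar>fst p - snd p\<bar>) -` {..r}"
    by auto
  also have "closed \<dots>"
    by (intro closed_vimage closed_atMost continuous_intros)
  finally show ?thesis .
qed

text \<open>The Ascoli argument: pointwise bounds and a fixed choice of moduli of continuity are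
  closed conditions, cutting a compact set out of a product of intervals. Compactness of a subset
  then reduces to closedness.\<close>

lemma equicont_compact_superset:
  fixes S :: "('a::topological_space \<Rightarrow> real) set"
  assumes S: "equicont S" and bound: "\<And>x. \<exists>M. \<forall>u\<in>S. \<bar>u x\<bar> \<le> M"
  obtains T where "S \<subseteq> T" "compact T" "equicont T"
proof -
  obtain M where M: "\<And>x u. u \<in> S \<Longrightarrow> \<bar>u x\<bar> \<le> M x"
    using bound by metis
  have "\<exists>V. open V \<and> x \<in> V \<and> (\<forall>u\<in>S. \<forall>y\<in>V. \<bar>u y - u x\<bar> \<le> inverse (real (Suc n)))" for x n
    using S unfolding equicont_def by simp
  then obtain V where V: "\<And>x n. open (V x n)" "\<And>x n. x \<in> V x n"
    "\<And>x n u y. u \<in> S \<Longrightarrow> y \<in> V x n \<Longrightarrow> \<bar>u y - u x\<bar> \<le> inverse (real (Suc n))"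
    by metis
  define T where "T = PiE UNIV (\<lambda>x. {- M x..M x})
    \<inter> (\<Inter>x n. \<Inter>y\<in>V x n. {u. \<bar>u y - u x\<bar> \<le> inverse (real (Suc n))})"
  show ?thesis
  proof (rule that)
    show "S \<subseteq> T"
    proof
      fix u assume "u \<in> S"
      have "u x \<in> {- M x..M x}" for x
        using M[OF \<open>u \<in> S\<close>, of x] by (simp add: abs_le_iff)
      then show "u \<in> T"
        unfolding T_def using V(3)[OF \<open>u \<in> S\<close>] by (simp add: PiE_iff)
    qed
    show "compact T"
      unfolding T_def
      by (intro compact_Int_closed compact_PiE_UNIV closed_INT ballI closed_coordinates closed_diff_le) auto
    show "equicont T"
      unfolding equicont_def
    proof (intro allI impI)
      fix x :: 'a and e :: real assume "e > 0"
      then obtain n where n: "inverse (real (Suc n)) < e"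
        using reals_Archimedean by auto
      have "\<bar>u y - u x\<bar> \<le> e" if "u \<in> T" "y \<in> V x n" for u y
        using that n unfolding T_def by fastforce
      then show "\<exists>V. open V \<and> x \<in> V \<and> (\<forall>u\<in>T. \<forall>y\<in>V. \<bar>u y - u x\<bar> \<le> e)"
        using V(1,2) by (intro exI[of _ "V x n"]) simp
    qed
  qed
qed

section \<open>Compact sets of functions with a prescribed translation modulus\<close>

context haar_measure
begin

lemma shift_diff_finite:
  assumes "integrable m a"
  shows "shift_diff a g < \<top>"
proof -
  have [measurable]: "a \<in> borel_measurable borel"
    using assms by (auto dest: borel_measurable_integrable)
  have "shift_diff a g \<le> (\<integral>\<^sup>+h. ennreal \<bar>a (g + h)\<bar> + ennreal \<bar>a h\<bar> \<partial>m)"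
    unfolding shift_diff_def
    by (intro nn_integral_mono) (simp add: ennreal_plus[symmetric] del: ennreal_plus)
  also have "\<dots> = (\<integral>\<^sup>+h. ennreal \<bar>a (g + h)\<bar> \<partial>m) + (\<integral>\<^sup>+h. ennreal \<bar>a h\<bar> \<partial>m)"
    by (rule nn_integral_add) measurable
  also have "(\<integral>\<^sup>+h. ennreal \<bar>a (g + h)\<bar> \<partial>m) = (\<integral>\<^sup>+h. ennreal \<bar>a h\<bar> \<partial>m)"
    by (rule nn_integral_translate) measurable
  also have "(\<integral>\<^sup>+h. ennreal \<bar>a h\<bar> \<partial>m) + (\<integral>\<^sup>+h. ennreal \<bar>a h\<bar> \<partial>m) < \<top>"
    using assms by (simp add: integrable_iff_bounded)
  finally show ?thesis .
qed

lemma shift_diff_nhds: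
  assumes a: "integrable m a" and e: "0 < e"
  shows "\<exists>V. open V \<and> x \<in> V \<and>
    (\<forall>y\<in>V. shift_diff a (- y + x) \<le> ennreal e \<and> shift_diff a (- x + y) \<le> ennreal e)"
proof -
  have ev: "eventually (\<lambda>g. shift_diff a g < ennreal e) (nhds 0)"
    using integrable_imp_shift_continuous[OF a] e unfolding shift_continuous_def
    by (auto intro: order_tendstoD(2))
  have "((\<lambda>y. - y + x) \<longlongrightarrow> - x + x) (nhds x)" "((\<lambda>y. - x + y) \<longlongrightarrow> - x + x) (nhds x)"
    by (intro tendsto_add tendsto_minus tendsto_const; simp add: filterlim_ident)+
  then have "((\<lambda>y. - y + x) \<longlongrightarrow> 0) (nhds x)" "((\<lambda>y. - x + y) \<longlongrightarrow> 0) (nhds x)"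
    by simp_all
  from this[THEN eventually_compose_filterlim[OF ev]]
  have "eventually (\<lambda>y. shift_diff a (- y + x) < ennreal e \<and> shift_diff a (- x + y) < ennreal e) (nhds x)"
    by (rule eventually_conj)
  then show ?thesis
    unfolding eventually_nhds using less_imp_le by blast
qed

text \<open>The modulus depends on the points only through \<open>- x + y\<close>, which left
  translation does not change, so the group acts on this set. It will hold the averaged visiting
  functions.\<close>

definition translation_ball :: "('g \<Rightarrow> real) \<Rightarrow> real \<Rightarrow> ('g \<Rightarrow> real) set" where
  "translation_ball a c = {F. (\<forall>x. 0 \<le> F x \<and> F x \<le> c) \<and>
    (\<forall>x y. \<bar>F x - F y\<bar> \<le> enn2real (shift_diff a (- x + y)))}"

lemma compact_translation_ball: "compact (translation_ball a c)"
proof -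
  have eq: "translation_ball a c = PiE UNIV (\<lambda>x. {0..c})
      \<inter> (\<Inter>x y. {u. \<bar>u x - u y\<bar> \<le> enn2real (shift_diff a (- x + y))})"
    unfolding translation_ball_def by (auto simp: PiE_iff)
  show ?thesis
    unfolding eq
    by (intro compact_Int_closed compact_PiE_UNIV closed_INT ballI closed_coordinates closed_diff_le) auto
qed

lemma equicont_translation_ball:
  assumes "integrable m a"
  shows "equicont (translation_ball a c)"
  unfolding equicont_def
proof (intro allI impI)
  fix x :: 'g and e :: real assume "e > 0"
  then obtain V where V: "open V" "x \<in> V" "\<And>y. y \<in> V \<Longrightarrow> shift_diff a (- y + x) \<le> ennreal e"
    using shift_diff_nhds[OF assms, of e x] by blast
  have "\<bar>F y - F x\<bar> \<le> e" if "F \<in> translation_ball a c" "y \<in> V" for F y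
  proof -
    have "\<bar>F y - F x\<bar> \<le> enn2real (shift_diff a (- y + x))"
      using that(1) by (simp add: translation_ball_def)
    also have "\<dots> \<le> e"
      using V(3)[OF that(2)] \<open>e > 0\<close> by (intro enn2real_leI) auto
    finally show ?thesis .
  qed
  then show "\<exists>V. open V \<and> x \<in> V \<and> (\<forall>u\<in>translation_ball a c. \<forall>y\<in>V. \<bar>u y - u x\<bar> \<le> e)"
    using V(1,2) by (intro exI[of _ V]) simp
qed

lemma translation_ball_translate:
  "F \<in> translation_ball a c \<Longrightarrow> (\<lambda>h. F (g + h)) \<in> translation_ball a c"
  unfolding translation_ball_def
proof (intro CollectI conjI allI)
  fix x y assume "F \<in> {F. (\<forall>x. 0 \<le> F x \<and> F x \<le> c) \<and>
    (\<forall>x y. \<bar>F x - F y\<bar> \<le> enn2real (shift_diff a (- x + y)))}"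
  then have "\<bar>F (g + x) - F (g + y)\<bar> \<le> enn2real (shift_diff a (- (g + x) + (g + y)))"
    by blast
  also have "- (g + x) + (g + y) = - x + y"
    by (simp only: minus_add add.assoc minus_add_cancel)
  finally show "\<bar>F (g + x) - F (g + y)\<bar> \<le> enn2real (shift_diff a (- x + y))" .
qed auto

end

section \<open>The compact set of normalised harmonic functions\<close>

context compact_kernel
begin

definition Har :: "('g \<Rightarrow> real) set" where
  "Har = {u. (\<forall>x. 0 \<le> u x) \<and> u 0 = 1 \<and> harm (\<lambda>x. ennreal (u x))}"

lemma HarD:
  assumes "u \<in> Har"
  shows "0 \<le> u x" "u 0 = 1" "harm (\<lambda>x. ennreal (u x))"
  using assms by (auto simp: Har_def)

lemma Har_pos:
  assumes "u \<in> Har"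
  shows "0 < u x"
proof (rule ccontr)
  assume "\<not> 0 < u x"
  then have "u x = 0"
    using HarD(1)[OF assms, of x] by simp
  then have "ennreal (u 0) = 0"
    using harm_zero[OF HarD(3)[OF assms], of x 0] by simp
  then show False
    using HarD(2)[OF assms] by simp
qed

lemma Har_measurable: "u \<in> Har \<Longrightarrow> u \<in> borel_measurable borel"
proof -
  assume u: "u \<in> Har"
  have "(\<lambda>x. enn2real (ennreal (u x))) \<in> borel_measurable borel"
    using harm_measurable[OF HarD(3)[OF u]] by measurable
  then show ?thesis
    using HarD(1)[OF u] by simp
qed

lemma Har_harmonic:
  assumes u: "u \<in> Har"
  shows "harmonic \<theta> u"
  unfolding harmonic_def
proof (intro conjI allI)
  have [measurable]: "u \<in> borel_measurable borel"
    by (rule Har_measurable[OF u])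
  show "u \<in> borel_measurable borel" by measurable
  show "has_bochner_integral \<theta> (\<lambda>h. u (g + h)) (u g)" for g
    using HarD(1,3)[OF u] by (intro has_bochner_integral_nn_integral) (auto simp: harm_def)
qed

lemma Har_bound:
  assumes "compact Q"
  obtains M where "0 < M" "\<And>u x. u \<in> Har \<Longrightarrow> x \<in> Q \<Longrightarrow> u x \<le> M"
proof -
  obtain M where M: "M \<noteq> \<top>" "\<And>u x. harm u \<Longrightarrow> u 0 < \<top> \<Longrightarrow> x \<in> Q \<Longrightarrow> u x \<le> M * u 0"
    using harnack[OF assms] by metis
  show ?thesis
  proof (rule that)
    \<comment> \<open>The summand 1 makes the bound positive, so that equicontinuity can divide by
      it.\<close>
    show "0 < enn2real M + 1"
      by (simp add: add_nonneg_pos)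
    show "u x \<le> enn2real M + 1" if u: "u \<in> Har" and x: "x \<in> Q" for u x
    proof -
      have "ennreal (u x) \<le> M"
        using M(2)[OF HarD(3)[OF u] _ x] HarD(2)[OF u] by simp
      then have "u x \<le> enn2real M"
        using M(1) HarD(1)[OF u] by (cases M) auto
      then show ?thesis by simp
    qed
  qed
qed

text \<open>After a translation, \<open>u w\<close> is the integral of
  \<open>f (- w + h) * u h\<close>, so \<open>w\<close> enters through the kernel alone. For
  \<open>w\<close> in a compact neighbourhood the integrand lives in one compact set, where Harnack
  bounds \<open>u\<close> by \<open>M\<close>; the oscillation is then at most \<open>M\<close>
  times the L^1 modulus of \<open>f\<close>.\<close>

lemma equicont_Har: "equicont Har"
  unfolding equicont_def
proof (intro allI impI)
  fix x :: 'g and e :: real assume e: "e > 0"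
  obtain U K where K: "open U" "compact K" "x \<in> U" "U \<subseteq> K"
    using compact_neighbourhood[of UNIV x] by (metis UNIV_I open_UNIV)
  define Q where "Q = {k + c |k c. k \<in> K \<and> c \<in> C}"
  have "compact Q"
    unfolding Q_def by (intro compact_plus K compact_C)
  then obtain M where M: "0 < M" "\<And>u x. u \<in> Har \<Longrightarrow> x \<in> Q \<Longrightarrow> u x \<le> M"
    using Har_bound by metis
  have le: "ennreal (u y) \<le> ennreal (u z) + ennreal M * shift_diff f (- y + z)"
    if u: "u \<in> Har" and yz: "y \<in> K" "z \<in> K" for u y z
  proof -
    have [measurable]: "u \<in> borel_measurable borel"
      by (rule Har_measurable[OF u])
    have rep: "ennreal (u w) = (\<integral>\<^sup>+h. ennreal (f (- w + h)) * ennreal (u h) \<partial>m)" for w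
    proof -
      have "ennreal (u w) = (\<integral>\<^sup>+h. ennreal (f (- w + (w + h))) * ennreal (u (w + h)) \<partial>m)"
        using harm_eq[OF HarD(3)[OF u], of w] by (simp add: add.assoc[symmetric])
      also have "\<dots> = (\<integral>\<^sup>+h. ennreal (f (- w + h)) * ennreal (u h) \<partial>m)"
        by (rule nn_integral_translate) measurable
      finally show ?thesis .
    qed
    have "ennreal (u y) \<le> (\<integral>\<^sup>+h. ennreal (f (- z + h)) * ennreal (u h) + ennreal M * ennreal \<bar>f (- y + h) - f (- z + h)\<bar> \<partial>m)"
      unfolding rep[of y]
    proof (rule nn_integral_mono)
      fix h
      have "f (- y + h) * u h \<le> f (- z + h) * u h + M * \<bar>f (- y + h) - f (- z + h)\<bar>"
      proof (cases "h \<in> Q")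
        case True
        have "(f (- y + h) - f (- z + h)) * u h \<le> \<bar>f (- y + h) - f (- z + h)\<bar> * M"
          using M(2)[OF u True] HarD(1)[OF u, of h] by (intro mult_mono) auto
        then show ?thesis by (simp add: algebra_simps)
      next
        case False
        have "- w + h \<notin> C" if "w \<in> K" for w
        proof
          assume "- w + h \<in> C"
          moreover have "h = w + (- w + h)" by (simp add: add.assoc[symmetric])
          ultimately show False using False that unfolding Q_def by blast
        qed
        then show ?thesis using yz by (simp add: f_zero)
      qed
      then show "ennreal (f (- y + h)) * ennreal (u h)
          \<le> ennreal (f (- z + h)) * ennreal (u h) + ennreal M * ennreal \<bar>f (- y + h) - f (- z + h)\<bar>"
        using HarD(1)[OF u, of h] f_nonneg M(1)
        by (simp add: ennreal_mult[symmetric] ennreal_plus[symmetric] ennreal_leI del: ennreal_plus)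
    qed
    also have "\<dots> = ennreal (u z) + ennreal M * (\<integral>\<^sup>+h. ennreal \<bar>f (- y + h) - f (- z + h)\<bar> \<partial>m)"
      unfolding rep[of z] by (subst nn_integral_add) (auto simp: nn_integral_cmult)
    also have "(\<integral>\<^sup>+h. ennreal \<bar>f (- y + h) - f (- z + h)\<bar> \<partial>m)
        = (\<integral>\<^sup>+h. ennreal \<bar>f (- y + (z + h)) - f (- z + (z + h))\<bar> \<partial>m)"
      by (rule nn_integral_translate[symmetric]) measurable
    also have "\<dots> = shift_diff f (- y + z)"
      by (simp add: shift_diff_def add.assoc[symmetric])
    finally show ?thesis .
  qed
  have "0 < e / M"
    using e M(1) by simp
  then obtain V where V: "open V" "x \<in> V" "\<And>y. y \<in> V \<Longrightarrow> shift_diff f (- y + x) \<le> ennreal (e / M)"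
    "\<And>y. y \<in> V \<Longrightarrow> shift_diff f (- x + y) \<le> ennreal (e / M)"
    using shift_diff_nhds[OF integrable_f, of "e / M" x] by blast
  have "\<bar>u y - u x\<bar> \<le> e" if u: "u \<in> Har" and y: "y \<in> U \<inter> V" for u y
  proof -
    have Me: "ennreal M * ennreal (e / M) = ennreal e"
      using e M(1) by (simp add: ennreal_mult[symmetric])
    have "ennreal (u y) \<le> ennreal (u x) + ennreal M * ennreal (e / M)"
      using le[OF u, of y x] V(3)[of y] y K by (meson IntD1 IntD2 add_left_mono mult_left_mono order_trans subsetD zero_le)
    then have 1: "u y \<le> u x + e"
      unfolding Me using e HarD(1)[OF u] by (simp add: ennreal_plus[symmetric] del: ennreal_plus)
    have "ennreal (u x) \<le> ennreal (u y) + ennreal M * ennreal (e / M)"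
      using le[OF u, of x y] V(4)[of y] y K by (meson IntD1 IntD2 add_left_mono mult_left_mono order_trans subsetD zero_le)
    then have 2: "u x \<le> u y + e"
      unfolding Me using e HarD(1)[OF u] by (simp add: ennreal_plus[symmetric] del: ennreal_plus)
    from 1 2 show ?thesis by linarith
  qed
  then show "\<exists>V. open V \<and> x \<in> V \<and> (\<forall>u\<in>Har. \<forall>y\<in>V. \<bar>u y - u x\<bar> \<le> e)"
    using K V by (intro exI[of _ "U \<inter> V"]) auto
qed

text \<open>Closedness inside \<open>T'\<close> remains. Evaluation is jointly continuous there and
  the kernel lives on the compact set \<open>C\<close>, so the mean value \<open>J g\<close> is
  continuous in \<open>u\<close> and harmonicity survives pointwise limits.\<close>

lemma compact_Har: "compact Har"
proof -
  have "\<exists>M. \<forall>u\<in>Har. \<bar>u x\<bar> \<le> M" for x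
  proof -
    have "compact {x}" by simp
    then obtain M where "\<And>u y. u \<in> Har \<Longrightarrow> y \<in> {x} \<Longrightarrow> u y \<le> M"
      using Har_bound by metis
    then have "\<forall>u\<in>Har. \<bar>u x\<bar> \<le> M"
      using HarD(1) by simp
    then show ?thesis ..
  qed
  then obtain T where T: "Har \<subseteq> T" "compact T" "equicont T"
    using equicont_compact_superset[OF equicont_Har] by metis
  define T' where "T' = T \<inter> ({u. u 0 \<in> {1}} \<inter> (\<Inter>x. {u. u x \<in> {0..}}))"
  have T': "compact T'"
    unfolding T'_def by (intro compact_Int_closed T closed_Int closed_INT ballI closed_coordinate) auto
  have T'T: "T' \<subseteq> T" by (auto simp: T'_def)
  have cont: "continuous_on UNIV u" if "u \<in> T'" for u
    using equicont_imp_continuous[OF T(3)] that T'T by auto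
  have meas [measurable]: "u \<in> borel_measurable borel" if "u \<in> T'" for u
    using cont[OF that] by (rule borel_measurable_continuous_onI)
  have int: "integrable m (\<lambda>h. f h * u (g + h))" if u: "u \<in> T'" for u g
  proof -
    have "continuous_on C (\<lambda>h. u (g + h))"
      by (rule continuous_on_compose2[OF cont[OF u]]) (auto intro!: continuous_intros)
    then have "bounded ((\<lambda>h. u (g + h)) ` C)"
      by (intro compact_imp_bounded compact_continuous_image compact_C)
    then obtain b where b: "\<And>h. h \<in> C \<Longrightarrow> \<bar>u (g + h)\<bar> \<le> b"
      by (auto simp: bounded_iff)
    have [measurable]: "u \<in> borel_measurable borel"
      by (rule meas[OF u])
    show ?thesis
    proof (rule Bochner_Integration.integrable_bound)
      show "integrable m (\<lambda>h. b * f h)"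
        using integrable_f by (rule integrable_mult_right)
      show "AE h in m. norm (f h * u (g + h)) \<le> norm (b * f h)"
      proof (rule AE_I2)
        fix h show "norm (f h * u (g + h)) \<le> norm (b * f h)"
        proof (cases "h \<in> C")
          case True
          have "\<bar>u (g + h)\<bar> \<le> \<bar>b\<bar>"
            using b[OF True] by linarith
          then show ?thesis
            using f_nonneg[of h] mult_right_mono[of "\<bar>u (g + h)\<bar>" "\<bar>b\<bar>" "f h"] by (simp add: abs_mult mult.commute)
        qed (simp add: f_zero)
      qed
    qed measurable
  qed
  define J where "J g u = (\<integral>h. f h * u (g + h) \<partial>m)" for g and u :: "'g \<Rightarrow> real"
  have J_cont: "continuous_on T' (J g)" for g
    unfolding continuous_on_def
  proof (intro ballI tendstoI)
    fix u and e :: real assume u: "u \<in> T'" and e: "e > 0"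
    have pair: "continuous_on (T' \<times> C) (\<lambda>p. (fst p, g + snd p))"
      by (intro continuous_intros)
    have "continuous_on (T' \<times> C) (\<lambda>p. fst (fst p, g + snd p) (snd (fst p, g + snd p)))"
      by (rule continuous_on_compose2[OF equicont_evaluation[OF T(3)] pair]) (use T'T in auto)
    then have c: "continuous_on (T' \<times> C) (\<lambda>p. fst p (g + snd p))"
      by simp
    have e2: "e/2 > 0" using e by simp
    obtain X where X: "u \<in> X" "open X"
      "\<forall>v\<in>X \<inter> T'. \<forall>h\<in>C. dist (fst (v, h) (g + snd (v, h))) (fst (u, h) (g + snd (u, h))) \<le> e/2"
      by (rule continuous_on_prod_compactE[OF c compact_C u e2])
    have "dist (J g v) (J g u) < e" if v: "v \<in> X" "v \<in> T'" for v
    proof -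
      have "J g v - J g u = (\<integral>h. f h * v (g + h) - f h * u (g + h) \<partial>m)"
        unfolding J_def using int u v by simp
      also have "\<bar>\<dots>\<bar> \<le> (\<integral>h. \<bar>f h * v (g + h) - f h * u (g + h)\<bar> \<partial>m)"
        by (rule integral_abs_bound)
      also have "\<dots> \<le> (\<integral>h. f h * (e/2) \<partial>m)"
      proof (rule integral_mono)
        show "integrable m (\<lambda>h. \<bar>f h * v (g + h) - f h * u (g + h)\<bar>)"
          using int u v by (intro integrable_abs) simp
        show "integrable m (\<lambda>h. f h * (e/2))"
          using integrable_f by simp
        fix h
        show "\<bar>f h * v (g + h) - f h * u (g + h)\<bar> \<le> f h * (e/2)"
        proof (cases "h \<in> C")
          case True
          then have "\<bar>v (g + h) - u (g + h)\<bar> \<le> e/2"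
            using X(3) v by (auto simp: dist_real_def)
          then show ?thesis
            using f_nonneg[of h] mult_left_mono[of "\<bar>v (g + h) - u (g + h)\<bar>" "e/2" "f h"]
            by (simp only: right_diff_distrib[symmetric] abs_mult abs_of_nonneg)
        qed (simp add: f_zero)
      qed
      also have "\<dots> = e/2"
        using integral_f by simp
      finally show ?thesis using e by (simp add: dist_real_def)
    qed
    then show "eventually (\<lambda>v. dist (J g v) (J g u) < e) (at u within T')"
      unfolding eventually_at_topological using X by blast
  qed
  have "Har = (\<Inter>g. {u\<in>T'. J g u - u g \<in> {0}})"
  proof (intro equalityI subsetI)
    fix u assume u: "u \<in> Har"
    then have uT: "u \<in> T'"
      using T(1) HarD by (auto simp: T'_def)
    have "J g u = u g" for g
      using harm_eq[OF HarD(3)[OF u], of g, symmetric] HarD(1)[OF u] f_nonneg meas[OF uT]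
      unfolding J_def by (subst integral_eq_nn_integral) (auto simp: ennreal_mult[symmetric])
    then show "u \<in> (\<Inter>g. {u\<in>T'. J g u - u g \<in> {0}})"
      using uT by auto
  next
    fix u assume "u \<in> (\<Inter>g. {u\<in>T'. J g u - u g \<in> {0}})"
    then have u: "u \<in> T'" "\<And>g. J g u = u g" by auto
    have nn: "0 \<le> u x" "u 0 = 1" for x
      using u(1) by (auto simp: T'_def)
    have [measurable]: "u \<in> borel_measurable borel"
      by (rule meas[OF u(1)])
    have "(\<integral>\<^sup>+h. ennreal (u (g + h)) \<partial>\<theta>) = ennreal (u g)" for g
    proof -
      have "(\<integral>\<^sup>+h. ennreal (u (g + h)) \<partial>\<theta>) = (\<integral>\<^sup>+h. ennreal (f h * u (g + h)) \<partial>m)"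
        by (subst nn_integral_\<theta>) (auto simp: ennreal_mult nn f_nonneg)
      also have "\<dots> = ennreal (J g u)"
        unfolding J_def using int[OF u(1)] nn f_nonneg by (intro nn_integral_eq_integral) auto
      finally show ?thesis by (simp add: u(2))
    qed
    then show "u \<in> Har"
      using nn by (auto simp: Har_def harm_def)
  qed
  moreover have "closedin (top_of_set T') {u\<in>T'. J g u - u g \<in> {0}}" for g
  proof -
    have "continuous_on T' (\<lambda>u. J g u - u g)"
      by (intro continuous_on_diff J_cont continuous_on_subset[OF continuous_on_product_coordinates]) simp
    then show ?thesis
      using continuous_closedin_preimage_constant[of T' "\<lambda>u. J g u - u g" 0] by simp
  qed
  then have "closedin (top_of_set T') (\<Inter>g. {u\<in>T'. J g u - u g \<in> {0}})"
    by (intro closedin_INT) auto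
  ultimately obtain Z where "closed Z" "Har = T' \<inter> Z"
    by (auto simp: closedin_closed)
  then show ?thesis
    using T' by (simp add: compact_Int_closed)
qed

lemma Har_translate:
  assumes u: "u \<in> Har"
  shows "(\<lambda>h. u (g + h) / u g) \<in> Har"
proof -
  have [measurable]: "u \<in> borel_measurable borel"
    by (rule Har_measurable[OF u])
  have pos: "0 < u g" by (rule Har_pos[OF u])
  have "(\<integral>\<^sup>+k. ennreal (u (g + (h + k)) / u g) \<partial>\<theta>) = ennreal (u (g + h) / u g)" for h
  proof -
    have "(\<integral>\<^sup>+k. ennreal (u (g + (h + k)) / u g) \<partial>\<theta>) = (\<integral>\<^sup>+k. ennreal (1 / u g) * ennreal (u (g + h + k)) \<partial>\<theta>)"
      using pos HarD(1)[OF u] by (simp add: ennreal_mult[symmetric] add.assoc)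
    also have "\<dots> = ennreal (1 / u g) * (\<integral>\<^sup>+k. ennreal (u (g + h + k)) \<partial>\<theta>)"
      by (rule nn_integral_cmult) measurable
    also have "\<dots> = ennreal (u (g + h) / u g)"
      using HarD(1,3)[OF u] pos by (simp add: harm_def ennreal_mult[symmetric])
    finally show ?thesis .
  qed
  then have "harm (\<lambda>h. ennreal (u (g + h) / u g))"
    unfolding harm_def by auto
  then show ?thesis
    using pos HarD(1)[OF u] by (simp add: Har_def)
qed

end


section \<open>The compact model\<close>

text \<open>
  A point of the model is a sequence of functions on the group, encoded by its values on the dense
  sequence \<open>q\<close>. Its first entry is a normalised harmonic function, which carries the cocycle, and
  the other entries only serve to separate points.
\<close>

locale compact_model = compact_kernel m \<theta> f C
  for m \<theta> :: "'g::{topological_group_add, second_countable_topology, t2_space} measure" and f C +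
  fixes a :: "nat \<Rightarrow> 'g \<Rightarrow> real" and c :: "nat \<Rightarrow> real" and q :: "nat \<Rightarrow> 'g"
  assumes integrable_a: "integrable m (a i)"
    and dense_q: "closure (range q) = UNIV"
begin

definition fibre :: "nat \<Rightarrow> ('g \<Rightarrow> real) set" where
  "fibre n = (case n of 0 \<Rightarrow> Har | Suc i \<Rightarrow> translation_ball (a i) (c i))"

definition points :: "(nat \<Rightarrow> 'g \<Rightarrow> real) set" where
  "points = PiE UNIV fibre"

text \<open>The index codes an entry and a point of \<open>q\<close>. Values on a dense sequence
  determine continuous functions, so on the compact set \<open>points\<close> this is a
  homeomorphism onto its image, which lies in a metric space.\<close>

definition enc :: "(nat \<Rightarrow> 'g \<Rightarrow> real) \<Rightarrow> nat \<Rightarrow> real" where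
  "enc k = (\<lambda>i. k (fst (prod_decode i)) (q (snd (prod_decode i))))"

definition model :: "(nat \<Rightarrow> real) set" where
  "model = enc ` points"

definition dec :: "(nat \<Rightarrow> real) \<Rightarrow> nat \<Rightarrow> 'g \<Rightarrow> real" where
  "dec = inv_into points enc"

text \<open>Left translation in every entry. The first entry is also divided by its value at
  \<open>- g\<close>, which restores the value 1 at the identity; these divisors are the
  cocycle.\<close>

definition point_act :: "'g \<Rightarrow> (nat \<Rightarrow> 'g \<Rightarrow> real) \<Rightarrow> nat \<Rightarrow> 'g \<Rightarrow> real" where
  "point_act g k n h = (if n = 0 then k 0 (- g + h) / k 0 (- g) else k n (- g + h))"

definition model_act :: "'g \<Rightarrow> (nat \<Rightarrow> real) \<Rightarrow> nat \<Rightarrow> real" where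
  "model_act g \<kappa> = enc (point_act g (dec \<kappa>))"

text \<open>The argument is \<open>- g\<close> because the first entry lists the derivatives of the
  translates by \<open>g\<close>, while the cocycle at \<open>g\<close> is the derivative of the
  translate by its inverse.\<close>

definition model_cocycle :: "'g \<Rightarrow> (nat \<Rightarrow> real) \<Rightarrow> real" where
  "model_cocycle g \<kappa> = dec \<kappa> 0 (- g)"

lemma points_iff: "k \<in> points \<longleftrightarrow> k 0 \<in> Har \<and> (\<forall>i. k (Suc i) \<in> translation_ball (a i) (c i))"
  unfolding points_def fibre_def by (auto simp: PiE_iff split: nat.splits)

lemma compact_fibre: "compact (fibre n)"
  by (cases n) (auto simp: fibre_def compact_Har compact_translation_ball)

lemma equicont_fibre: "equicont (fibre n)"
  by (cases n) (auto simp: fibre_def equicont_Har equicont_translation_ball integrable_a)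

lemma compact_points: "compact points"
  unfolding points_def by (intro compact_PiE_UNIV compact_fibre)

lemma continuous_on_enc: "continuous_on S enc"
proof -
  have "continuous_on UNIV (\<lambda>k. (k n :: 'g \<Rightarrow> real) h)" for n :: nat and h
    by (rule continuous_on_product_then_coordinatewise[OF continuous_on_product_coordinates])
  then have "continuous_on UNIV enc"
    unfolding enc_def[abs_def] by (intro continuous_on_coordinatewise_then_product)
  then show ?thesis
    by (rule continuous_on_subset) simp
qed

lemma eq_on_dense:
  fixes u v :: "'g \<Rightarrow> real"
  assumes "continuous_on UNIV u" "continuous_on UNIV v" "\<And>j. u (q j) = v (q j)"
  shows "u = v"
proof -
  have "closed {x. u x = v x}"
    using assms(1,2) by (rule closed_Collect_eq)
  moreover have "range q \<subseteq> {x. u x = v x}"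
    using assms(3) by auto
  ultimately have "closure (range q) \<subseteq> {x. u x = v x}"
    by (intro closure_minimal)
  then show ?thesis
    using dense_q by auto
qed

lemma inj_on_enc: "inj_on enc points"
proof (rule inj_onI, rule ext)
  fix k l n assume k: "k \<in> points" and l: "l \<in> points" and eq: "enc k = enc l"
  have kl: "k n \<in> fibre n" "l n \<in> fibre n"
    using k l by (auto simp: points_def)
  have "k n (q j) = l n (q j)" for j
    using fun_cong[OF eq, of "prod_encode (n, j)"] by (simp add: enc_def)
  then show "k n = l n"
    by (intro eq_on_dense equicont_imp_continuous[OF equicont_fibre kl(1)]
        equicont_imp_continuous[OF equicont_fibre kl(2)])
qed

lemma dec_enc: "k \<in> points \<Longrightarrow> dec (enc k) = k"
  unfolding dec_def by (rule inv_into_f_f[OF inj_on_enc])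

lemma dec_points: "\<kappa> \<in> model \<Longrightarrow> dec \<kappa> \<in> points"
  unfolding model_def using dec_enc by auto

lemma enc_dec: "\<kappa> \<in> model \<Longrightarrow> enc (dec \<kappa>) = \<kappa>"
  unfolding model_def using dec_enc by auto

lemma compact_model: "compact model"
  unfolding model_def by (intro compact_continuous_image continuous_on_enc compact_points)

lemma continuous_on_dec: "continuous_on model dec"
  unfolding model_def by (rule continuous_on_inv[OF continuous_on_enc compact_points]) (simp add: dec_enc)

lemma dec_Har: "\<kappa> \<in> model \<Longrightarrow> dec \<kappa> 0 \<in> Har"
  using dec_points points_iff by blast

lemma continuous_on_evaluate:
  "continuous_on (UNIV \<times> model) (\<lambda>p. dec (snd p) n (- fst p + h))"
proof -
  have "continuous_on (UNIV \<times> model) (\<lambda>p :: 'g \<times> (nat \<Rightarrow> real). dec (snd p))"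
    by (rule continuous_on_compose2[OF continuous_on_dec continuous_on_snd[OF continuous_on_id]]) auto
  then have "continuous_on (UNIV \<times> model) (\<lambda>p :: 'g \<times> (nat \<Rightarrow> real). dec (snd p) n)"
    by (rule continuous_on_product_then_coordinatewise)
  moreover have "continuous_on (UNIV \<times> model) (\<lambda>p. - fst p + h)"
    by (intro continuous_intros)
  ultimately have "continuous_on (UNIV \<times> model) (\<lambda>p. (dec (snd p) n, - fst p + h))"
    by (rule continuous_on_Pair)
  then have "continuous_on (UNIV \<times> model) (\<lambda>p. fst (dec (snd p) n, - fst p + h) (snd (dec (snd p) n, - fst p + h)))"
    by (rule continuous_on_compose2[OF equicont_evaluation[OF equicont_fibre[of n]]])
       (use dec_points in \<open>auto simp: points_def PiE_iff\<close>)
  then show ?thesis by simp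
qed

lemma point_act_points:
  assumes "k \<in> points"
  shows "point_act g k \<in> points"
  unfolding points_iff
proof (intro conjI allI)
  have k: "k 0 \<in> Har" "\<And>i. k (Suc i) \<in> translation_ball (a i) (c i)"
    using assms by (auto simp: points_iff)
  have "point_act g k 0 = (\<lambda>h. k 0 (- g + h) / k 0 (- g))"
    by (simp add: point_act_def fun_eq_iff)
  then show "point_act g k 0 \<in> Har"
    using Har_translate[OF k(1)] by simp
  have "point_act g k (Suc i) = (\<lambda>h. k (Suc i) (- g + h))" for i
    by (simp add: point_act_def fun_eq_iff)
  then show "point_act g k (Suc i) \<in> translation_ball (a i) (c i)" for i
    using translation_ball_translate[OF k(2)] by simp
qed

lemma point_act_zero: "k \<in> points \<Longrightarrow> point_act 0 k = k"
  using HarD(2)[of "k 0"] by (auto simp: point_act_def fun_eq_iff points_iff)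

lemma point_act_plus: "k \<in> points \<Longrightarrow> point_act (g + h) k = point_act g (point_act h k)"
proof (intro ext)
  fix n x assume "k \<in> points"
  then have "0 < k 0 y" for y
    using Har_pos[of "k 0" y] by (auto simp: points_iff)
  then have "k 0 y \<noteq> 0" for y
    by (metis less_irrefl)
  then show "point_act (g + h) k n x = point_act g (point_act h k) n x"
    by (simp add: point_act_def minus_add add.assoc del: add_uminus_conv_diff)
qed

lemma dec_model_act: "\<kappa> \<in> model \<Longrightarrow> dec (model_act g \<kappa>) = point_act g (dec \<kappa>)"
  unfolding model_act_def by (intro dec_enc point_act_points dec_points)

lemma model_act_model: "\<kappa> \<in> model \<Longrightarrow> model_act g \<kappa> \<in> model"
  unfolding model_act_def model_def[symmetric] using point_act_points[OF dec_points]
  by (auto simp: model_def)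

lemma continuous_on_model_act: "continuous_on (UNIV \<times> model) (\<lambda>(g, \<kappa>). model_act g \<kappa>)"
proof (rule continuous_on_coordinatewise_then_product)
  fix i
  define n h where "n = fst (prod_decode i)" and "h = q (snd (prod_decode i))"
  \<comment> \<open>The summand 0 gives the denominator the shape of
    \<open>continuous_on_evaluate\<close>.\<close>
  let ?F = "\<lambda>p. if n = 0 then dec (snd p) 0 (- fst p + h) / dec (snd p) 0 (- fst p + 0) else dec (snd p) n (- fst p + h)"
  have eq: "(\<lambda>p. (case p of (g, \<kappa>) \<Rightarrow> model_act g \<kappa>) i)
      = ?F"
    by (auto simp: model_act_def enc_def point_act_def n_def h_def fun_eq_iff)
  have ne: "dec (snd p) 0 (- fst p + 0) \<noteq> 0" if "p \<in> UNIV \<times> model" for p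
    using Har_pos[OF dec_Har, of "snd p" "- fst p + 0"] that by auto
  show "continuous_on (UNIV \<times> model) (\<lambda>p. (case p of (g, \<kappa>) \<Rightarrow> model_act g \<kappa>) i)"
    unfolding eq
  proof (cases "n = 0")
    case True
    have "continuous_on (UNIV \<times> model) (\<lambda>p. dec (snd p) 0 (- fst p + h) / dec (snd p) 0 (- fst p + 0))"
      using ne by (intro continuous_on_divide continuous_on_evaluate) blast
    then show "continuous_on (UNIV \<times> model) ?F"
      using True by simp
  qed (simp add: continuous_on_evaluate)
qed

lemma compact_G_space_model: "compact_G_space model model_act"
  unfolding compact_G_space_def action_on_def
proof (intro conjI allI ballI)
  fix \<kappa> assume \<kappa>: "\<kappa> \<in> model"
  show "model_act g \<kappa> \<in> model" for g
    by (rule model_act_model[OF \<kappa>])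
  show "model_act 0 \<kappa> = \<kappa>"
    using \<kappa> by (simp add: model_act_def point_act_zero dec_points enc_dec)
  show "model_act (g + h) \<kappa> = model_act g (model_act h \<kappa>)" for g h
    using \<kappa> dec_model_act[OF \<kappa>, of h] point_act_plus[OF dec_points[OF \<kappa>]]
    by (simp add: model_act_def[of g] model_act_def[of "g + h"])
qed (rule compact_model, rule continuous_on_model_act)

lemma cocycle_on_model: "cocycle_on model model_act model_cocycle"
  unfolding cocycle_on_def
proof (intro conjI allI ballI)
  fix \<kappa> assume \<kappa>: "\<kappa> \<in> model"
  have pos: "0 < dec \<kappa> 0 y" for y
    by (rule Har_pos[OF dec_Har[OF \<kappa>]])
  show "0 < model_cocycle g \<kappa>" for g
    unfolding model_cocycle_def by (rule pos)
  show "model_cocycle (g + h) \<kappa> = model_cocycle g (model_act h \<kappa>) * model_cocycle h \<kappa>" for g h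
    using pos[of "- h"]
    by (simp add: model_cocycle_def dec_model_act[OF \<kappa>] point_act_def minus_add del: add_uminus_conv_diff)
qed

lemma harmonic_on_model: "harmonic_on \<theta> model model_cocycle"
  unfolding harmonic_on_def model_cocycle_def using Har_harmonic[OF dec_Har] by simp

lemma continuous_on_model_cocycle: "continuous_on (UNIV \<times> model) (\<lambda>(g, \<kappa>). model_cocycle g \<kappa>)"
  using continuous_on_evaluate[of 0 0] by (simp add: model_cocycle_def case_prod_unfold)

end


section \<open>The Radon--Nikodym cocycle of a stationary space\<close>

lemma dense_sequence:
  obtains q :: "nat \<Rightarrow> 'a::second_countable_topology" where "closure (range q) = UNIV"
proof -
  obtain D :: "'a set" where D: "countable D" "\<And>X. open X \<Longrightarrow> X \<noteq> {} \<Longrightarrow> \<exists>d\<in>D. d \<in> X"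
    using countable_dense_setE by blast
  have "D \<noteq> {}"
    using D(2)[of UNIV] by auto
  then have "range (from_nat_into D) = D"
    by (rule range_from_nat_into[OF _ D(1)])
  moreover have "closure D = UNIV"
    using D(2)[of "- closure D"] closure_subset by blast
  ultimately show ?thesis
    by (intro that[of "from_nat_into D"]) simp
qed

lemma (in haar_measure) AE_imp_ex:
  assumes "AE g in m. P g"
  shows "\<exists>g. P g"
proof (rule ccontr)
  assume "\<nexists>g. P g"
  moreover obtain N where "N \<in> null_sets m" "\<And>g. g \<in> space m - N \<Longrightarrow> P g"
    using AE_E3[OF assms] by blast
  ultimately have "UNIV \<in> null_sets m"
    by (metis DiffI UNIV_I UNIV_eq_I space_m)
  then show False
    using not_null_UNIV by auto
qed

locale stationary = compact_kernel m \<theta> f C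
  for m \<theta> :: "'g::{topological_group_add, second_countable_topology, t2_space} measure" and f C +
  fixes \<mu> :: "'x measure" and T :: "'g \<Rightarrow> 'x \<Rightarrow> 'x"
  assumes stationary: "stationary_space \<theta> \<mu> T"
begin

sublocale prob_mu: prob_space \<mu>
  using stationary by (simp add: stationary_space_def stationary_measure_def)

sublocale m_mu: pair_sigma_finite m \<mu> ..

sublocale theta_mu: pair_sigma_finite \<theta> \<mu> ..

lemma T_space: "x \<in> space \<mu> \<Longrightarrow> T g x \<in> space \<mu>"
  and T_zero: "x \<in> space \<mu> \<Longrightarrow> T 0 x = x"
  and T_plus: "x \<in> space \<mu> \<Longrightarrow> T (g + h) x = T g (T h x)"
  using stationary unfolding stationary_space_def borel_action_def action_on_def by blast+

lemma T_measurable [measurable (raw)]: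
  assumes [measurable]: "a \<in> borel_measurable N" "b \<in> measurable N \<mu>"
  shows "(\<lambda>w. T (a w) (b w)) \<in> measurable N \<mu>"
proof -
  have "(\<lambda>(g, x). T g x) \<in> borel \<Otimes>\<^sub>M \<mu> \<rightarrow>\<^sub>M \<mu>"
    using stationary unfolding stationary_space_def borel_action_def by blast
  moreover have "(\<lambda>w. (a w, b w)) \<in> N \<rightarrow>\<^sub>M borel \<Otimes>\<^sub>M \<mu>"
    by measurable
  ultimately have "(\<lambda>(g, x). T g x) \<circ> (\<lambda>w. (a w, b w)) \<in> measurable N \<mu>"
    by (rule measurable_comp[rotated])
  then show ?thesis by (simp add: o_def)
qed

text \<open>The measure of \<open>A\<close> under the translate by \<open>g\<close>, written as an
  integral so that measurability in \<open>g\<close> follows from that of the action.\<close>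

definition mass :: "'x set \<Rightarrow> 'g \<Rightarrow> ennreal" where
  "mass A g = (\<integral>\<^sup>+x. indicator A (T g x) \<partial>\<mu>)"

lemma emeasure_translate_eq:
  assumes [measurable]: "A \<in> sets \<mu>"
  shows "emeasure (translate \<mu> T g) A = mass A g"
proof -
  have "emeasure (translate \<mu> T g) A = (\<integral>\<^sup>+x. indicator A x \<partial>distr \<mu> \<mu> (T g))"
    unfolding translate_def by (subst nn_integral_indicator) auto
  also have "\<dots> = mass A g"
    unfolding mass_def by (subst nn_integral_distr) auto
  finally show ?thesis .
qed

lemma mass_zero:
  assumes "A \<in> sets \<mu>"
  shows "mass A 0 = emeasure \<mu> A"
proof -
  have "mass A 0 = (\<integral>\<^sup>+x. indicator A x \<partial>\<mu>)"
    unfolding mass_def by (intro nn_integral_cong) (simp add: T_zero)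
  then show ?thesis using assms by simp
qed

lemma mass_stationary:
  assumes "A \<in> sets \<mu>"
  shows "(\<integral>\<^sup>+g. mass A g \<partial>\<theta>) = emeasure \<mu> A"
  using stationary assms unfolding stationary_space_def stationary_measure_def
  by (simp add: emeasure_translate_eq)

text \<open>Stationarity is the mean value property at the identity; at \<open>g\<close> it is
  applied to the preimage \<open>A'\<close>.\<close>

lemma harm_mass:
  assumes [measurable]: "A \<in> sets \<mu>"
  shows "harm (mass A)"
  unfolding harm_def
proof (intro conjI allI)
  show "mass A \<in> borel_measurable borel"
    unfolding mass_def[abs_def] by measurable
  fix g
  define A' where "A' = T g -` A \<inter> space \<mu>"
  have [measurable]: "A' \<in> sets \<mu>"
    unfolding A'_def by measurable
  have "mass A (g + h) = mass A' h" for h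
    unfolding mass_def by (intro nn_integral_cong) (auto simp: A'_def T_plus T_space indicator_def)
  then have "(\<integral>\<^sup>+h. mass A (g + h) \<partial>\<theta>) = emeasure \<mu> A'"
    by (simp add: mass_stationary)
  also have "\<dots> = (\<integral>\<^sup>+x. indicator A' x \<partial>\<mu>)"
    by simp
  also have "\<dots> = mass A g"
    unfolding mass_def by (intro nn_integral_cong) (auto simp: A'_def indicator_def)
  finally show "(\<integral>\<^sup>+h. mass A (g + h) \<partial>\<theta>) = mass A g" .
qed

text \<open>Quasi-invariance: for a null set \<open>N\<close> the harmonic function
  \<open>mass N\<close> vanishes at the identity, hence everywhere by
  \<open>harm_zero\<close>.\<close>

lemma AE_act:
  assumes "AE x in \<mu>. P x"
  shows "AE x in \<mu>. P (T g x)"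
proof -
  obtain N where N: "N \<in> null_sets \<mu>" "\<And>x. x \<in> space \<mu> - N \<Longrightarrow> P x"
    using AE_E3[OF assms] by blast
  have [measurable]: "N \<in> sets \<mu>"
    using N(1) by auto
  have "mass N 0 = 0"
    using mass_zero[of N] null_setsD1[OF N(1)] by simp
  then have "mass N g = 0"
    by (rule harm_zero[OF harm_mass, rotated]) measurable
  then have "AE x in \<mu>. indicator N (T g x) = (0 :: ennreal)"
    unfolding mass_def by (subst (asm) nn_integral_0_iff_AE) auto
  then show ?thesis
    using AE_space
  proof eventually_elim
    case (elim x)
    then show ?case
      using N(2)[of "T g x"] T_space by (auto simp: indicator_def split: if_splits)
  qed
qed

text \<open>Differentiating all translates at once on the product space yields a jointly measurable
  density, which separate choices for each group element would not guarantee.\<close>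

definition flow :: "('g \<times> 'x) measure" where
  "flow = distr (m \<Otimes>\<^sub>M \<mu>) (m \<Otimes>\<^sub>M \<mu>) (\<lambda>(g, x). (g, T g x))"

definition raw_deriv :: "'g \<times> 'x \<Rightarrow> ennreal" where
  "raw_deriv = RN_deriv (m \<Otimes>\<^sub>M \<mu>) flow"

lemma raw_deriv_measurable [measurable]: "raw_deriv \<in> borel_measurable (borel \<Otimes>\<^sub>M \<mu>)"
  using borel_measurable_RN_deriv[of "m \<Otimes>\<^sub>M \<mu>" flow]
  unfolding raw_deriv_def by (simp cong: measurable_cong_sets)

lemma nn_integral_flow:
  assumes [measurable]: "F \<in> borel_measurable (borel \<Otimes>\<^sub>M \<mu>)"
  shows "(\<integral>\<^sup>+p. F p \<partial>flow) = (\<integral>\<^sup>+g. \<integral>\<^sup>+x. F (g, T g x) \<partial>\<mu> \<partial>m)"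
proof -
  have "(\<integral>\<^sup>+p. F p \<partial>flow) = (\<integral>\<^sup>+p. F (fst p, T (fst p) (snd p)) \<partial>(m \<Otimes>\<^sub>M \<mu>))"
    unfolding flow_def by (subst nn_integral_distr) (auto simp: case_prod_unfold)
  also have "\<dots> = (\<integral>\<^sup>+g. \<integral>\<^sup>+x. F (g, T g x) \<partial>\<mu> \<partial>m)"
    by (subst prob_mu.nn_integral_fst[symmetric]) auto
  finally show ?thesis .
qed

lemma density_raw_deriv: "density (m \<Otimes>\<^sub>M \<mu>) raw_deriv = flow"
  unfolding raw_deriv_def
proof (rule m_mu.density_RN_deriv)
  show "sets flow = sets (m \<Otimes>\<^sub>M \<mu>)"
    by (simp add: flow_def)
  show "absolutely_continuous (m \<Otimes>\<^sub>M \<mu>) flow"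
    unfolding absolutely_continuous_def
  proof
    fix N assume N: "N \<in> null_sets (m \<Otimes>\<^sub>M \<mu>)"
    then have "N \<in> sets (m \<Otimes>\<^sub>M \<mu>)" by auto
    then have [measurable]: "N \<in> sets (borel \<Otimes>\<^sub>M \<mu>)"
      by (simp cong: sets_pair_measure_cong)
    have "AE p in m \<Otimes>\<^sub>M \<mu>. p \<notin> N"
      using N by (rule AE_not_in)
    then have "AE g in m. AE x in \<mu>. (g, x) \<notin> N"
      by (rule m_mu.AE_pair)
    then have "AE g in m. AE x in \<mu>. (g, T g x) \<notin> N"
      by (rule AE_mp) (auto intro!: AE_I2 AE_act)
    then have "AE g in m. (\<integral>\<^sup>+x. indicator N (g, T g x) \<partial>\<mu>) = 0"
    proof eventually_elim
      case (elim g)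
      then have "AE x in \<mu>. indicator N (g, T g x) = (0 :: ennreal)"
        by eventually_elim simp
      then show ?case
        by (subst nn_integral_0_iff_AE) auto
    qed
    then have "(\<integral>\<^sup>+g. \<integral>\<^sup>+x. indicator N (g, T g x) \<partial>\<mu> \<partial>m) = 0"
      by (subst nn_integral_0_iff_AE) auto
    moreover have "emeasure flow N = (\<integral>\<^sup>+p. indicator N p \<partial>flow)"
      by (subst nn_integral_indicator) (auto simp: flow_def)
    moreover have "(\<integral>\<^sup>+p. indicator N p \<partial>flow) = (\<integral>\<^sup>+g. \<integral>\<^sup>+x. indicator N (g, T g x) \<partial>\<mu> \<partial>m)"
      by (rule nn_integral_flow) measurable
    ultimately show "N \<in> null_sets flow"
      by (simp add: null_sets_def flow_def)
  qed
qed

lemma nn_integral_raw_deriv: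
  assumes [measurable]: "F \<in> borel_measurable (borel \<Otimes>\<^sub>M \<mu>)"
  shows "(\<integral>\<^sup>+g. \<integral>\<^sup>+x. raw_deriv (g, x) * F (g, x) \<partial>\<mu> \<partial>m) = (\<integral>\<^sup>+g. \<integral>\<^sup>+x. F (g, T g x) \<partial>\<mu> \<partial>m)"
proof -
  have "(\<integral>\<^sup>+g. \<integral>\<^sup>+x. raw_deriv (g, x) * F (g, x) \<partial>\<mu> \<partial>m) = (\<integral>\<^sup>+p. raw_deriv p * F p \<partial>(m \<Otimes>\<^sub>M \<mu>))"
    by (subst prob_mu.nn_integral_fst[symmetric]) auto
  also have "\<dots> = (\<integral>\<^sup>+p. F p \<partial>density (m \<Otimes>\<^sub>M \<mu>) raw_deriv)"
    by (subst nn_integral_density) auto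
  finally show ?thesis
    by (simp add: density_raw_deriv nn_integral_flow)
qed

text \<open>Both functions of \<open>g\<close> are densities of the same measure on the group. The
  exceptional null set depends on \<open>B\<close>.\<close>

lemma AE_raw_deriv:
  assumes [measurable]: "B \<in> sets \<mu>"
  shows "AE g in m. (\<integral>\<^sup>+x. raw_deriv (g, x) * indicator B x \<partial>\<mu>) = mass B g"
proof (rule density_unique)
  let ?r = "\<lambda>g. \<integral>\<^sup>+x. raw_deriv (g, x) * indicator B x \<partial>\<mu>"
  have [measurable]: "mass B \<in> borel_measurable borel"
    by (rule harm_measurable[OF harm_mass]) measurable
  show "?r \<in> borel_measurable m" "mass B \<in> borel_measurable m"
    by measurable
  show "density m ?r = density m (mass B)"
  proof (rule measure_eqI)
    fix A assume "A \<in> sets (density m ?r)"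
    then have [measurable]: "A \<in> sets borel" by simp
    have "emeasure (density m ?r) A
        = (\<integral>\<^sup>+g. (\<integral>\<^sup>+x. raw_deriv (g, x) * indicator B x \<partial>\<mu>) * indicator A g \<partial>m)"
      by (rule emeasure_density) auto
    also have "\<dots> = (\<integral>\<^sup>+g. \<integral>\<^sup>+x. raw_deriv (g, x) * (indicator B x * indicator A g) \<partial>\<mu> \<partial>m)"
      by (subst nn_integral_multc[symmetric]) (auto simp: mult.assoc)
    also have "\<dots> = (\<integral>\<^sup>+g. \<integral>\<^sup>+x. indicator B (T g x) * indicator A g \<partial>\<mu> \<partial>m)"
      using nn_integral_raw_deriv[of "\<lambda>p. indicator B (snd p) * indicator A (fst p)"] by simp
    also have "\<dots> = (\<integral>\<^sup>+g. mass B g * indicator A g \<partial>m)"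
      unfolding mass_def by (subst nn_integral_multc[symmetric]) auto
    also have "\<dots> = emeasure (density m (mass B)) A"
      by (rule emeasure_density[symmetric]) auto
    finally show "emeasure (density m ?r) A
        = emeasure (density m (mass B)) A" .
  qed simp
qed

text \<open>
  Smoothing by \<open>\<theta>\<close> turns the almost everywhere defined derivative into one that is a density of every
  translate and, for almost every point, harmonic in the group variable.
\<close>

definition rn_density :: "'g \<Rightarrow> 'x \<Rightarrow> ennreal" where
  "rn_density g x = (\<integral>\<^sup>+h. raw_deriv (g + h, x) \<partial>\<theta>)"

lemma rn_density_measurable [measurable (raw)]:
  assumes [measurable]: "a \<in> borel_measurable N" "b \<in> measurable N \<mu>"
  shows "(\<lambda>w. rn_density (a w) (b w)) \<in> borel_measurable N"
  unfolding rn_density_def by measurable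

text \<open>The almost everywhere identity holds at \<open>g + h\<close> for
  \<open>\<theta>\<close>-almost every \<open>h\<close>, because left translations preserve null
  sets and \<open>\<theta>\<close> has a density. Harmonicity of \<open>mass B\<close> then gives
  the value at every \<open>g\<close>.\<close>

lemma nn_integral_rn_density_indicator:
  assumes [measurable]: "B \<in> sets \<mu>"
  shows "(\<integral>\<^sup>+x. rn_density g x * indicator B x \<partial>\<mu>) = mass B g"
proof -
  have "(\<integral>\<^sup>+x. rn_density g x * indicator B x \<partial>\<mu>) = (\<integral>\<^sup>+x. \<integral>\<^sup>+h. raw_deriv (g + h, x) * indicator B x \<partial>\<theta> \<partial>\<mu>)"
    unfolding rn_density_def by (intro nn_integral_cong nn_integral_multc[symmetric]) measurable
  also have "\<dots> = (\<integral>\<^sup>+h. \<integral>\<^sup>+x. raw_deriv (g + h, x) * indicator B x \<partial>\<mu> \<partial>\<theta>)"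
    by (rule theta_mu.Fubini') measurable
  also have "\<dots> = (\<integral>\<^sup>+h. mass B (g + h) \<partial>\<theta>)"
    by (intro nn_integral_cong_AE AE_\<theta> AE_translate AE_raw_deriv) measurable
  also have "\<dots> = mass B g"
    using harm_mass[of B] by (simp add: harm_def)
  finally show ?thesis .
qed

lemma density_rn_density: "density \<mu> (rn_density g) = translate \<mu> T g"
proof (rule measure_eqI)
  show "sets (density \<mu> (rn_density g)) = sets (translate \<mu> T g)"
    by (simp add: translate_def)
  fix B assume "B \<in> sets (density \<mu> (rn_density g))"
  then have [measurable]: "B \<in> sets \<mu>" by simp
  show "emeasure (density \<mu> (rn_density g)) B = emeasure (translate \<mu> T g) B"
    by (simp add: emeasure_density emeasure_translate_eq nn_integral_rn_density_indicator)
qed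

lemma nn_integral_rn_density:
  assumes [measurable]: "F \<in> borel_measurable \<mu>"
  shows "(\<integral>\<^sup>+x. rn_density g x * F x \<partial>\<mu>) = (\<integral>\<^sup>+x. F (T g x) \<partial>\<mu>)"
proof -
  have "(\<integral>\<^sup>+x. rn_density g x * F x \<partial>\<mu>) = (\<integral>\<^sup>+x. F x \<partial>density \<mu> (rn_density g))"
    by (subst nn_integral_density) auto
  also have "\<dots> = (\<integral>\<^sup>+x. F (T g x) \<partial>\<mu>)"
    unfolding density_rn_density translate_def by (subst nn_integral_distr) auto
  finally show ?thesis .
qed

text \<open>Both are densities of \<open>flow\<close>, hence equal almost everywhere on the product;
  Fubini exchanges the two quantifiers.\<close>

lemma AE_raw_deriv_eq: "AE x in \<mu>. AE g in m. raw_deriv (g, x) = rn_density g x"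
proof -
  let ?R = "density (m \<Otimes>\<^sub>M \<mu>) raw_deriv"
  let ?D = "density (m \<Otimes>\<^sub>M \<mu>) (\<lambda>p. rn_density (fst p) (snd p))"
  have "AE p in m \<Otimes>\<^sub>M \<mu>. raw_deriv p = (\<lambda>p. rn_density (fst p) (snd p)) p"
  proof (rule m_mu.density_unique)
    show "?R = ?D"
    proof (rule measure_eqI)
      fix N assume "N \<in> sets (?R)"
      then have [measurable]: "N \<in> sets (borel \<Otimes>\<^sub>M \<mu>)"
        by (simp cong: sets_pair_measure_cong)
      have "emeasure (?R) N = (\<integral>\<^sup>+p. indicator N p \<partial>flow)"
        unfolding density_raw_deriv by (subst nn_integral_indicator) (auto simp: flow_def cong: sets_pair_measure_cong)
      also have "\<dots> = (\<integral>\<^sup>+g. \<integral>\<^sup>+x. indicator N (g, T g x) \<partial>\<mu> \<partial>m)"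
        by (rule nn_integral_flow) measurable
      also have "\<dots> = (\<integral>\<^sup>+g. \<integral>\<^sup>+x. rn_density g x * indicator N (g, x) \<partial>\<mu> \<partial>m)"
        by (intro nn_integral_cong nn_integral_rn_density[symmetric]) measurable
      also have "\<dots> = (\<integral>\<^sup>+p. rn_density (fst p) (snd p) * indicator N p \<partial>(m \<Otimes>\<^sub>M \<mu>))"
        by (subst prob_mu.nn_integral_fst[symmetric]) auto
      also have "\<dots> = emeasure (?D) N"
        by (rule emeasure_density[symmetric]) auto
      finally show "emeasure (?R) N
          = emeasure (?D) N" .
    qed simp
  qed measurable
  then have "AE g in m. AE x in \<mu>. raw_deriv (g, x) = rn_density g x"
    using m_mu.AE_pair by fastforce
  moreover have "{p \<in> space (m \<Otimes>\<^sub>M \<mu>). raw_deriv (fst p, snd p) = rn_density (fst p) (snd p)} \<in> sets (m \<Otimes>\<^sub>M \<mu>)"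
    by measurable
  ultimately show ?thesis
    using m_mu.AE_commute[of "\<lambda>g x. raw_deriv (g, x) = rn_density g x"] by blast
qed

lemma AE_rn_density_zero: "AE x in \<mu>. rn_density 0 x = 1"
proof (rule prob_mu.density_unique)
  show "density \<mu> (rn_density 0) = density \<mu> (\<lambda>_. 1)"
  proof (rule measure_eqI)
    fix B assume "B \<in> sets (density \<mu> (rn_density 0))"
    then have [measurable]: "B \<in> sets \<mu>" by simp
    show "emeasure (density \<mu> (rn_density 0)) B = emeasure (density \<mu> (\<lambda>_. 1)) B"
      by (simp add: emeasure_density nn_integral_rn_density_indicator mass_zero)
  qed simp
qed measurable

text \<open>The chain rule: both sides are densities of the translate by \<open>- g + h\<close>. The
  exceptional set depends on \<open>g\<close> and \<open>h\<close>.\<close>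

lemma AE_rn_density_cocycle: "AE x in \<mu>. rn_density (- g) x * rn_density h (T g x) = rn_density (- g + h) x"
proof (rule prob_mu.density_unique)
  let ?D = "density \<mu> (\<lambda>x. rn_density (- g) x * rn_density h (T g x))"
  show "?D = density \<mu> (rn_density (- g + h))"
  proof (rule measure_eqI)
    fix B assume "B \<in> sets (?D)"
    then have [measurable]: "B \<in> sets \<mu>" by simp
    have "emeasure (?D) B
        = (\<integral>\<^sup>+x. rn_density (- g) x * (rn_density h (T g x) * indicator B x) \<partial>\<mu>)"
      by (subst emeasure_density) (auto simp: mult.assoc)
    also have "\<dots> = (\<integral>\<^sup>+x. rn_density h (T g (T (- g) x)) * indicator B (T (- g) x) \<partial>\<mu>)"
      by (rule nn_integral_rn_density) measurable
    also have "\<dots> = (\<integral>\<^sup>+x. rn_density h x * indicator B (T (- g) x) \<partial>\<mu>)"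
      by (intro nn_integral_cong) (simp add: T_plus[symmetric] T_zero)
    also have "\<dots> = (\<integral>\<^sup>+x. indicator B (T (- g) (T h x)) \<partial>\<mu>)"
      by (rule nn_integral_rn_density) measurable
    also have "\<dots> = mass B (- g + h)"
      unfolding mass_def by (intro nn_integral_cong) (simp add: T_plus)
    also have "\<dots> = emeasure (density \<mu> (rn_density (- g + h))) B"
      by (simp add: emeasure_density nn_integral_rn_density_indicator)
    finally show "emeasure (?D) B
        = emeasure (density \<mu> (rn_density (- g + h))) B" .
  qed simp
qed measurable

definition orbit_fun :: "'x \<Rightarrow> 'g \<Rightarrow> real" where
  "orbit_fun x g = enn2real (rn_density g x)"

definition regular :: "'x \<Rightarrow> bool" where
  "regular x \<longleftrightarrow> x \<in> space \<mu> \<and> rn_density 0 x = 1 \<and> (AE g in m. raw_deriv (g, x) = rn_density g x)"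

lemma AE_regular: "AE x in \<mu>. regular x"
  using AE_space AE_rn_density_zero AE_raw_deriv_eq
  by eventually_elim (simp add: regular_def)

text \<open>\<open>rn_density\<close> is by definition the \<open>\<theta>\<close>-average of
  \<open>raw_deriv\<close>, and at a regular point the latter may be replaced by
  \<open>rn_density\<close> under the integral.\<close>

lemma regular_harm:
  assumes "regular x"
  shows "harm (\<lambda>g. rn_density g x)"
  unfolding harm_def
proof (intro conjI allI)
  have x [measurable]: "x \<in> space \<mu>"
    using assms by (simp add: regular_def)
  show "(\<lambda>g. rn_density g x) \<in> borel_measurable borel"
    by measurable
  fix g
  have "AE h in \<theta>. raw_deriv (g + h, x) = rn_density (g + h) x"
    using assms unfolding regular_def by (intro AE_\<theta> AE_translate) blast
  then have "(\<integral>\<^sup>+h. rn_density (g + h) x \<partial>\<theta>) = (\<integral>\<^sup>+h. raw_deriv (g + h, x) \<partial>\<theta>)"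
    by (intro nn_integral_cong_AE) auto
  then show "(\<integral>\<^sup>+h. rn_density (g + h) x \<partial>\<theta>) = rn_density g x"
    by (simp add: rn_density_def)
qed

text \<open>The Harnack inequality and the value 1 at the identity exclude infinite values.\<close>

lemma ennreal_orbit_fun:
  assumes "regular x"
  shows "ennreal (orbit_fun x g) = rn_density g x"
proof -
  have "compact {g}" by simp
  then obtain M where M: "M \<noteq> \<top>" "\<And>u x. harm u \<Longrightarrow> u 0 < \<top> \<Longrightarrow> x \<in> {g} \<Longrightarrow> u x \<le> M * u 0"
    using harnack by metis
  have "rn_density g x \<le> M * rn_density 0 x"
    using assms by (intro M(2)[OF regular_harm[OF assms]]) (auto simp: regular_def)
  then have "rn_density g x < \<top>"
    using M(1) assms by (auto simp: regular_def less_top top_unique)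
  then show ?thesis
    by (simp add: orbit_fun_def)
qed

lemma orbit_fun_Har:
  assumes "regular x"
  shows "orbit_fun x \<in> Har"
proof -
  have "orbit_fun x 0 = 1"
    using assms by (simp add: orbit_fun_def regular_def)
  then show ?thesis
    using regular_harm[OF assms] ennreal_orbit_fun[OF assms]
    by (auto simp: Har_def orbit_fun_def)
qed

text \<open>
  The cocycle identity holds for almost every group element at almost every point. Composing with a
  generic group element upgrades it to all group elements on a conull set.
\<close>

lemma conull_equivariant:
  obtains X0 where "X0 \<in> sets \<mu>" "space \<mu> - X0 \<in> null_sets \<mu>" "\<And>x. x \<in> X0 \<Longrightarrow> regular x"
    "\<And>x g h. x \<in> X0 \<Longrightarrow> T g x \<in> X0 \<Longrightarrow> orbit_fun (T g x) h = orbit_fun x (- g + h) / orbit_fun x (- g)"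
proof -
  obtain N where N: "N \<in> null_sets \<mu>" "\<And>x. x \<in> space \<mu> - N \<Longrightarrow> regular x"
    using AE_E3[OF AE_regular] by blast
  have [measurable]: "N \<in> sets \<mu>"
    using N(1) by auto
  obtain q :: "nat \<Rightarrow> 'g" where q: "closure (range q) = UNIV"
    by (rule dense_sequence)
  \<comment> \<open>The identity in the second variable is asked only on a dense sequence, which
    keeps the exceptional set null; continuity of the functions in \<open>Har\<close> extends it in
    \<open>cocycle\<close>.\<close>
  define good_pair where "good_pair g x \<longleftrightarrow> T g x \<notin> N \<and>
    (\<forall>j. rn_density (- g) x * rn_density (q j) (T g x) = rn_density (- g + q j) x)" for g x
  have "AE x in \<mu>. good_pair g x" for g
  proof -
    have "AE x in \<mu>. \<forall>j. rn_density (- g) x * rn_density (q j) (T g x) = rn_density (- g + q j) x"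
      unfolding AE_all_countable by (intro allI AE_rn_density_cocycle)
    moreover have "AE x in \<mu>. T g x \<notin> N"
      by (intro AE_act AE_not_in N)
    ultimately show ?thesis
      unfolding good_pair_def by eventually_elim simp
  qed
  then have "AE g in m. AE x in \<mu>. good_pair g x"
    by (rule AE_I2)
  moreover have "{p \<in> space (m \<Otimes>\<^sub>M \<mu>). good_pair (fst p) (snd p)} \<in> sets (m \<Otimes>\<^sub>M \<mu>)"
    unfolding good_pair_def by measurable
  ultimately have AE_good: "AE x in \<mu>. AE g in m. good_pair g x"
    using m_mu.AE_commute[of good_pair] by blast
  obtain N' where N': "N' \<in> null_sets \<mu>" "\<And>x. x \<in> space \<mu> - N' \<Longrightarrow> AE g in m. good_pair g x"
    using AE_E3[OF AE_good] by blast
  define X0 where "X0 = space \<mu> - (N \<union> N')"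
  have reg: "regular x" if "x \<in> X0" for x
    using that N(2) by (simp add: X0_def)
  have cocycle: "orbit_fun x (- g) * orbit_fun (T g x) h = orbit_fun x (- g + h)"
    if x: "regular x" and gp: "good_pair g x" for x g h
  proof -
    let ?H = "{h. orbit_fun x (- g) * orbit_fun (T g x) h = orbit_fun x (- g + h)}"
    have xs: "x \<in> space \<mu>" using x by (simp add: regular_def)
    have r: "regular (T g x)"
      using gp N(2) T_space[OF xs] by (simp add: good_pair_def)
    have c: "continuous_on UNIV (orbit_fun y)" if "regular y" for y
      by (rule equicont_imp_continuous[OF equicont_Har orbit_fun_Har[OF that]])
    have "ennreal (orbit_fun x (- g) * orbit_fun (T g x) (q j)) = ennreal (orbit_fun x (- g + q j))" for j
      using gp ennreal_orbit_fun[OF x] ennreal_orbit_fun[OF r]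
      by (simp add: good_pair_def ennreal_mult HarD(1)[OF orbit_fun_Har[OF x]] HarD(1)[OF orbit_fun_Har[OF r]])
    then have eq: "orbit_fun x (- g) * orbit_fun (T g x) (q j) = orbit_fun x (- g + q j)" for j
      by (subst (asm) ennreal_inj) (auto simp: HarD(1)[OF orbit_fun_Har[OF x]] HarD(1)[OF orbit_fun_Har[OF r]])
    have "closed ?H"
      by (intro closed_Collect_eq continuous_on_mult continuous_on_const c[OF r]
          continuous_on_compose2[OF c[OF x], of _ "\<lambda>h. - g + h"] continuous_intros) auto
    moreover have "range q \<subseteq> ?H"
      using eq by auto
    ultimately have "closure (range q) \<subseteq> ?H"
      by (intro closure_minimal)
    then show ?thesis
      using q by blast
  qed
  show ?thesis
  proof (rule that)
    show "X0 \<in> sets \<mu>"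
      using N' by (auto simp: X0_def)
    have "space \<mu> - X0 \<subseteq> N \<union> N'" by (auto simp: X0_def)
    then show "space \<mu> - X0 \<in> null_sets \<mu>"
      using N(1) N'(1) \<open>X0 \<in> sets \<mu>\<close> by (metis null_sets.Un null_sets_subset sets.compl_sets)
    show "regular x" if "x \<in> X0" for x
      using that by (rule reg)
    fix x g0 h assume x: "x \<in> X0" and y: "T g0 x \<in> X0"
    have xs: "x \<in> space \<mu>" using x by (simp add: X0_def)
    \<comment> \<open>\<open>good_pair g0 x\<close> itself may fail, so \<open>x\<close> and
      \<open>T g0 x\<close> are compared through a third point \<open>T (g + g0) x\<close> that is
      good for both. Right translation of null sets makes almost every \<open>g\<close>
      suitable.\<close>
    have "AE g in m. good_pair (g + g0) x"
      using N'(2)[of x] x by (intro AE_translate_right) (simp add: X0_def)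
    moreover have "AE g in m. good_pair g (T g0 x)"
      using N'(2)[of "T g0 x"] y by (simp add: X0_def)
    ultimately have "AE g in m. good_pair (g + g0) x \<and> good_pair g (T g0 x)"
      by eventually_elim simp
    then have "\<exists>g. good_pair (g + g0) x \<and> good_pair g (T g0 x)"
      by (rule AE_imp_ex)
    then obtain g where g: "good_pair (g + g0) x" "good_pair g (T g0 x)" by blast
    let ?u = "orbit_fun x" and ?v = "orbit_fun (T g0 x)" and ?w = "orbit_fun (T (g + g0) x)"
    have 1: "?u (- g0 + - g) * ?w (g + k) = ?u (- g0 + k)" for k
      using cocycle[OF reg[OF x] g(1), of "g + k"]
      by (simp add: minus_add add.assoc del: add_uminus_conv_diff)
    have 2: "?v (- g) * ?w (g + k) = ?v k" for k
      using cocycle[OF reg[OF y] g(2), of "g + k"] xs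
      by (simp add: T_plus add.assoc[symmetric])
    have pos: "0 < ?u k" "0 < ?v k" for k
      using Har_pos[OF orbit_fun_Har] reg x y by auto
    have v0: "?v 0 = 1"
      by (rule HarD(2)[OF orbit_fun_Har[OF reg[OF y]]])
    \<comment> \<open>Relations \<open>1\<close> and \<open>2\<close>, each at \<open>h\<close> and
      at the identity, eliminate \<open>?w\<close>.\<close>
    have "?v h * ?u (- g0) = ?v (- g) * ?w (g + h) * (?u (- g0 + - g) * ?w (g + 0))"
      using 1[of 0] 2[of h] by simp
    also have "\<dots> = (?v (- g) * ?w (g + 0)) * (?u (- g0 + - g) * ?w (g + h))"
      by (simp only: mult_ac)
    also have "\<dots> = ?u (- g0 + h)"
      using 1[of h] 2[of 0] v0 by simp
    finally show "?v h = ?u (- g0 + h) / ?u (- g0)"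
      using pos(1)[of "- g0"] by (simp add: field_simps)
  qed
qed

end


section \<open>Embedding a stationary space into the model\<close>

lemma standard_borel_separating:
  assumes "standard_borel M"
  obtains U :: "nat \<Rightarrow> 'x set" where "\<And>j. U j \<in> sets M"
    "\<And>x y. x \<in> space M \<Longrightarrow> y \<in> space M \<Longrightarrow> (\<And>j. x \<in> U j \<longleftrightarrow> y \<in> U j) \<Longrightarrow> x = y"
proof -
  obtain X where X: "completely_metrizable_space X" "second_countable X" "topspace X = space M"
    "sets M = sigma_sets (topspace X) {U. openin X U}"
    using assms unfolding standard_borel_def by blast
  have haus: "Hausdorff_space X"
    by (intro metrizable_imp_Hausdorff_space completely_metrizable_imp_metrizable_space X)
  obtain \<B> where \<B>: "countable \<B>" "\<forall>V\<in>\<B>. openin X V"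
    "\<forall>U x. openin X U \<and> x \<in> U \<longrightarrow> (\<exists>V\<in>\<B>. x \<in> V \<and> V \<subseteq> U)"
    using X(2) unfolding second_countable_def by (elim exE conjE)
  define U where "U = from_nat_into (insert {} \<B>)"
  have U: "range U = insert {} \<B>"
    unfolding U_def using \<B>(1) by (intro range_from_nat_into) auto
  show ?thesis
  proof (rule that)
    show "U j \<in> sets M" for j
    proof -
      have "U j \<in> insert {} \<B>"
        using U by blast
      then have "openin X (U j)"
        using \<B>(2) by auto
      then show ?thesis
        unfolding X(4) by auto
    qed
    fix x y assume xy: "x \<in> space M" "y \<in> space M" "\<And>j. x \<in> U j \<longleftrightarrow> y \<in> U j"
    show "x = y"
    proof (rule ccontr)
      assume "x \<noteq> y"
      then obtain V W where VW: "openin X V" "openin X W" "x \<in> V" "y \<in> W" "disjnt V W"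
        using haus xy(1,2) unfolding Hausdorff_space_def X(3) by blast
      then obtain V' where V': "V' \<in> \<B>" "x \<in> V'" "V' \<subseteq> V"
        using \<B>(3) by blast
      then obtain j where "V' = U j"
        using U by blast
      then show False
        using V' VW xy(3)[of j] by (auto simp: disjnt_def)
    qed
  qed
qed

context haar_measure
begin

text \<open>These properties let a measure be identified by its values on \<open>range B\<close>.
  Finite intersections of basic open sets lying in compact sets have them all.\<close>

lemma generating_sequence:
  obtains B :: "nat \<Rightarrow> 'g set" where "\<And>n. open (B n)" "\<And>n. emeasure m (B n) < \<infinity>"
    "Int_stable (range B)" "sets (borel :: 'g measure) = sigma_sets UNIV (range B)" "(\<Union>n. B n) = UNIV"
proof -
  obtain \<B> :: "'g set set" where \<B>: "countable \<B>" "topological_basis \<B>"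
    using ex_countable_basis by blast
  define \<C> where "\<C> = {b\<in>\<B>. \<exists>K. compact K \<and> b \<subseteq> K}"
  \<comment> \<open>\<open>F\<close> must be nonempty: the empty intersection is the whole group,
    whose measure may be infinite.\<close>
  define \<E> where "\<E> = (\<lambda>F. \<Inter>F) ` {F. F \<noteq> {} \<and> finite F \<and> F \<subseteq> \<C>}"
  have \<C>: "countable \<C>" "\<And>b. b \<in> \<C> \<Longrightarrow> open b"
    using \<B> by (auto simp: \<C>_def intro: topological_basis_open)
  have \<C>_basis: "\<exists>b\<in>\<C>. x \<in> b \<and> b \<subseteq> W" if W: "open W" "x \<in> W" for W x
  proof -
    obtain V K where "open V" "compact K" "x \<in> V" "V \<subseteq> K" "K \<subseteq> W"
      by (rule compact_neighbourhood[OF W])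
    moreover obtain b where "b \<in> \<B>" "x \<in> b" "b \<subseteq> V"
      by (rule topological_basisE[OF \<B>(2) \<open>open V\<close> \<open>x \<in> V\<close>])
    ultimately show ?thesis
      unfolding \<C>_def by blast
  qed
  have \<C>\<E>: "b \<in> \<E>" if "b \<in> \<C>" for b
    unfolding \<E>_def using that by (intro image_eqI[of _ _ "{b}"]) auto
  have \<E>_count: "countable \<E>"
  proof -
    have "countable {F. finite F \<and> F \<subseteq> \<C>}"
      by (rule countable_Collect_finite_subset[OF \<C>(1)])
    then have "countable {F. F \<noteq> {} \<and> finite F \<and> F \<subseteq> \<C>}"
      by (rule countable_subset[rotated]) auto
    then show ?thesis
      unfolding \<E>_def by (rule countable_image)
  qed
  have \<E>_open: "open E" if "E \<in> \<E>" for E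
    using that \<C>(2) unfolding \<E>_def by (auto intro!: open_Inter)
  have \<E>_ne: "\<E> \<noteq> {}"
    using \<C>_basis[of UNIV 0] \<C>\<E> by auto
  define B where "B = from_nat_into \<E>"
  have B: "range B = \<E>"
    unfolding B_def by (rule range_from_nat_into[OF \<E>_ne \<E>_count])
  then have B\<E>: "B n \<in> \<E>" for n
    by auto
  show ?thesis
  proof (rule that)
    show "open (B n)" for n
      by (rule \<E>_open[OF B\<E>])
    show "emeasure m (B n) < \<infinity>" for n
    proof -
      obtain F where F: "B n = \<Inter>F" "F \<noteq> {}" "F \<subseteq> \<C>"
        using B\<E>[of n] unfolding \<E>_def by blast
      from F(2) obtain b where "b \<in> F"
        by (auto simp only: ex_in_conv[symmetric])
      then have "b \<in> \<C>" using F(3) by (rule subsetD[rotated])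
      then obtain K where "compact K" "b \<subseteq> K"
        unfolding \<C>_def by auto
      then have "B n \<subseteq> K" using F(1) \<open>b \<in> F\<close> by auto
      then have "emeasure m (B n) \<le> emeasure m K"
        using compact_imp_borel[OF \<open>compact K\<close>] by (intro emeasure_mono) auto
      then show ?thesis
        using emeasure_compact_finite[OF \<open>compact K\<close>] by (auto intro: le_less_trans)
    qed
    show "Int_stable (range B)"
      unfolding B
    proof (rule Int_stableI)
      fix a b assume "a \<in> \<E>" "b \<in> \<E>"
      then obtain F F' where "a = \<Inter>F" "F \<noteq> {}" "finite F" "F \<subseteq> \<C>" "b = \<Inter>F'" "F' \<noteq> {}" "finite F'" "F' \<subseteq> \<C>"
        unfolding \<E>_def by blast
      then show "a \<inter> b \<in> \<E>"
        unfolding \<E>_def by (intro image_eqI[of _ _ "F \<union> F'"]) auto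
    qed
    show "(\<Union>n. B n) = UNIV"
      using \<C>_basis[of UNIV] \<C>\<E> B by blast
    have "topological_basis \<E>"
    proof (rule topological_basisI)
      show "\<exists>b\<in>\<E>. x \<in> b \<and> b \<subseteq> W" if "open W" "x \<in> W" for W x
        using \<C>_basis[OF that] \<C>\<E> by (auto 4 3)
    qed (rule \<E>_open)
    then have "(borel :: 'g measure) = sigma UNIV \<E>"
      by (rule borel_eq_countable_basis[OF \<E>_count])
    then have "sets (borel :: 'g measure) = sets (sigma UNIV \<E>)"
      by (rule arg_cong)
    also have "\<dots> = sigma_sets UNIV \<E>"
      by (rule sets_measure_of) simp
    finally show "sets (borel :: 'g measure) = sigma_sets UNIV (range B)"
      unfolding B .
  qed
qed

end

definition represented ::
  "'g::topological_group_add measure \<Rightarrow> 'k::metric_space set \<Rightarrow> ('g \<Rightarrow> 'k \<Rightarrow> 'k) \<Rightarrow> ('g \<Rightarrow> 'k \<Rightarrow> real) \<Rightarrow>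
   'x measure \<Rightarrow> ('g \<Rightarrow> 'x \<Rightarrow> 'x) \<Rightarrow> bool" where
  "represented \<theta> K act \<eta> \<mu> T \<longleftrightarrow> (\<exists>Xh \<mu>h.
     Xh \<subseteq> K \<and> compact Xh \<and> (\<forall>g. \<forall>x\<in>Xh. act g x \<in> Xh) \<and>
     sets \<mu>h = sets (restrict_space borel Xh) \<and> stationary_measure \<theta> \<mu>h act \<and>
     measurably_isomorphic \<mu> T \<mu>h act \<and> RN_cocycle_version \<mu>h act \<eta>)"

locale embedding = stationary m \<theta> f C \<mu> T
  for m \<theta> :: "'g::{topological_group_add, second_countable_topology, t2_space} measure" and f C
    and \<mu> :: "'x measure" and T +
  fixes B :: "nat \<Rightarrow> 'g set" and U :: "nat \<Rightarrow> 'x set" and q :: "nat \<Rightarrow> 'g"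
  assumes dense: "closure (range q) = UNIV"
    and B_open: "open (B n)" and B_finite: "emeasure m (B n) < \<infinity>"
    and B_stable: "Int_stable (range B)"
    and B_generates: "sets (borel :: 'g measure) = sigma_sets UNIV (range B)"
    and B_cover: "(\<Union>n. B n) = UNIV"
    and U_sets [measurable]: "U j \<in> sets \<mu>"
    and U_separates: "x \<in> space \<mu> \<Longrightarrow> y \<in> space \<mu> \<Longrightarrow> (\<And>j. x \<in> U j \<longleftrightarrow> y \<in> U j) \<Longrightarrow> x = y"
begin

lemma B_sets [measurable]: "B n \<in> sets borel"
  using B_open by simp

lemma integrable_B: "integrable m (indicat_real (B n))"
  using B_finite by (intro integrable_real_indicator) auto

text \<open>The index codes a pair of \<open>j\<close>, for a set \<open>U j\<close> of the space,
  and \<open>n\<close>, for a set \<open>B n\<close> of the group. Modulus and bound use only the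
  second component, so the model does not see the space.\<close>

sublocale compact_model m \<theta> f C "\<lambda>i. indicator (B (snd (prod_decode i)))"
    "\<lambda>i. measure m (B (snd (prod_decode i)))" q
  by standard (rule integrable_B dense)+

text \<open>The Haar measure of those \<open>h\<close> in the translate of \<open>B n\<close> by
  \<open>g\<close> for which \<open>T (- h) x\<close> lies in \<open>U j\<close>. Since
  \<open>g\<close> enters through the indicator of \<open>B n\<close> alone, the modulus of
  continuity is the same for all spaces.\<close>

definition visits :: "nat \<Rightarrow> nat \<Rightarrow> 'x \<Rightarrow> 'g \<Rightarrow> ennreal" where
  "visits n j x g = (\<integral>\<^sup>+h. indicator (B n) (- g + h) * indicator (U j) (T (- h) x) \<partial>m)"

definition visit :: "nat \<Rightarrow> nat \<Rightarrow> 'x \<Rightarrow> 'g \<Rightarrow> real" where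
  "visit n j x g = enn2real (visits n j x g)"

lemma visits_le: "visits n j x g \<le> emeasure m (B n)"
proof -
  have "visits n j x g \<le> (\<integral>\<^sup>+h. indicator (B n) (- g + h) \<partial>m)"
    unfolding visits_def by (intro nn_integral_mono) (auto simp: indicator_def)
  also have "\<dots> = (\<integral>\<^sup>+h. indicator (B n) h \<partial>m)"
    by (rule nn_integral_translate) measurable
  finally show ?thesis by simp
qed

lemma visits_fin: "visits n j x g < \<top>"
  using le_less_trans[OF visits_le B_finite] by simp

lemma visits_diff:
  assumes [measurable]: "x \<in> space \<mu>"
  shows "visits n j x g \<le> visits n j x h + shift_diff (indicator (B n)) (- g + h)"
proof -
  have "visits n j x g \<le> (\<integral>\<^sup>+k. indicator (B n) (- h + k) * indicator (U j) (T (- k) x)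
      + ennreal \<bar>indicat_real (B n) (- g + k) - indicator (B n) (- h + k)\<bar> \<partial>m)"
    unfolding visits_def by (intro nn_integral_mono) (auto simp: indicator_def)
  also have "\<dots> = visits n j x h + (\<integral>\<^sup>+k. ennreal \<bar>indicat_real (B n) (- g + k) - indicator (B n) (- h + k)\<bar> \<partial>m)"
    unfolding visits_def by (rule nn_integral_add) measurable
  also have "(\<integral>\<^sup>+k. ennreal \<bar>indicat_real (B n) (- g + k) - indicator (B n) (- h + k)\<bar> \<partial>m)
      = (\<integral>\<^sup>+k. ennreal \<bar>indicat_real (B n) (- g + (h + k)) - indicator (B n) (- h + (h + k))\<bar> \<partial>m)"
    by (rule nn_integral_translate[symmetric]) measurable
  also have "\<dots> = shift_diff (indicator (B n)) (- g + h)"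
    by (simp add: shift_diff_def add.assoc[symmetric])
  finally show ?thesis .
qed

lemma shift_diff_uminus:
  assumes [measurable]: "a \<in> borel_measurable borel"
  shows "shift_diff a (- g) = shift_diff a g"
proof -
  have "shift_diff a (- g) = (\<integral>\<^sup>+h. ennreal \<bar>a (- g + (g + h)) - a (g + h)\<bar> \<partial>m)"
    unfolding shift_diff_def by (rule nn_integral_translate[symmetric]) measurable
  then show ?thesis
    by (simp add: shift_diff_def add.assoc[symmetric] abs_minus_commute)
qed

lemma visit_ball:
  assumes x: "x \<in> space \<mu>"
  shows "visit n j x \<in> translation_ball (indicator (B n)) (measure m (B n))"
  unfolding translation_ball_def
proof (intro CollectI conjI allI)
  show "0 \<le> visit n j x g" for g
    by (simp add: visit_def)
  show "visit n j x g \<le> measure m (B n)" for g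
    unfolding visit_def measure_def using visits_le B_finite by (intro enn2real_mono) auto
  fix g h :: 'g
  have "- h + g = - (- g + h)"
    by (simp only: minus_add minus_minus)
  then have sym: "shift_diff (indicator (B n)) (- h + g) = shift_diff (indicator (B n)) (- g + h)"
    using shift_diff_uminus[of "indicator (B n)" "- g + h"] by simp
  have "\<bar>enn2real a - enn2real b\<bar> \<le> enn2real s"
    if "a \<le> b + s" "b \<le> a + s" "a < \<top>" "b < \<top>" "s < \<top>" for a b s
    using that by (cases a; cases b; cases s)
      (auto simp: ennreal_plus[symmetric] simp del: ennreal_plus)
  then show "\<bar>visit n j x g - visit n j x h\<bar> \<le> enn2real (shift_diff (indicator (B n)) (- g + h))"
    unfolding visit_def
    using visits_diff[OF x, of n j g h] visits_diff[OF x, of n j h g] visits_fin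
      shift_diff_finite[OF integrable_B] unfolding sym by blast
qed

lemma visit_equivariant:
  assumes x [measurable]: "x \<in> space \<mu>"
  shows "visit n j (T g x) h = visit n j x (- g + h)"
proof -
  have "visits n j x (- g + h) = (\<integral>\<^sup>+k. indicator (B n) (- h + (g + k)) * indicator (U j) (T (- (- g + (g + k))) x) \<partial>m)"
    by (simp add: visits_def minus_add add.assoc[symmetric])
  also have "\<dots> = (\<integral>\<^sup>+k. indicator (B n) (- h + (g + - g + k)) * indicator (U j) (T (- (- g + k)) x) \<partial>m)"
  proof -
    have "(\<integral>\<^sup>+k. indicator (B n) (- h + (g + k)) * indicator (U j) (T (- (- g + (g + k))) x) \<partial>m)
        = (\<integral>\<^sup>+k. indicator (B n) (- h + k) * indicator (U j) (T (- (- g + k)) x) \<partial>m)"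
      by (rule nn_integral_translate[of "\<lambda>k. indicator (B n) (- h + k) * indicator (U j) (T (- (- g + k)) x)"]) measurable
    then show ?thesis by simp
  qed
  also have "\<dots> = visits n j (T g x) h"
    unfolding visits_def by (simp add: minus_add T_plus[OF x])
  finally show ?thesis by (simp add: visit_def)
qed

lemma visit_measurable [measurable]: "(\<lambda>x. visit n j x g) \<in> borel_measurable \<mu>"
  unfolding visit_def visits_def by measurable

text \<open>The values at the identity are those of a measure with density on the sets
  \<open>B n\<close>, and so determine, for almost every \<open>h\<close>, whether
  \<open>T (- h) x\<close> lies in \<open>U j\<close>. One \<open>h\<close> serves all
  \<open>j\<close>; there \<open>T (- h)\<close> sends both points to the same point, and
  \<open>T h\<close> brings it back.\<close>

lemma visit_inj:
  assumes x [measurable]: "x \<in> space \<mu>" and y [measurable]: "y \<in> space \<mu>"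
    and eq: "\<And>n j. visit n j x 0 = visit n j y 0"
  shows "x = y"
proof -
  let ?d = "\<lambda>j z. density m (\<lambda>h. indicator (U j) (T (- h) z))"
  have "AE h in m. (indicator (U j) (T (- h) x) :: ennreal) = indicator (U j) (T (- h) y)" for j
  proof (rule density_unique)
    show "(?d j x) = (?d j y)"
    proof (rule measure_eqI_generator_eq_countable[OF B_stable, of UNIV])
      have dens: "emeasure (?d j z) (B n) = visits n j z 0"
        if [measurable]: "z \<in> space \<mu>" for z n
        by (subst emeasure_density) (auto simp: visits_def mult.commute)
      have "visits n j x 0 = visits n j y 0" for n
        using eq[of n j] visits_fin[of n j x 0] visits_fin[of n j y 0]
        by (cases "visits n j x 0"; cases "visits n j y 0") (auto simp: visit_def)
      then show "emeasure ((?d j x)) X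
          = emeasure ((?d j y)) X" if "X \<in> range B" for X
        using that dens x y by auto
      show "emeasure ((?d j x)) X \<noteq> \<infinity>" if "X \<in> range B" for X
        using that dens[OF x] visits_fin by (auto simp: less_top)
    qed (use B_cover in \<open>auto simp: B_generates\<close>)
  qed measurable
  then have "AE h in m. \<forall>j. (indicator (U j) (T (- h) x) :: ennreal) = indicator (U j) (T (- h) y)"
    unfolding AE_all_countable by blast
  then have "\<exists>h. \<forall>j. (indicator (U j) (T (- h) x) :: ennreal) = indicator (U j) (T (- h) y)"
    by (rule AE_imp_ex)
  then obtain h where h: "\<And>j. (indicator (U j) (T (- h) x) :: ennreal) = indicator (U j) (T (- h) y)"
    by blast
  have "T (- h) x = T (- h) y"
  proof (rule U_separates)
    fix j show "T (- h) x \<in> U j \<longleftrightarrow> T (- h) y \<in> U j"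
      using h[of j] by (auto simp: indicator_def split: if_splits)
  qed (intro T_space x y)+
  then have "T h (T (- h) x) = T h (T (- h) y)"
    by simp
  then show ?thesis
    by (simp add: T_plus[symmetric] T_zero x y)
qed

definition point :: "'x \<Rightarrow> nat \<Rightarrow> 'g \<Rightarrow> real" where
  "point x n = (case n of 0 \<Rightarrow> orbit_fun x | Suc i \<Rightarrow> visit (snd (prod_decode i)) (fst (prod_decode i)) x)"

definition embed :: "'x \<Rightarrow> nat \<Rightarrow> real" where
  "embed x = enc (point x)"

lemma point_points: "regular x \<Longrightarrow> point x \<in> points"
  unfolding points_iff by (auto simp: point_def orbit_fun_Har visit_ball regular_def)

lemma embed_model: "regular x \<Longrightarrow> embed x \<in> model"
  unfolding embed_def model_def using point_points by blast

lemma dec_embed: "regular x \<Longrightarrow> dec (embed x) = point x"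
  unfolding embed_def by (intro dec_enc point_points)

lemma embed_measurable [measurable]: "embed \<in> borel_measurable \<mu>"
proof (rule measurable_coordinatewise_then_product)
  fix i
  show "(\<lambda>x. embed x i) \<in> borel_measurable \<mu>"
    unfolding embed_def enc_def point_def orbit_fun_def
    by (cases "fst (prod_decode i)") simp_all
qed

lemma model_cocycle_embed: "regular x \<Longrightarrow> ennreal (model_cocycle g (embed x)) = rn_density (- g) x"
  by (simp add: model_cocycle_def dec_embed point_def ennreal_orbit_fun)

lemma embed_inj:
  assumes x: "regular x" and y: "regular y" and eq: "embed x = embed y"
  shows "x = y"
proof -
  have p: "point x = point y"
    using dec_embed[OF x] dec_embed[OF y] eq by simp
  have "visit n j x 0 = visit n j y 0" for n j
    using fun_cong[OF fun_cong[OF p, of "Suc (prod_encode (j, n))"], of 0] by (simp add: point_def)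
  then show ?thesis
    using x y by (intro visit_inj) (auto simp: regular_def)
qed

lemma model_act_measurable:
  "model_act g \<in> restrict_space borel model \<rightarrow>\<^sub>M restrict_space borel model"
proof (rule measurable_restrict_space2)
  have "continuous_on model (\<lambda>\<kappa>. (g, \<kappa>))"
    by (intro continuous_on_Pair continuous_on_const continuous_on_id)
  then have "continuous_on model (\<lambda>\<kappa>. (\<lambda>(g, \<kappa>). model_act g \<kappa>) (g, \<kappa>))"
    by (rule continuous_on_compose2[OF continuous_on_model_act]) auto
  then have "continuous_on model (model_act g)"
    by simp
  then show "model_act g \<in> borel_measurable (restrict_space borel model)"
    by (rule borel_measurable_continuous_on_restrict)
qed (auto simp: space_restrict_space model_act_model)

text \<open>The whole model serves as the compact invariant set, with the image of
  \<open>\<mu>\<close> under \<open>embed\<close> as measure. Each claim is pulled back to the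
  conull set \<open>X0\<close>.\<close>

theorem embedding: "represented \<theta> model model_act model_cocycle \<mu> T"
proof -
  obtain X0 where X0 [measurable]: "X0 \<in> sets \<mu>" and conull: "space \<mu> - X0 \<in> null_sets \<mu>"
    and reg: "\<And>x. x \<in> X0 \<Longrightarrow> regular x"
    and equi: "\<And>x g h. x \<in> X0 \<Longrightarrow> T g x \<in> X0 \<Longrightarrow> orbit_fun (T g x) h = orbit_fun x (- g + h) / orbit_fun x (- g)"
    using conull_equivariant by blast
  have X0s: "X0 \<subseteq> space \<mu>"
    using X0 by (rule sets.sets_into_space)
  have AE_X0: "AE x in \<mu>. x \<in> X0"
    using AE_not_in[OF conull] AE_space by eventually_elim auto
  have equivariant: "embed (T g x) = model_act g (embed x)" if x: "x \<in> X0" "T g x \<in> X0" for x g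
  proof -
    have "point (T g x) n h = point_act g (point x) n h" for n h
      using equi[OF x, of h] visit_equivariant[of x] x X0s
      by (cases n) (auto simp: point_def point_act_def)
    then have "point (T g x) = point_act g (point x)"
      by (intro ext)
    then show ?thesis
      by (simp add: embed_def model_act_def dec_enc point_points reg x)
  qed
  define N where "N = (restrict_space borel model :: (nat \<Rightarrow> real) measure)"
  define \<nu> where "\<nu> = distr (restrict_space \<mu> X0) N embed"
  have sets_\<nu> [simp, measurable_cong]: "sets \<nu> = sets N"
    by (simp add: \<nu>_def)
  have space_\<nu>: "space \<nu> = model"
    by (simp add: \<nu>_def N_def space_restrict_space)
  have space_N: "space N = model"
    by (simp add: N_def space_restrict_space)
  have space_X0: "space (restrict_space \<mu> X0) = X0"
    using X0s by (auto simp: space_restrict_space)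
  have emb [measurable]: "embed \<in> restrict_space \<mu> X0 \<rightarrow>\<^sub>M N"
    unfolding N_def
    by (intro measurable_restrict_space2 measurable_restrict_space1 embed_measurable)
       (auto simp: space_X0 embed_model reg)
  have act [measurable]: "model_act g \<in> N \<rightarrow>\<^sub>M N" for g
    unfolding N_def by (rule model_act_measurable)
  have nn: "(\<integral>\<^sup>+\<kappa>. F \<kappa> \<partial>\<nu>) = (\<integral>\<^sup>+x. F (embed x) * indicator X0 x \<partial>\<mu>)"
    if [measurable]: "F \<in> borel_measurable N" for F
    unfolding \<nu>_def by (subst nn_integral_distr) (auto simp: nn_integral_restrict_space)
  have pre [measurable]: "embed -` A \<inter> X0 \<in> sets \<mu>" if "A \<in> sets N" for A
    using measurable_sets[OF emb that] X0s by (simp add: space_X0 sets_restrict_space_iff)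
  have em: "emeasure \<nu> A = emeasure \<mu> (embed -` A \<inter> X0)" if A [measurable]: "A \<in> sets N" for A
  proof -
    have "emeasure \<nu> A = (\<integral>\<^sup>+\<kappa>. indicator A \<kappa> \<partial>\<nu>)"
      by simp
    also have "\<dots> = (\<integral>\<^sup>+x. indicator A (embed x) * indicator X0 x \<partial>\<mu>)"
      by (rule nn) measurable
    also have "\<dots> = (\<integral>\<^sup>+x. indicator (embed -` A \<inter> X0) x \<partial>\<mu>)"
      by (intro nn_integral_cong) (auto simp: indicator_def)
    finally show ?thesis using pre[OF A] by simp
  qed
  \<comment> \<open>Equivariance is available only where \<open>x\<close> and \<open>T g x\<close>
    both lie in \<open>X0\<close>; by quasi-invariance this is almost everywhere for each
    \<open>g\<close>.\<close>
  have translate_\<nu>: "emeasure (translate \<nu> model_act g) A = mass (embed -` A \<inter> X0) g"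
    if A [measurable]: "A \<in> sets N" for A g
  proof -
    have "emeasure (translate \<nu> model_act g) A = (\<integral>\<^sup>+\<kappa>. indicator A \<kappa> \<partial>distr \<nu> \<nu> (model_act g))"
      unfolding translate_def by (subst nn_integral_indicator) auto
    also have "\<dots> = (\<integral>\<^sup>+\<kappa>. indicator A (model_act g \<kappa>) \<partial>\<nu>)"
      by (subst nn_integral_distr) auto
    also have "\<dots> = (\<integral>\<^sup>+x. indicator A (model_act g (embed x)) * indicator X0 x \<partial>\<mu>)"
      by (rule nn) measurable
    also have "\<dots> = mass (embed -` A \<inter> X0) g"
      unfolding mass_def
    proof (rule nn_integral_cong_AE)
      show "AE x in \<mu>. indicator A (model_act g (embed x)) * indicator X0 x
          = (indicator (embed -` A \<inter> X0) (T g x) :: ennreal)"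
        using AE_X0 AE_act[OF AE_X0, of g]
        by eventually_elim (simp add: equivariant[symmetric] indicator_def)
    qed
    finally show ?thesis .
  qed
  have prob_\<nu>: "prob_space \<nu>"
  proof
    have "emeasure \<nu> (space \<nu>) = emeasure \<mu> (embed -` model \<inter> X0)"
      using em[OF sets.top[of N]] by (simp add: space_N space_\<nu>)
    also have "embed -` model \<inter> X0 = X0"
      using embed_model reg by auto
    also have "emeasure \<mu> X0 = 1"
      using AE_X0 by (intro prob_mu.emeasure_eq_1_AE) auto
    finally show "emeasure \<nu> (space \<nu>) = 1" .
  qed
  interpret \<nu>: prob_space \<nu> by (rule prob_\<nu>)
  have "stationary_measure \<theta> \<nu> model_act"
    unfolding stationary_measure_def
  proof (intro conjI ballI prob_\<nu>)
    fix A assume "A \<in> sets \<nu>"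
    then have A: "A \<in> sets N" by simp
    show "(\<integral>\<^sup>+g. emeasure (translate \<nu> model_act g) A \<partial>\<theta>) = emeasure \<nu> A"
      by (simp add: translate_\<nu>[OF A] em[OF A] mass_stationary pre[OF A])
  qed
  moreover have "measurably_isomorphic \<mu> T \<nu> model_act"
    unfolding measurably_isomorphic_def
  proof (intro exI conjI allI ballI impI)
    show "embed \<in> restrict_space \<mu> X0 \<rightarrow>\<^sub>M \<nu>"
      using emb by simp
    show "inj_on embed X0"
      using embed_inj reg by (intro inj_onI) blast
    show "distr (restrict_space \<mu> X0) \<nu> embed = \<nu>"
      unfolding \<nu>_def by (intro distr_cong) auto
  qed (use X0 conull equivariant in auto)
  moreover have "RN_cocycle_version \<nu> model_act model_cocycle"
    unfolding RN_cocycle_version_def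
  proof (intro conjI allI ballI)
    \<comment> \<open>By second countability the product sigma-algebra contains the Borel sets of
      the product, so continuity of the cocycle yields joint measurability.\<close>
    have id: "(\<lambda>p. p) \<in> (borel :: 'g measure) \<Otimes>\<^sub>M \<nu> \<rightarrow>\<^sub>M restrict_space borel (UNIV \<times> model)"
    proof (rule measurable_restrict_space2)
      have "snd \<in> (borel :: 'g measure) \<Otimes>\<^sub>M \<nu> \<rightarrow>\<^sub>M N"
        by (simp cong: measurable_cong_sets)
      then have snd: "snd \<in> (borel :: 'g measure) \<Otimes>\<^sub>M \<nu> \<rightarrow>\<^sub>M borel"
        unfolding N_def using measurable_restrict_space2_iff by blast
      have "(\<lambda>p. (fst p, snd p)) \<in> (borel :: 'g measure) \<Otimes>\<^sub>M \<nu> \<rightarrow>\<^sub>M borel \<Otimes>\<^sub>M borel"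
        by (intro measurable_Pair measurable_fst snd)
      then show "(\<lambda>p. p) \<in> (borel :: 'g measure) \<Otimes>\<^sub>M \<nu> \<rightarrow>\<^sub>M borel"
        by (simp add: borel_prod)
    qed (auto simp: space_pair_measure space_\<nu>)
    have "(\<lambda>(g, \<kappa>). model_cocycle g \<kappa>) \<in> borel_measurable (restrict_space borel (UNIV \<times> model))"
      by (rule borel_measurable_continuous_on_restrict[OF continuous_on_model_cocycle])
    from measurable_compose[OF id this]
    show meas: "(\<lambda>(g, \<kappa>). model_cocycle g \<kappa>) \<in> borel_measurable (borel \<Otimes>\<^sub>M \<nu>)" .
    show "0 < model_cocycle g \<kappa>" if "\<kappa> \<in> space \<nu>" for g \<kappa>
      using cocycle_on_model that unfolding cocycle_on_def space_\<nu> by blast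
    show "AE \<kappa> in \<nu>. ennreal (model_cocycle g \<kappa>) = RN_deriv \<nu> (translate \<nu> model_act (- g)) \<kappa>" for g
    proof (rule \<nu>.RN_deriv_unique)
      let ?D = "density \<nu> (\<lambda>\<kappa>. ennreal (model_cocycle g \<kappa>))"
      have "(\<lambda>\<kappa>. (\<lambda>(g, \<kappa>). model_cocycle g \<kappa>) (g, \<kappa>)) \<in> borel_measurable \<nu>"
        using measurable_compose[OF measurable_Pair1'[of g borel \<nu>] meas] by simp
      then have mc: "model_cocycle g \<in> borel_measurable \<nu>"
        by simp
      then show mc': "(\<lambda>\<kappa>. ennreal (model_cocycle g \<kappa>)) \<in> borel_measurable \<nu>"
        by measurable
      then have [measurable]: "(\<lambda>\<kappa>. ennreal (model_cocycle g \<kappa>)) \<in> borel_measurable N"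
        by (simp cong: measurable_cong_sets)
      show "?D = translate \<nu> model_act (- g)"
      proof (rule measure_eqI)
        show "sets (?D) = sets (translate \<nu> model_act (- g))"
          by (simp add: translate_def)
        fix A assume "A \<in> sets (?D)"
        then have A [measurable]: "A \<in> sets N" by simp
        have "emeasure (?D) A
            = (\<integral>\<^sup>+\<kappa>. ennreal (model_cocycle g \<kappa>) * indicator A \<kappa> \<partial>\<nu>)"
          by (rule emeasure_density[OF mc']) simp
        also have "\<dots> = (\<integral>\<^sup>+x. ennreal (model_cocycle g (embed x)) * indicator A (embed x) * indicator X0 x \<partial>\<mu>)"
          by (rule nn) measurable
        also have "\<dots> = (\<integral>\<^sup>+x. rn_density (- g) x * indicator (embed -` A \<inter> X0) x \<partial>\<mu>)"
          by (intro nn_integral_cong) (auto simp: indicator_def model_cocycle_embed reg)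
        also have "\<dots> = emeasure (translate \<nu> model_act (- g)) A"
          by (simp add: nn_integral_rn_density_indicator pre[OF A] translate_\<nu>[OF A])
        finally show "emeasure (?D) A
            = emeasure (translate \<nu> model_act (- g)) A" .
      qed
    qed
  qed
  moreover have "sets \<nu> = sets (restrict_space borel model)"
    by (simp add: N_def)
  ultimately show ?thesis
    unfolding represented_def using compact_model model_act_model by blast
qed

end

text \<open>\<open>B\<close> and \<open>q\<close> are fixed before any space is given and the
  separating sets \<open>U\<close> only afterwards, so one model serves all spaces.\<close>

theorem (in compact_kernel) universal_model_exists:
  "\<exists>(K :: (nat \<Rightarrow> real) set) act \<eta>. universal_compact_RN_model TYPE('y) \<theta> K act \<eta>"
proof -
  obtain q :: "nat \<Rightarrow> 'g" where q: "closure (range q) = UNIV"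
    by (rule dense_sequence)
  obtain B :: "nat \<Rightarrow> 'g set" where B: "\<And>n. open (B n)" "\<And>n. emeasure m (B n) < \<infinity>"
    "Int_stable (range B)" "sets (borel :: 'g measure) = sigma_sets UNIV (range B)" "(\<Union>n. B n) = UNIV"
    using generating_sequence by blast
  have "integrable m (indicat_real (B n))" for n
    using B(1,2) by (intro integrable_real_indicator) auto
  then interpret compact_model m \<theta> f C "\<lambda>i. indicator (B (snd (prod_decode i)))"
    "\<lambda>i. measure m (B (snd (prod_decode i)))" q
    using q by unfold_locales
  have "represented \<theta> model model_act model_cocycle \<mu> T"
    if st: "stationary_space \<theta> \<mu> T" for \<mu> :: "'y measure" and T
  proof -
    obtain U :: "nat \<Rightarrow> 'y set" where U: "\<And>j. U j \<in> sets \<mu>"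
      "\<And>x y. x \<in> space \<mu> \<Longrightarrow> y \<in> space \<mu> \<Longrightarrow> (\<And>j. x \<in> U j \<longleftrightarrow> y \<in> U j) \<Longrightarrow> x = y"
      using standard_borel_separating st unfolding stationary_space_def by metis
    interpret E: embedding m \<theta> f C \<mu> T B U q
      by unfold_locales (fact st q B U)+
    show ?thesis
      by (rule E.embedding)
  qed
  then have "universal_compact_RN_model TYPE('y) \<theta> model model_act model_cocycle"
    unfolding universal_compact_RN_model_def represented_def
    using compact_G_space_model cocycle_on_model harmonic_on_model continuous_on_model_cocycle
    by blast
  then show ?thesis by blast
qed


section \<open>Renaming points\<close>

locale renaming =
  fixes \<mu> :: "'x measure" and e :: "'x \<Rightarrow> 'y"
  assumes inj: "inj_on e (space \<mu>)"
begin

definition un :: "'y \<Rightarrow> 'x" where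
  "un = inv_into (space \<mu>) e"

text \<open>The sigma-algebra is carried along with the points, so \<open>e\<close> can be an
  arbitrary injection, unrelated to the Borel structure of its target.\<close>

definition copy :: "'y measure" where
  "copy = distr \<mu> (vimage_algebra (e ` space \<mu>) un \<mu>) e"

lemma un_e [simp]: "x \<in> space \<mu> \<Longrightarrow> un (e x) = x"
  unfolding un_def by (rule inv_into_f_f[OF inj])

lemma space_copy [simp]: "space copy = e ` space \<mu>"
  by (simp add: copy_def)

lemma un_space: "y \<in> e ` space \<mu> \<Longrightarrow> un y \<in> space \<mu>"
  by auto

lemma sets_copy: "sets copy = {un -` A \<inter> e ` space \<mu> |A. A \<in> sets \<mu>}"
  unfolding copy_def by (simp add: sets_vimage_algebra2 un_space)

lemma un_measurable [measurable]: "un \<in> copy \<rightarrow>\<^sub>M \<mu>"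
proof -
  have "un \<in> vimage_algebra (e ` space \<mu>) un \<mu> \<rightarrow>\<^sub>M \<mu>"
    by (rule measurable_vimage_algebra1) (auto simp: un_space)
  then show ?thesis
    by (simp add: copy_def)
qed

lemma e_measurable [measurable]: "e \<in> \<mu> \<rightarrow>\<^sub>M copy"
proof -
  have "(\<lambda>x. un (e x)) \<in> \<mu> \<rightarrow>\<^sub>M \<mu>"
    by (subst measurable_cong[where g = "\<lambda>x. x"]) auto
  then have "e \<in> \<mu> \<rightarrow>\<^sub>M vimage_algebra (e ` space \<mu>) un \<mu>"
    by (intro measurable_vimage_algebra2) auto
  then show ?thesis
    by (simp add: copy_def)
qed

lemma distr_e: "distr \<mu> copy e = copy"
  unfolding copy_def by (intro distr_cong) auto

lemma emeasure_copy: "A \<in> sets copy \<Longrightarrow> emeasure copy A = emeasure \<mu> (e -` A \<inter> space \<mu>)"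
  using emeasure_distr[OF e_measurable] by (simp add: distr_e)

text \<open>The Polish topology is pulled back along \<open>un\<close>; this makes \<open>e\<close>
  a homeomorphism.\<close>

lemma standard_borel_copy:
  assumes "standard_borel \<mu>"
  shows "standard_borel copy"
proof -
  obtain X where X: "completely_metrizable_space X" "second_countable X" "topspace X = space \<mu>"
    "sets \<mu> = sigma_sets (topspace X) {U. openin X U}"
    using assms unfolding standard_borel_def by blast
  define Y where "Y = pullback_topology (e ` space \<mu>) un X"
  have topY: "topspace Y = e ` space \<mu>"
    unfolding Y_def topspace_pullback_topology X(3) by auto
  have "homeomorphic_maps X Y e un"
    unfolding homeomorphic_maps_def
  proof (intro conjI ballI)
    show "continuous_map X Y e"
      unfolding continuous_map_def topY X(3)
    proof (intro conjI allI impI)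
      fix V assume "openin Y V"
      then obtain U where U: "openin X U" "V = un -` U \<inter> e ` space \<mu>"
        unfolding Y_def openin_pullback_topology by blast
      then have "{x \<in> space \<mu>. e x \<in> V} = U"
        using openin_subset[OF U(1)] X(3) by (auto dest: inj_onD[OF inj])
      then show "openin X {x \<in> space \<mu>. e x \<in> V}"
        using U(1) by simp
    qed auto
    show "continuous_map Y X un"
      unfolding continuous_map_def topY X(3)
    proof (intro conjI allI impI)
      fix U assume "openin X U"
      then show "openin Y {y \<in> e ` space \<mu>. un y \<in> U}"
        unfolding Y_def openin_pullback_topology by (intro exI[of _ U]) auto
    qed auto
  qed (auto simp: topY X(3))
  then have hom: "X homeomorphic_space Y"
    unfolding homeomorphic_space_def by blast
  have "sets copy = sigma_sets (e ` space \<mu>) {un -` A \<inter> e ` space \<mu> |A. A \<in> {U. openin X U}}"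
    unfolding sets_copy X(4) X(3) by (rule sigma_sets_vimage_commute) (auto simp: un_space)
  also have "{un -` A \<inter> e ` space \<mu> |A. A \<in> {U. openin X U}} = {V. openin Y V}"
    unfolding Y_def openin_pullback_topology by blast
  finally have "sets copy = sigma_sets (topspace Y) {V. openin Y V}"
    unfolding topY .
  then show ?thesis
    unfolding standard_borel_def
    using X(1,2) homeomorphic_completely_metrizable_space[OF hom] homeomorphic_space_second_countability[OF hom] topY
    by auto
qed

lemma stationary_space_copy:
  assumes "stationary_space \<theta> \<mu> T"
  shows "stationary_space \<theta> copy (\<lambda>g y. e (T g (un y)))"
proof -
  let ?a = "\<lambda>g y. e (T g (un y))"
  have T: "standard_borel \<mu>" "action_on T (space \<mu>)" "(\<lambda>(g, x). T g x) \<in> borel \<Otimes>\<^sub>M \<mu> \<rightarrow>\<^sub>M \<mu>" "prob_space \<mu>"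
    "\<And>A. A \<in> sets \<mu> \<Longrightarrow> (\<integral>\<^sup>+ g. emeasure (translate \<mu> T g) A \<partial>\<theta>) = emeasure \<mu> A"
    using assms unfolding stationary_space_def borel_action_def stationary_measure_def by blast+
  have Ts: "T g x \<in> space \<mu>" if "x \<in> space \<mu>" for g x
    using T(2) that unfolding action_on_def by blast
  have Tg: "T g \<in> \<mu> \<rightarrow>\<^sub>M \<mu>" for g
    using measurable_compose[OF measurable_Pair1' T(3), of g] by simp
  have "action_on ?a (space copy)"
    using T(2) unfolding action_on_def by auto
  moreover have "(\<lambda>(g, y). e (T g (un y))) \<in> borel \<Otimes>\<^sub>M copy \<rightarrow>\<^sub>M copy"
  proof -
    have "(\<lambda>p. (fst p, un (snd p))) \<in> borel \<Otimes>\<^sub>M copy \<rightarrow>\<^sub>M borel \<Otimes>\<^sub>M \<mu>"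
      by measurable
    from measurable_compose[OF measurable_compose[OF this T(3)] e_measurable] show ?thesis
      by (simp add: case_prod_unfold)
  qed
  moreover have "prob_space copy"
    using prob_space.prob_space_distr[OF T(4) e_measurable] by (simp add: distr_e)
  moreover have "(\<integral>\<^sup>+ g. emeasure (translate copy ?a g) A \<partial>\<theta>) = emeasure copy A"
    if A: "A \<in> sets copy" for A
  proof -
    have A': "e -` A \<inter> space \<mu> \<in> sets \<mu>"
      using measurable_sets[OF e_measurable A] .
    have act: "(?a g) \<in> copy \<rightarrow>\<^sub>M copy" for g
      by (rule measurable_compose[OF measurable_compose[OF un_measurable Tg] e_measurable])
    have "emeasure (translate copy ?a g) A = emeasure (translate \<mu> T g) (e -` A \<inter> space \<mu>)" for g
    proof -
      have "emeasure (translate copy ?a g) A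
          = emeasure copy ((?a g) -` A \<inter> space copy)"
        unfolding translate_def by (rule emeasure_distr[OF act A])
      also have "\<dots> = emeasure \<mu> (e -` ((?a g) -` A \<inter> space copy) \<inter> space \<mu>)"
        by (rule emeasure_copy[OF measurable_sets[OF act A]])
      also have "e -` ((?a g) -` A \<inter> space copy) \<inter> space \<mu> = T g -` (e -` A \<inter> space \<mu>) \<inter> space \<mu>"
      proof (rule set_eqI)
        fix x show "x \<in> e -` ((?a g) -` A \<inter> space copy) \<inter> space \<mu>
            \<longleftrightarrow> x \<in> T g -` (e -` A \<inter> space \<mu>) \<inter> space \<mu>"
          by (cases "x \<in> space \<mu>") (simp_all add: Ts imageI)
      qed
      also have "emeasure \<mu> \<dots> = emeasure (translate \<mu> T g) (e -` A \<inter> space \<mu>)"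
        unfolding translate_def by (rule emeasure_distr[OF Tg A', symmetric])
      finally show ?thesis .
    qed
    then show ?thesis
      using T(5)[OF A'] emeasure_copy[OF A] by simp
  qed
  ultimately show ?thesis
    unfolding stationary_space_def borel_action_def stationary_measure_def
    using standard_borel_copy[OF T(1)] by blast
qed

lemma measurably_isomorphic_copy:
  assumes iso: "measurably_isomorphic copy (\<lambda>g y. e (T g (un y))) \<nu> act"
  shows "measurably_isomorphic \<mu> T \<nu> act"
proof -
  obtain X0 \<iota> where X0: "X0 \<in> sets copy" "space copy - X0 \<in> null_sets copy"
    and \<iota>: "\<iota> \<in> restrict_space copy X0 \<rightarrow>\<^sub>M \<nu>" "inj_on \<iota> X0"
    and equi: "\<forall>g. \<forall>x\<in>X0. e (T g (un x)) \<in> X0 \<longrightarrow> \<iota> (e (T g (un x))) = act g (\<iota> x)"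
    and distr: "distr (restrict_space copy X0) \<nu> \<iota> = \<nu>"
    using iso unfolding measurably_isomorphic_def by blast
  define Z where "Z = e -` X0 \<inter> space \<mu>"
  let ?D = "distr (restrict_space \<mu> Z) (restrict_space copy X0) e"
  have Z [measurable]: "Z \<in> sets \<mu>"
    unfolding Z_def using measurable_sets[OF e_measurable X0(1)] .
  have X0s: "X0 \<subseteq> e ` space \<mu>"
    using sets.sets_into_space[OF X0(1)] by simp
  have e_Z: "e \<in> restrict_space \<mu> Z \<rightarrow>\<^sub>M restrict_space copy X0"
    by (intro measurable_restrict_space2 measurable_restrict_space1 e_measurable)
       (auto simp: space_restrict_space Z_def)
  have distr_Z: "?D = restrict_space copy X0"
  proof (rule measure_eqI)
    fix A assume "A \<in> sets (?D)"
    then have A: "A \<in> sets (restrict_space copy X0)" by simp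
    then have A': "A \<in> sets copy" "A \<subseteq> X0"
      using sets_restrict_space_iff[of X0 copy A] sets.Int_space_eq2[OF X0(1)] X0(1) by simp_all
    have "emeasure (?D) A
        = emeasure (restrict_space \<mu> Z) (e -` A \<inter> space (restrict_space \<mu> Z))"
      by (rule emeasure_distr[OF e_Z A])
    also have "e -` A \<inter> space (restrict_space \<mu> Z) = e -` A \<inter> space \<mu>"
      using A'(2) by (auto simp: space_restrict_space Z_def)
    also have "emeasure (restrict_space \<mu> Z) \<dots> = emeasure \<mu> (e -` A \<inter> space \<mu>)"
      using A'(2) Z by (intro emeasure_restrict_space) (auto simp: Z_def)
    also have "\<dots> = emeasure (restrict_space copy X0) A"
      using emeasure_restrict_space[of X0 copy A] sets.Int_space_eq2[OF X0(1)] X0(1) A'(2)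
        emeasure_copy[OF A'(1)] by simp
    finally show "emeasure (?D) A
        = emeasure (restrict_space copy X0) A" .
  qed simp
  show ?thesis
    unfolding measurably_isomorphic_def
  proof (intro exI[of _ Z] exI[of _ "\<lambda>x. \<iota> (e x)"] conjI allI ballI impI Z)
    have "emeasure \<mu> (space \<mu> - Z) = emeasure copy (space copy - X0)"
      using X0 by (subst emeasure_copy) (auto simp: Z_def intro!: arg_cong[where f = "emeasure \<mu>"])
    then show "space \<mu> - Z \<in> null_sets \<mu>"
      using X0(2) Z by (simp add: null_sets_def)
    show "(\<lambda>x. \<iota> (e x)) \<in> restrict_space \<mu> Z \<rightarrow>\<^sub>M \<nu>"
      by (rule measurable_compose[OF e_Z \<iota>(1)])
    show "inj_on (\<lambda>x. \<iota> (e x)) Z"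
      using \<iota>(2) inj unfolding Z_def inj_on_def by auto
    show "\<iota> (e (T g x)) = act g (\<iota> (e x))" if "x \<in> Z" "T g x \<in> Z" for g x
      using equi[rule_format, of "e x" g] that unfolding Z_def by simp
    have "distr (restrict_space \<mu> Z) \<nu> (\<iota> \<circ> e) = distr (?D) \<nu> \<iota>"
      by (rule distr_distr[OF \<iota>(1) e_Z, symmetric])
    then show "distr (restrict_space \<mu> Z) \<nu> (\<lambda>x. \<iota> (e x)) = \<nu>"
      unfolding distr_Z distr by (simp add: o_def)
  qed
qed

end

text \<open>A point is determined by the set of indices \<open>j\<close> with the point in
  \<open>U j\<close>, and there are as many sets of naturals as reals.\<close>

lemma standard_borel_inj_real:
  fixes M :: "'x measure"
  assumes "standard_borel M"
  obtains e :: "'x \<Rightarrow> real" where "inj_on e (space M)"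
proof -
  obtain U :: "nat \<Rightarrow> 'x set" where U: "\<And>x y. x \<in> space M \<Longrightarrow> y \<in> space M \<Longrightarrow> (\<And>j. x \<in> U j \<longleftrightarrow> y \<in> U j) \<Longrightarrow> x = y"
    using standard_borel_separating[OF assms] by metis
  obtain b :: "nat set \<Rightarrow> real" where b: "bij b"
    using nat_sets_eqpoll_reals unfolding eqpoll_def by blast
  show ?thesis
  proof (rule that, rule inj_onI)
    fix x y assume xy: "x \<in> space M" "y \<in> space M" "b {j. x \<in> U j} = b {j. y \<in> U j}"
    then have "{j. x \<in> U j} = {j. y \<in> U j}"
      using bij_is_inj[OF b] by (simp add: inj_eq)
    then show "x = y"
      using xy(1,2) by (intro U) auto
  qed
qed

text \<open>The space is copied to a set of reals and represented there; composing the isomorphism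
  with \<open>e\<close> leaves the model untouched.\<close>

lemma universal_compact_RN_model_transfer:
  assumes real: "universal_compact_RN_model TYPE(real) \<theta> K act \<eta>"
  shows "universal_compact_RN_model TYPE('x) \<theta> K act \<eta>"
  unfolding universal_compact_RN_model_def
proof (intro conjI allI impI)
  fix \<mu> :: "'x measure" and T
  assume st: "stationary_space \<theta> \<mu> T"
  then have "standard_borel \<mu>"
    by (simp add: stationary_space_def)
  then obtain e :: "'x \<Rightarrow> real" where "inj_on e (space \<mu>)"
    by (rule standard_borel_inj_real)
  then interpret renaming \<mu> e
    by unfold_locales
  have "represented \<theta> K act \<eta> copy (\<lambda>g y. e (T g (un y)))"
    using real stationary_space_copy[OF st] unfolding universal_compact_RN_model_def represented_def by blast
  then show "\<exists>Xh \<mu>h. Xh \<subseteq> K \<and> compact Xh \<and> (\<forall>g. \<forall>x\<in>Xh. act g x \<in> Xh) \<and>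
      sets \<mu>h = sets (restrict_space borel Xh) \<and> stationary_measure \<theta> \<mu>h act \<and>
      measurably_isomorphic \<mu> T \<mu>h act \<and> RN_cocycle_version \<mu>h act \<eta>"
    unfolding represented_def using measurably_isomorphic_copy by blast
qed (use real in \<open>simp_all add: universal_compact_RN_model_def\<close>)

theorem corollary1p5:
  fixes \<theta> m :: "'g::{topological_group_add, second_countable_topology, t2_space} measure"
    and p :: ennreal and f :: "'g \<Rightarrow> real"
  assumes "measured_group \<theta>"
    and "left_haar_measure m"
    and "1 < p"
    and "Lp_compact m p f" and "AE x in m. 0 \<le> f x"
    and "\<theta> = density m (\<lambda>x. ennreal (f x))"
  shows "(\<exists>(K :: (nat \<Rightarrow> real) set) act \<eta>.
            universal_compact_RN_model TYPE(real) \<theta> K act \<eta>) \<and>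
         (\<forall>(K :: (nat \<Rightarrow> real) set) act \<eta>.
            universal_compact_RN_model TYPE(real) \<theta> K act \<eta> \<longrightarrow>
            universal_compact_RN_model TYPE('x) \<theta> K act \<eta>)"
proof (rule conjI)
  obtain C where C: "compact C" "AE x in m. x \<notin> C \<longrightarrow> f x = 0" and "f \<in> borel_measurable m"
    using assms(4) unfolding Lp_compact_def by blast
  interpret haar_measure m
    using assms(1,2) unfolding measured_group_def by unfold_locales auto
  have [measurable]: "f \<in> borel_measurable borel"
    using \<open>f \<in> borel_measurable m\<close> by simp
  have [measurable]: "C \<in> sets borel"
    using compact_imp_borel[OF C(1)] .
  \<comment> \<open>Sign and support of \<open>f\<close> are known only almost everywhere;
    \<open>k\<close> is a representative for which they hold everywhere, as
    \<open>compact_kernel\<close> demands.\<close>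
  define k where "k x = indicator C x * max 0 (f x)" for x
  have [measurable]: "k \<in> borel_measurable borel"
    unfolding k_def[abs_def] by measurable
  have \<theta>: "\<theta> = density m (\<lambda>x. ennreal (k x))"
    unfolding assms(6)
  proof (rule density_cong)
    show "AE x in m. ennreal (f x) = ennreal (k x)"
      using C(2) assms(5) by eventually_elim (auto simp: k_def indicator_def)
  qed measurable
  have semigroup: "S = UNIV"
    if "closed S" "\<And>x y. x \<in> S \<Longrightarrow> y \<in> S \<Longrightarrow> x + y \<in> S" "emeasure \<theta> S = 1" for S
    using assms(1) that unfolding measured_group_def admissible_def by blast
  interpret compact_kernel m \<theta> k C
  proof (intro compact_kernel.intro compact_kernel_axioms.intro haar_measure_axioms)
    show "prob_space \<theta>"
      using assms(1) unfolding measured_group_def by blast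
    show "0 \<le> k x" for x
      by (simp add: k_def)
    show "k x = 0" if "x \<notin> C" for x
      using that by (simp add: k_def)
    show "k \<in> borel_measurable borel"
      by measurable
    show "S = UNIV" if "closed S" "\<And>x y. x \<in> S \<Longrightarrow> y \<in> S \<Longrightarrow> x + y \<in> S" "emeasure \<theta> S = 1" for S
      using semigroup[OF that(1) _ that(3)] that(2) by blast
  qed (fact C(1), fact \<theta>)
  show "\<exists>(K :: (nat \<Rightarrow> real) set) act \<eta>. universal_compact_RN_model TYPE(real) \<theta> K act \<eta>"
    by (rule universal_model_exists)
  show "\<forall>(K :: (nat \<Rightarrow> real) set) act \<eta>.
      universal_compact_RN_model TYPE(real) \<theta> K act \<eta> \<longrightarrow> universal_compact_RN_model TYPE('x) \<theta> K act \<eta>"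
    by (intro allI impI) (rule universal_compact_RN_model_transfer)
qed

end
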